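(* Let $\delta>0$ be a fixed small constant and $B>0$ a constant. There are constants $c_1,c_2,C,C_{B,\delta}>0$ depending only on $\delta$ and $B$ such that the following holds. Let $H_N$ be a deterministic $N\times N$ real symmetric (resp. complex Hermitian) matrix and let $P_N$ be a deterministic $N\times N$ real symmetric (resp. complex Hermitian) matrix of rank $M=o(N)$, with $\|H_N\|\le B$ and $\|P_N\|\le B$. Let the nonzero eigenvalues of $P_N$ be $\theta_1\ge\dots\ge\theta_{M_1}>0>\theta_{M_1+1}\ge\dots\ge\theta_M$, and put $\tilde P_M=\mathrm{diag}(\theta_1,\dots,\theta_M)$. Let $U$ be a Haar-distributed $N\times N$ orthogonal (resp. unitary) matrix, let $\tilde W_N=U^*H_NU+P_N$, and denote its eigenvalues by $\lambda_1(\tilde W_N)\ge\dots\ge\lambda_N(\tilde W_N)$. Let $1\le i\le M$ be such that $$m_N^{-1}\Big(\frac1{\theta_i}\Big)\ge\lambda_1(H_N)+2\delta\ \text{ if }\theta_i>0,\qquad m_N^{-1}\Big(\frac1{\theta_i}\Big)\le\lambda_N(H_N)-2\delta\ \text{ if }\theta_i<0 .$$ Set $\tilde\lambda_i=\lambda_i(\tilde W_N)$ if $\theta_i>0$ and $\tilde\lambda_i=\lambda_{N-M+i}(\tilde W_N)$ if $\theta_i<0$. Let $v_i$ be a unit eigenvector of $\tilde W_N$ for the eigenvalue $\tilde\lambda_i$ (any one, if $\tilde\lambda_i$ is not simple), and let $\tilde v_i$ be the projection of $v_i$ onto the span of the eigenvectors of $P_N$ with nonzero eigenvalues, written in coordinates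 as a vector of length $M$ (see context). Then for any $0\le\epsilon\le\delta$ ($\epsilon$ may depend on $M$ and $N$), with probability at least $1-Ce^{-c_1N\epsilon^2+c_2M}$, both of the following hold: (1) $$\left|\,\|\tilde v_i\|^2+\frac1{\theta_i^2\,m_N'\big(m_N^{-1}(\frac1{\theta_i})\big)}\right|\le\epsilon\, C_{B,\delta};$$ (2) $$\left\|\tilde P_M\tilde v_i-\theta_i\tilde v_i\right\|\le\epsilon\, C_{B,\delta}.$$
   Context: $\|\cdot\|$ is the operator norm for matrices and the Euclidean norm for vectors. The ordered eigenvalues of $H_N$ are $\lambda_1(H_N)\ge\dots\ge\lambda_N(H_N)$. The Stieltjes transform of the empirical eigenvalue distribution of $H_N$ is $$m_N(z)=\frac1N\sum_{k=1}^N\frac1{z-\lambda_k(H_N)},\qquad z\in(-\infty,\lambda_N(H_N))\cup(\lambda_1(H_N),\infty).$$ It is strictly decreasing on each of the two intervals, $m_N'$ is its derivative, and $m_N^{-1}:\mathbb R\setminus\{0\}\to\mathbb R$ denotes its inverse, mapping $(0,\infty)$ onto $(\lambda_1(H_N),\infty)$ and $(-\infty,0)$ onto $(-\infty,\lambda_N(H_N))$. Coordinates for $\tilde v_i$: fix a deterministic $N\times M$ matrix $V$ whose $j$-th column is a unit eigenvector of $P_N$ for $\theta_j$, with orthonormal columns, so that $P_N=V\tilde P_MV^*$; then $\tilde v_i=V^*v_i$. (If $P_N=\mathrm{diag}(\theta_1,\dots,\theta_M,0,\dots,0)$, then $\tilde v_i$ consists of the first $M$ coordinates of $v_i$.) The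 rank $M=M(N)$ may grow with $N$; the assumption $M=o(N)$ refers to the sequence $N\to\infty$, and the constants do not depend on $N$, $M$, $\epsilon$, $i$ or on the matrices. *)

theory Defs
  imports
    "HOL-Probability.Probability_Measure"
    "HOL-Library.Landau_Symbols"
    "Jordan_Normal_Form.Schur_Decomposition"
    "Jordan_Normal_Form.DL_Rank"
begin

text \<open>
  All notions are polymorphic over the scalars; they are used only for \<^typ>\<open>real\<close>, where
  \<^const>\<open>mat_adjoint\<close> is the transpose, and for \<^typ>\<open>complex\<close>, where it is the conjugate transpose.
\<close>

definition hermitian_mat :: "nat \<Rightarrow> 'a::conjugatable_field mat \<Rightarrow> bool" where
  "hermitian_mat n A \<longleftrightarrow> A \<in> carrier_mat n n \<and> mat_adjoint A = A"

definition euclid_norm :: "'a::real_normed_field vec \<Rightarrow> real" where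
  "euclid_norm v = L2_set (\<lambda>i. norm (vec_index v i)) {..<dim_vec v}"

definition mat_opnorm :: "'a::real_normed_field mat \<Rightarrow> real" where
  "mat_opnorm A = (SUP v \<in> {v \<in> carrier_vec (dim_col A). euclid_norm v \<le> 1}. euclid_norm (A *\<^sub>v v))"

text \<open>
  The eigenvalues of a Hermitian matrix, in decreasing order and repeated according to
  multiplicity. The list is unique because the order is total on the reals; it exists for
  Hermitian matrices by the spectral theorem. Entries of the list are addressed from 1.
\<close>

definition eigval_list :: "'a::real_normed_field mat \<Rightarrow> real list" where
  "eigval_list A =
     (THE ls. sorted_wrt (\<ge>) ls \<and> char_poly A = (\<Prod>l\<leftarrow>ls. [:- of_real l, 1:]))"

definition eigval :: "'a::real_normed_field mat \<Rightarrow> nat \<Rightarrow> real" where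
  "eigval A k = eigval_list A ! (k - 1)"

definition nonzero_eigval :: "'a::real_normed_field mat \<Rightarrow> nat \<Rightarrow> real" where
  "nonzero_eigval A j = filter (\<lambda>l. l \<noteq> 0) (eigval_list A) ! (j - 1)"

definition stieltjes :: "'a::real_normed_field mat \<Rightarrow> real \<Rightarrow> real" where
  "stieltjes H z = (1 / real (dim_row H)) * (\<Sum>k=1..dim_row H. 1 / (z - eigval H k))"

text \<open>Only meaningful for nonzero arguments.\<close>

definition stieltjes_inv :: "'a::real_normed_field mat \<Rightarrow> real \<Rightarrow> real" where
  "stieltjes_inv H y =
     (if y > 0 then the_inv_into {eigval H 1 <..} (stieltjes H) y
      else the_inv_into {..< eigval H (dim_row H)} (stieltjes H) y)"

text \<open>The orthogonal group for real scalars, the unitary group for complex scalars.\<close>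

definition unitary_group :: "nat \<Rightarrow> 'a::conjugatable_field mat set" where
  "unitary_group n = {U \<in> carrier_mat n n. mat_adjoint U * U = 1\<^sub>m n \<and> U * mat_adjoint U = 1\<^sub>m n}"

text \<open>The Borel sets of the space of square matrices, identified with families of entries.\<close>

definition mat_borel :: "nat \<Rightarrow> 'a::real_normed_field mat measure" where
  "mat_borel n = vimage_algebra (carrier_mat n n)
     (\<lambda>A. \<lambda>ij \<in> {..<n} \<times> {..<n}. A $$ ij) (PiM ({..<n} \<times> {..<n}) (\<lambda>_. borel))"

text \<open>
  \<^term>\<open>\<mu>\<close> is the law of a Haar-distributed matrix: a Borel probability measure on the compact
  group that is invariant under left translations.
\<close>

definition haar_distribution ::
    "nat \<Rightarrow> 'a::{conjugatable_field, real_normed_field} mat measure \<Rightarrow> bool" where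
  "haar_distribution n \<mu> \<longleftrightarrow>
     prob_space \<mu> \<and>
     sets \<mu> = sets (restrict_space (mat_borel n) (unitary_group n)) \<and>
     (\<forall>Q \<in> unitary_group n. distr \<mu> \<mu> (\<lambda>U. Q * U) = \<mu>)"

text \<open>
  ``With probability at least \<^term>\<open>p\<close>, \<^term>\<open>Q\<close> holds'', phrased through an event contained in
  \<^term>\<open>{\<omega>. Q \<omega>}\<close>, so that no measurability of that set has to be known in advance.
\<close>

definition holds_with_prob_ge :: "'w measure \<Rightarrow> real \<Rightarrow> ('w \<Rightarrow> bool) \<Rightarrow> bool" where
  "holds_with_prob_ge \<mu> p Q \<longleftrightarrow> (\<exists>E \<in> sets \<mu>. measure \<mu> E \<ge> p \<and> (\<forall>\<omega>\<in>E. Q \<omega>))"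

text \<open>
  \<^term>\<open>V\<close> has orthonormal columns, the \<^term>\<open>j\<close>-th being an eigenvector of \<^term>\<open>P\<close> for its
  \<^term>\<open>j\<close>-th nonzero eigenvalue (columns of a matrix are numbered from 0 in the library).
\<close>

definition nonzero_eigenbasis ::
    "nat \<Rightarrow> 'a::{conjugatable_field, real_normed_field} mat \<Rightarrow> nat \<Rightarrow> 'a mat \<Rightarrow> bool" where
  "nonzero_eigenbasis n P m V \<longleftrightarrow>
     V \<in> carrier_mat n m \<and> mat_adjoint V * V = 1\<^sub>m m \<and>
     (\<forall>j\<in>{1..m}. eigenvector P (col V (j - 1)) (of_real (nonzero_eigval P j)))"

definition nonzero_eigval_diag :: "'a::real_normed_field mat \<Rightarrow> nat \<Rightarrow> 'a mat" where
  "nonzero_eigval_diag P m = mat_diag m (\<lambda>j. of_real (nonzero_eigval P (j + 1)))"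

end

theory Submission
  imports Defs
begin

text \<open>
  For a fixed vector \<open>p\<close>, the random vector \<open>y = S\<^sup>* U V p\<close>, with \<open>S\<close> an eigenbasis of \<open>H\<close>, has a law
  invariant under rotations in the coordinate planes. Differentiating this invariance at angle 0,
  for the function \<open>Re (y\<^sub>i cnj y\<^sub>j) exp (t F)\<close> with \<open>F = \<Sum> a\<^sub>k \<bar>y\<^sub>k\<bar>\<^sup>2\<close>, gives
  \<open>E ((\<bar>y\<^sub>i\<bar>\<^sup>2 - \<bar>y\<^sub>j\<bar>\<^sup>2) exp (t F)) = 2 t (a\<^sub>i - a\<^sub>j) E ((Re (y\<^sub>i cnj y\<^sub>j))\<^sup>2 exp (t F))\<close>.
  Multiplied by \<open>a\<^sub>i - a\<^sub>j\<close> and summed over \<open>i\<close> and \<open>j\<close>, this bounds the logarithmic derivative of the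
  moment generating function of \<open>F\<close>, so \<open>F\<close> is sub-Gaussian with variance of order \<open>1 / N\<close>.
  A net of \<open>exp (O(M))\<close> points of the sphere makes the bound uniform: for \<open>X = S\<^sup>* U V\<close> and
  \<open>z = m\<^sub>N\<^sup>-\<^sup>1(1 / \<theta>\<^sub>i)\<close>, the forms \<open>X\<^sup>* (z - D)\<^sup>-\<^sup>1 X\<close> and \<open>X\<^sup>* (z - D)\<^sup>-\<^sup>2 X\<close>, with \<open>D\<close> the diagonal matrix of the
  eigenvalues of \<open>H\<close>, are \<open>\<epsilon>\<close>-close to \<open>1 / \<theta>\<^sub>i\<close> and \<open>- m\<^sub>N'(z)\<close> times the identity.

  The rest is deterministic. Counting dimensions in the min-max principle puts the outlier
  \<open>\<lambda>\<close> within \<open>O(\<epsilon>)\<close> of \<open>z\<close>. In the eigenbasis of \<open>H\<close> the eigenvector is \<open>(\<lambda> - D)\<^sup>-\<^sup>1 X \<Theta> w\<close> where \<open>w\<close> is its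
  projection; applying \<open>X\<^sup>*\<close> yields \<open>w \<approx> \<Theta> w / \<theta>\<^sub>i\<close>, and taking norms yields \<open>1 \<approx> - m\<^sub>N'(z) \<theta>\<^sub>i\<^sup>2 \<bar>w\<bar>\<^sup>2\<close>.
  Negative outliers follow on changing the sign of all matrices, and real matrices are treated as
  complex ones, since only real rotations were used.
\<close>

section \<open>Concentration of rotation invariant quadratic forms\<close>

text \<open>The forms are controlled only at the deterministic point z, although the outlier sits at
  an unknown random place. No net in the spectral parameter is needed: \<open>1 / (x - h)\<close> is
  monotone in x, so moving z by a fixed multiple of \<open>\<epsilon>\<close> outweighs the random
  error, and the gap \<open>2 * \<delta>\<close> bounds the change of the resolvent between z and
  the outlier. Two forms occur because the resolvent determines the direction of w, and its square,
  through the norm of the eigenvector, the length of w. The \<open>\<theta>\<^sub>j\<close> may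
  coincide or cluster and the outlier may be multiple, which rules out arguments about simple
  eigenvalues or about continuity in a parameter. Dimension counts are insensitive to ties, and the
  identities for w hold for every eigenvector; the good event is fixed before the eigenvector is
  chosen. The claim must also hold for \<open>\<epsilon>\<close> too large for the localisation.
  Both errors are then bounded by constants, which enlarging \<open>C\<^sub>B\<close>
  absorbs.\<close>

lemma (in prob_space) has_field_derivative_expectation:
  fixes g g' :: "real \<Rightarrow> 'a \<Rightarrow> real"
  assumes int: "\<And>t. integrable M (g t)"
    and der: "\<And>t \<omega>. \<omega> \<in> space M \<Longrightarrow> ((\<lambda>t. g t \<omega>) has_field_derivative g' t \<omega>) (at t)"
    and bd: "\<And>t \<omega>. \<omega> \<in> space M \<Longrightarrow> \<bar>t - t0\<bar> \<le> 1 \<Longrightarrow> \<bar>g' t \<omega>\<bar> \<le> C"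
    and meas: "g' t0 \<in> borel_measurable M"
  shows "((\<lambda>t. expectation (g t)) has_field_derivative expectation (g' t0)) (at t0)"
  unfolding has_field_derivative_iff tendsto_at_iff_sequentially
proof (intro allI impI)
  fix X :: "nat \<Rightarrow> real"
  assume ne: "\<forall>i. X i \<in> UNIV - {t0}" and lim: "X \<longlonglongrightarrow> t0"
  have "\<forall>\<^sub>F i in sequentially. dist (X i) t0 < 1" using lim by (rule tendstoD) simp
  then obtain n0 where n0: "\<And>i. i \<ge> n0 \<Longrightarrow> dist (X i) t0 < 1"
    by (auto simp: eventually_sequentially)
  \<comment> \<open>The first \<open>n0\<close> terms are dropped so that all difference quotients
    are taken within distance 1 of \<open>t0\<close>; there \<open>bd\<close> and the mean value
    inequality make the constant \<open>C\<close> a dominating function.\<close>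
  define Y where "Y = (\<lambda>i. X (i + n0))"
  have Yne: "Y i \<noteq> t0" and Y1: "\<bar>Y i - t0\<bar> \<le> 1" for i
    using ne n0[of "i + n0"] by (auto simp: Y_def dist_real_def less_imp_le)
  have Ylim: "Y \<longlonglongrightarrow> t0" unfolding Y_def using lim by (rule LIMSEQ_ignore_initial_segment)
  let ?q = "\<lambda>i \<omega>. (g (Y i) \<omega> - g t0 \<omega>) / (Y i - t0)"
  have "(\<lambda>i. expectation (?q i)) \<longlonglongrightarrow> expectation (g' t0)"
  proof (rule integral_dominated_convergence[where w = "\<lambda>_. C"])
    show "g' t0 \<in> borel_measurable M" by (fact meas)
    show "?q i \<in> borel_measurable M" for i
      using int[THEN borel_measurable_integrable] by measurable
    show "AE \<omega> in M. (\<lambda>i. ?q i \<omega>) \<longlonglongrightarrow> g' t0 \<omega>"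
    proof (rule AE_I2)
      fix \<omega> assume "\<omega> \<in> space M"
      from der[OF this, of t0] have
        "((\<lambda>t. (g t \<omega> - g t0 \<omega>) / (t - t0)) \<longlongrightarrow> g' t0 \<omega>) (at t0)"
        unfolding has_field_derivative_iff .
      then show "(\<lambda>i. ?q i \<omega>) \<longlonglongrightarrow> g' t0 \<omega>"
        unfolding tendsto_at_iff_sequentially using Ylim Yne by (auto simp: o_def)
    qed
    show "AE \<omega> in M. norm (?q i \<omega>) \<le> C" for i
    proof (rule AE_I2)
      fix \<omega> assume \<omega>: "\<omega> \<in> space M"
      have "norm (g (Y i) \<omega> - g t0 \<omega>) \<le> C * norm (Y i - t0)"
      proof (rule field_differentiable_bound[of "cball t0 1" "\<lambda>t. g t \<omega>" "\<lambda>t. g' t \<omega>"])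
        show "norm (g' t \<omega>) \<le> C" if "t \<in> cball t0 1" for t
          using bd[OF \<omega>, of t] that by (auto simp: dist_real_def abs_minus_commute)
        show "((\<lambda>t. g t \<omega>) has_field_derivative g' t \<omega>) (at t within cball t0 1)" for t
          using der[OF \<omega>] by (rule has_field_derivative_at_within)
      qed (use Y1[of i] in \<open>auto simp: dist_real_def abs_minus_commute\<close>)
      then show "norm (?q i \<omega>) \<le> C" using Yne[of i] by (simp add: field_simps)
    qed
  qed simp
  also have "(\<lambda>i. expectation (?q i)) = (\<lambda>i. (expectation (g (Y i)) - expectation (g t0)) / (Y i - t0))"
    by (simp only: integral_divide_zero Bochner_Integration.integral_diff[OF int int])
  finally show "((\<lambda>t. (expectation (g t) - expectation (g t0)) / (t - t0)) \<circ> X)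
      \<longlonglongrightarrow> expectation (g' t0)"
    unfolding Y_def o_def by (rule LIMSEQ_offset[of _ n0])
qed

lemma abs_diff_le_add:
  fixes a b :: real
  assumes "\<bar>a\<bar> \<le> p" "\<bar>b\<bar> \<le> q"
  shows "\<bar>a - b\<bar> \<le> p + q"
  using assms by linarith

text \<open>In the application \<open>D\<close> is the difference of two squared moduli,
  \<open>x\<close> the real part of one coordinate times the conjugate of the other,
  \<open>b\<close> the difference of their weights, and \<open>\<psi>\<close> twice the rotation
  angle. The left side of \<open>inv\<close> does not depend on \<open>\<psi>\<close>, so its
  derivative at 0 vanishes.\<close>

lemma (in prob_space) integration_by_parts_rotation:
  fixes D x F :: "'a \<Rightarrow> real" and b t :: real
  assumes [measurable]: "D \<in> borel_measurable M" "x \<in> borel_measurable M" "F \<in> borel_measurable M"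
    and bounds: "\<And>\<omega>. \<omega> \<in> space M \<Longrightarrow> \<bar>D \<omega>\<bar> \<le> R \<and> \<bar>x \<omega>\<bar> \<le> R \<and> \<bar>F \<omega>\<bar> \<le> R"
    and inv: "\<And>\<psi>. expectation (\<lambda>\<omega>. (sin \<psi> / 2 * D \<omega> + cos \<psi> * x \<omega>) *
        exp (t * (F \<omega> - b * ((1 - cos \<psi>) / 2 * D \<omega> + sin \<psi> * x \<omega>)))) =
        expectation (\<lambda>\<omega>. x \<omega> * exp (t * F \<omega>))"
  shows "expectation (\<lambda>\<omega>. D \<omega> * exp (t * F \<omega>)) = 2 * t * b * expectation (\<lambda>\<omega>. (x \<omega>)\<^sup>2 * exp (t * F \<omega>))"
proof -
  obtain \<omega>0 where "\<omega>0 \<in> space M" using not_empty by auto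
  then have R0: "R \<ge> 0" using bounds[of \<omega>0] by linarith
  have alg: "d * e + e * - (c * a) * a = (d - c * a\<^sup>2) * e" for a c d e :: real
    by (simp add: algebra_simps power2_eq_square)
  let ?A = "\<lambda>\<psi> \<omega>. sin \<psi> / 2 * D \<omega> + cos \<psi> * x \<omega>"
  let ?E = "\<lambda>\<psi> \<omega>. exp (t * (F \<omega> - b * ((1 - cos \<psi>) / 2 * D \<omega> + sin \<psi> * x \<omega>)))"
  let ?g = "\<lambda>\<psi> \<omega>. ?A \<psi> \<omega> * ?E \<psi> \<omega>"
  \<comment> \<open>The derivative of
    \<open>(1 - cos \<psi>) / 2 * D \<omega> + sin \<psi> * x \<omega>\<close> in
    \<open>\<psi>\<close> is again \<open>?A \<psi> \<omega>\<close>; hence the square.\<close>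
  let ?g' = "\<lambda>\<psi> \<omega>. (cos \<psi> / 2 * D \<omega> - sin \<psi> * x \<omega> - t * b * (?A \<psi> \<omega>)\<^sup>2) * ?E \<psi> \<omega>"
  let ?K = "exp (\<bar>t\<bar> * (R + \<bar>b\<bar> * (2 * R)))"
  have lin: "\<bar>c1 * D \<omega> + c2 * x \<omega>\<bar> \<le> 2 * R" if "\<omega> \<in> space M" "\<bar>c1\<bar> \<le> 1" "\<bar>c2\<bar> \<le> 1" for c1 c2 \<omega>
  proof -
    have "\<bar>c1 * D \<omega>\<bar> \<le> 1 * R" "\<bar>c2 * x \<omega>\<bar> \<le> 1 * R"
      unfolding abs_mult using bounds[OF that(1)] that R0 by (intro mult_mono; simp)+
    then show ?thesis by linarith
  qed
  have cs: "\<bar>sin \<psi> / 2\<bar> \<le> 1" "\<bar>cos \<psi> / 2\<bar> \<le> 1" for \<psi> :: real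
    by (insert abs_sin_le_one[of \<psi>] abs_cos_le_one[of \<psi>], linarith+)
  have cs3: "\<bar>(1 - cos \<psi>) / 2\<bar> \<le> 1" for \<psi> :: real
  proof (rule abs_leI)
    show "(1 - cos \<psi>) / 2 \<le> 1" by (simp add: field_simps, insert cos_ge_minus_one[of \<psi>], linarith)
    show "- ((1 - cos \<psi>) / 2) \<le> 1" by (simp add: field_simps, insert cos_le_one[of \<psi>], linarith)
  qed
  have A: "\<bar>?A \<psi> \<omega>\<bar> \<le> 2 * R" if "\<omega> \<in> space M" for \<psi> \<omega>
    using lin[OF that cs(1) abs_cos_le_one, of \<psi> \<psi>] by simp
  have A': "\<bar>cos \<psi> / 2 * D \<omega> - sin \<psi> * x \<omega>\<bar> \<le> 2 * R" if "\<omega> \<in> space M" for \<psi> \<omega>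
    using lin[OF that cs(2)[of \<psi>], of "- sin \<psi>"] by simp
  have E: "?E \<psi> \<omega> \<le> ?K" if "\<omega> \<in> space M" for \<psi> \<omega>
  proof -
    have "\<bar>b * ((1 - cos \<psi>) / 2 * D \<omega> + sin \<psi> * x \<omega>)\<bar> \<le> \<bar>b\<bar> * (2 * R)"
      unfolding abs_mult by (intro mult_left_mono lin[OF that cs3]) auto
    then have "\<bar>F \<omega> - b * ((1 - cos \<psi>) / 2 * D \<omega> + sin \<psi> * x \<omega>)\<bar> \<le> R + \<bar>b\<bar> * (2 * R)"
      using bounds[OF that] by (intro abs_diff_le_add) auto
    then have "\<bar>t * (F \<omega> - b * ((1 - cos \<psi>) / 2 * D \<omega> + sin \<psi> * x \<omega>))\<bar> \<le> \<bar>t\<bar> * (R + \<bar>b\<bar> * (2 * R))"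
      unfolding abs_mult by (intro mult_left_mono) auto
    then show ?thesis by simp
  qed
  have int: "integrable M (?g \<psi>)" for \<psi>
  proof (rule integrable_const_bound[where B = "2 * R * ?K"])
    show "AE \<omega> in M. norm (?g \<psi> \<omega>) \<le> 2 * R * ?K"
      unfolding real_norm_def abs_mult[of _ "?E \<psi> _"] abs_exp_cancel
      using R0 by (intro AE_I2 mult_mono A E) auto
  qed measurable
  have "((\<lambda>\<psi>. expectation (?g \<psi>)) has_field_derivative expectation (?g' 0)) (at 0)"
  proof (rule has_field_derivative_expectation[OF int, where C = "(2 * R + \<bar>t * b\<bar> * (2 * R)\<^sup>2) * ?K"])
    show "((\<lambda>\<psi>. ?g \<psi> \<omega>) has_field_derivative ?g' \<psi> \<omega>) (at \<psi>)" for \<psi> \<omega>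
    proof -
      have "((\<lambda>\<psi>. ?A \<psi> \<omega>) has_field_derivative (cos \<psi> / 2 * D \<omega> - sin \<psi> * x \<omega>)) (at \<psi>)"
        by (auto intro!: derivative_eq_intros)
      moreover have "((\<lambda>\<psi>. t * (F \<omega> - b * ((1 - cos \<psi>) / 2 * D \<omega> + sin \<psi> * x \<omega>)))
          has_field_derivative (- (t * b * ?A \<psi> \<omega>))) (at \<psi>)"
        by (rule derivative_eq_intros refl | simp)+
      ultimately show ?thesis
        by (rule DERIV_mult[OF _ DERIV_fun_exp, THEN DERIV_cong]) (rule alg)
    qed
    show "\<bar>?g' \<psi> \<omega>\<bar> \<le> (2 * R + \<bar>t * b\<bar> * (2 * R)\<^sup>2) * ?K" if "\<omega> \<in> space M" for \<psi> \<omega>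
    proof -
      have "(?A \<psi> \<omega>)\<^sup>2 \<le> (2 * R)\<^sup>2" using A[OF that, of \<psi>] R0 by (intro power2_le_iff_abs_le[THEN iffD2]) auto
      then have "\<bar>t * b * (?A \<psi> \<omega>)\<^sup>2\<bar> \<le> \<bar>t * b\<bar> * (2 * R)\<^sup>2"
        unfolding abs_mult[of "t * b"] by (intro mult_left_mono) auto
      then have "\<bar>cos \<psi> / 2 * D \<omega> - sin \<psi> * x \<omega> - t * b * (?A \<psi> \<omega>)\<^sup>2\<bar> \<le> 2 * R + \<bar>t * b\<bar> * (2 * R)\<^sup>2"
        by (rule abs_diff_le_add[OF A'[OF that]])
      then show ?thesis unfolding abs_mult[of _ "?E \<psi> \<omega>"] abs_exp_cancel using R0
        by (intro mult_mono E[OF that]) auto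
    qed
  qed measurable
  moreover have "((\<lambda>\<psi>. expectation (?g \<psi>)) has_field_derivative 0) (at 0)"
    unfolding inv by simp
  ultimately have z: "expectation (?g' 0) = 0" by (rule DERIV_unique)
  have g'0: "?g' 0 = (\<lambda>\<omega>. (D \<omega> * exp (t * F \<omega>)) / 2 - t * b * ((x \<omega>)\<^sup>2 * exp (t * F \<omega>)))"
    by (rule ext) (simp add: left_diff_distrib)
  have u: "integrable M (\<lambda>\<omega>. D \<omega> * exp (t * F \<omega>))" and v: "integrable M (\<lambda>\<omega>. (x \<omega>)\<^sup>2 * exp (t * F \<omega>))"
  proof -
    have eF: "exp (t * F \<omega>) \<le> exp (\<bar>t\<bar> * R)" if "\<omega> \<in> space M" for \<omega>
    proof -
      have "\<bar>t * F \<omega>\<bar> \<le> \<bar>t\<bar> * R" unfolding abs_mult using bounds[OF that] by (intro mult_left_mono) auto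
      then show ?thesis by simp
    qed
    show "integrable M (\<lambda>\<omega>. D \<omega> * exp (t * F \<omega>))"
    proof (rule integrable_const_bound[where B = "R * exp (\<bar>t\<bar> * R)"])
      show "AE \<omega> in M. norm (D \<omega> * exp (t * F \<omega>)) \<le> R * exp (\<bar>t\<bar> * R)"
        unfolding real_norm_def abs_mult[of "D _"] abs_exp_cancel
        using bounds R0 by (intro AE_I2 mult_mono eF) auto
    qed measurable
    show "integrable M (\<lambda>\<omega>. (x \<omega>)\<^sup>2 * exp (t * F \<omega>))"
    proof (rule integrable_const_bound[where B = "R\<^sup>2 * exp (\<bar>t\<bar> * R)"])
      show "AE \<omega> in M. norm ((x \<omega>)\<^sup>2 * exp (t * F \<omega>)) \<le> R\<^sup>2 * exp (\<bar>t\<bar> * R)"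
        unfolding real_norm_def abs_mult[of "_\<^sup>2"] abs_exp_cancel
        using bounds R0 by (intro AE_I2 mult_mono eF) (auto simp: power2_le_iff_abs_le)
    qed measurable
  qed
  have "expectation (?g' 0) = expectation (\<lambda>\<omega>. D \<omega> * exp (t * F \<omega>)) / 2
      - t * b * expectation (\<lambda>\<omega>. (x \<omega>)\<^sup>2 * exp (t * F \<omega>))"
    unfolding g'0 using u v by (subst Bochner_Integration.integral_diff) simp_all
  with z show ?thesis by linarith
qed

lemma (in prob_space) integrable_bounded:
  fixes f :: "'a \<Rightarrow> real"
  assumes "f \<in> borel_measurable M" "\<And>\<omega>. \<omega> \<in> space M \<Longrightarrow> \<bar>f \<omega>\<bar> \<le> C"
  shows "integrable M f"
  using assms by (intro integrable_const_bound[where B = C]) auto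

text \<open>A covariance written through pairs. It turns a centred weighted sum into differences
  \<open>p i - p j\<close>, the combinations that the rotation identity controls.\<close>

lemma half_double_sum_diff_prod:
  fixes a p :: "nat \<Rightarrow> real"
  shows "(\<Sum>i<N. \<Sum>j<N. (a i - a j) * (p i - p j)) / 2 =
    real N * (\<Sum>k<N. a k * p k) - (\<Sum>k<N. a k) * (\<Sum>k<N. p k)"
proof -
  have "(\<Sum>i<N. \<Sum>j<N. (a i - a j) * (p i - p j)) =
      (\<Sum>i<N. \<Sum>j<N. a i * p i) + (\<Sum>i<N. \<Sum>j<N. a j * p j)
      - (\<Sum>i<N. \<Sum>j<N. a i * p j) - (\<Sum>i<N. \<Sum>j<N. a j * p i)"
    by (simp add: sum.distrib sum_subtractf algebra_simps)
  also have "(\<Sum>i<N. \<Sum>j<N. a j * p i) = (\<Sum>i<N. \<Sum>j<N. a i * p j)"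
    by (rule sum.swap)
  also have "(\<Sum>i<N. \<Sum>j<N. a i * p j) = (\<Sum>k<N. a k) * (\<Sum>k<N. p k)"
    by (simp add: sum_product)
  finally show ?thesis by (simp add: flip: sum_distrib_left)
qed

lemma integral_double_sum:
  fixes f :: "nat \<Rightarrow> nat \<Rightarrow> 'a \<Rightarrow> real"
  assumes "\<And>i j. i < m \<Longrightarrow> j < n \<Longrightarrow> integrable M (f i j)"
  shows "integral\<^sup>L M (\<lambda>\<omega>. \<Sum>i<m. \<Sum>j<n. f i j \<omega>) = (\<Sum>i<m. \<Sum>j<n. integral\<^sup>L M (f i j))"
proof -
  have "integral\<^sup>L M (\<lambda>\<omega>. \<Sum>i<m. \<Sum>j<n. f i j \<omega>) = (\<Sum>i<m. integral\<^sup>L M (\<lambda>\<omega>. \<Sum>j<n. f i j \<omega>))"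
    using assms by (intro Bochner_Integration.integral_sum Bochner_Integration.integrable_sum) auto
  also have "\<dots> = (\<Sum>i<m. \<Sum>j<n. integral\<^sup>L M (f i j))"
    using assms by (intro sum.cong refl Bochner_Integration.integral_sum) auto
  finally show ?thesis .
qed

lemma (in prob_space) sub_gaussian_tail:
  fixes G :: "'a \<Rightarrow> real"
  assumes meas: "G \<in> borel_measurable M"
    and int: "\<And>t. integrable M (\<lambda>\<omega>. exp (t * G \<omega>))"
    and \<kappa>: "\<kappa> > 0" and \<eta>: "\<eta> \<ge> 0"
    and mgf: "\<And>t. expectation (\<lambda>\<omega>. exp (t * G \<omega>)) \<le> exp (\<kappa> * t\<^sup>2 / 2)"
  shows "prob {\<omega> \<in> space M. \<bar>G \<omega>\<bar> > \<eta>} \<le> 2 * exp (- (\<eta>\<^sup>2 / (2 * \<kappa>)))"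
\<comment> \<open>The Chernoff bound needs a positive parameter. For \<open>\<eta> = 0\<close> the
  claimed bound is 2.\<close>
proof (cases "\<eta> = 0")
  case True
  then show ?thesis by (intro order_trans[OF prob_le_1]) simp
next
  case False
  \<comment> \<open>The minimiser of \<open>\<kappa> * t\<^sup>2 / 2 - t * \<eta>\<close>.\<close>
  define t where "t = \<eta> / \<kappa>"
  have t: "t > 0" using False \<eta> \<kappa> by (simp add: t_def)
  have tail: "prob {\<omega> \<in> space M. H \<omega> \<ge> \<eta>} \<le> exp (- (\<eta>\<^sup>2 / (2 * \<kappa>)))"
    if i: "integrable M (\<lambda>\<omega>. exp (t * H \<omega>))" and m: "expectation (\<lambda>\<omega>. exp (t * H \<omega>)) \<le> exp (\<kappa> * t\<^sup>2 / 2)"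
    for H
  proof -
    have "prob {\<omega> \<in> space M. H \<omega> \<ge> \<eta>} \<le> exp (- t * \<eta>) * (\<integral>\<omega>\<in>space M. exp (t * H \<omega>) \<partial>M)"
      using integrable_mult_indicator[OF sets.top i]
      by (intro Chernoff_ineq_ge t sets.top) (simp only: set_integrable_def)
    also have "(\<integral>\<omega>\<in>space M. exp (t * H \<omega>) \<partial>M) = expectation (\<lambda>\<omega>. exp (t * H \<omega>))"
      by (rule set_integral_space[OF i])
    also have "exp (- t * \<eta>) * \<dots> \<le> exp (- t * \<eta>) * exp (\<kappa> * t\<^sup>2 / 2)"
      by (intro mult_left_mono m) simp
    also have "\<dots> = exp (- (\<eta>\<^sup>2 / (2 * \<kappa>)))"
      using \<kappa> by (simp add: t_def power2_eq_square field_simps flip: exp_add)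
    finally show ?thesis .
  qed
  have "prob {\<omega> \<in> space M. \<bar>G \<omega>\<bar> > \<eta>} \<le> prob ({\<omega> \<in> space M. G \<omega> \<ge> \<eta>} \<union> {\<omega> \<in> space M. - G \<omega> \<ge> \<eta>})"
    using meas by (intro finite_measure_mono) auto
  also have "\<dots> \<le> prob {\<omega> \<in> space M. G \<omega> \<ge> \<eta>} + prob {\<omega> \<in> space M. - G \<omega> \<ge> \<eta>}"
    using meas by (intro measure_Un_le) auto
  also have "\<dots> \<le> exp (- (\<eta>\<^sup>2 / (2 * \<kappa>))) + exp (- (\<eta>\<^sup>2 / (2 * \<kappa>)))"
    using int[of t] int[of "- t"] mgf[of t] mgf[of "- t"] by (intro add_mono tail) auto
  finally show ?thesis by simp
qed

text \<open>Read \<open>p k\<close> as the squared modulus of coordinate \<open>k\<close> of a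
  random vector of squared norm \<open>s\<close>, and \<open>x i j\<close> as the real part of
  coordinate \<open>i\<close> times the conjugate of coordinate \<open>j\<close>. What remains of
  the vector is the Cauchy-Schwarz inequality \<open>x2\<close> and the invariance
  \<open>inv\<close> under the rotation by \<open>\<psi> / 2\<close> in the plane of
  \<open>i\<close> and \<open>j\<close>.\<close>

locale rotation_invariant_form = prob_space +
  fixes N :: nat and p :: "nat \<Rightarrow> 'a \<Rightarrow> real" and x :: "nat \<Rightarrow> nat \<Rightarrow> 'a \<Rightarrow> real"
    and s :: real and a :: "nat \<Rightarrow> real"
  assumes N: "N > 0"
    and p_meas: "\<And>k. k < N \<Longrightarrow> p k \<in> borel_measurable M"
    and x_meas: "\<And>i j. i < N \<Longrightarrow> j < N \<Longrightarrow> x i j \<in> borel_measurable M"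
    and p0: "\<And>\<omega> k. \<omega> \<in> space M \<Longrightarrow> k < N \<Longrightarrow> 0 \<le> p k \<omega>"
    and psum: "\<And>\<omega>. \<omega> \<in> space M \<Longrightarrow> (\<Sum>k<N. p k \<omega>) = s"
    and x2: "\<And>\<omega> i j. \<omega> \<in> space M \<Longrightarrow> i < N \<Longrightarrow> j < N \<Longrightarrow> (x i j \<omega>)\<^sup>2 \<le> p i \<omega> * p j \<omega>"
    and inv: "\<And>i j t \<psi>. i < N \<Longrightarrow> j < N \<Longrightarrow> i \<noteq> j \<Longrightarrow>
        expectation (\<lambda>\<omega>. (sin \<psi> / 2 * (p i \<omega> - p j \<omega>) + cos \<psi> * x i j \<omega>) *
          exp (t * ((\<Sum>k<N. a k * p k \<omega>) -
            (a i - a j) * ((1 - cos \<psi>) / 2 * (p i \<omega> - p j \<omega>) + sin \<psi> * x i j \<omega>)))) =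
        expectation (\<lambda>\<omega>. x i j \<omega> * exp (t * (\<Sum>k<N. a k * p k \<omega>)))"
begin

definition F :: "'a \<Rightarrow> real" where "F \<omega> = (\<Sum>k<N. a k * p k \<omega>)"
text \<open>The mean of \<open>F\<close>, since invariance gives all \<open>p k\<close> the same
  expectation \<open>s / N\<close>.\<close>

definition c :: real where "c = s * (\<Sum>k<N. a k) / N"
definition G :: "'a \<Rightarrow> real" where "G \<omega> = F \<omega> - c"
text \<open>A common bound for \<open>p i - p j\<close>, \<open>x i j\<close> and \<open>F\<close>,
  because the rotation identity is stated with a single bound.\<close>

definition R :: real where "R = max s ((\<Sum>k<N. \<bar>a k\<bar>) * s)"

lemma F_meas [measurable]: "F \<in> borel_measurable M"
  unfolding F_def using p_meas by (intro borel_measurable_sum borel_measurable_times) auto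

lemma G_meas [measurable]: "G \<in> borel_measurable M"
  unfolding G_def by measurable

lemma ps: "\<omega> \<in> space M \<Longrightarrow> k < N \<Longrightarrow> p k \<omega> \<le> s"
  unfolding psum[symmetric] by (intro member_le_sum p0) auto

lemma s_nonneg: "s \<ge> 0"
  using not_empty p0 ps N by (metis all_not_in_conv order_trans)

lemma F_bd:
  assumes "\<omega> \<in> space M"
  shows "\<bar>F \<omega>\<bar> \<le> R"
proof -
  have "\<bar>F \<omega>\<bar> \<le> (\<Sum>k<N. \<bar>a k\<bar> * s)"
    unfolding F_def using ps[OF assms] p0[OF assms]
    by (intro order_trans[OF sum_abs] sum_mono) (auto simp: abs_mult intro!: mult_left_mono)
  also have "\<dots> \<le> R" by (simp add: R_def sum_distrib_right)
  finally show ?thesis .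
qed

lemma G_bd: "\<omega> \<in> space M \<Longrightarrow> \<bar>G \<omega>\<bar> \<le> R + \<bar>c\<bar>"
  unfolding G_def using F_bd by (intro abs_diff_le_add) auto

lemma expb:
  assumes "\<omega> \<in> space M"
  shows "\<bar>exp (t * G \<omega>)\<bar> \<le> exp (\<bar>t\<bar> * (R + \<bar>c\<bar>))"
proof -
  have "\<bar>t * G \<omega>\<bar> \<le> \<bar>t\<bar> * (R + \<bar>c\<bar>)"
    unfolding abs_mult by (intro mult_left_mono G_bd assms) auto
  then show ?thesis by simp
qed

lemma int:
  assumes f: "f \<in> borel_measurable M" and b: "\<And>\<omega>. \<omega> \<in> space M \<Longrightarrow> \<bar>f \<omega>\<bar> \<le> C"
  shows "integrable M (\<lambda>\<omega>. f \<omega> * exp (t * G \<omega>))"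
proof (rule integrable_bounded)
  show "(\<lambda>\<omega>. f \<omega> * exp (t * G \<omega>)) \<in> borel_measurable M" using f by measurable
  show "\<bar>f \<omega> * exp (t * G \<omega>)\<bar> \<le> C * exp (\<bar>t\<bar> * (R + \<bar>c\<bar>))" if "\<omega> \<in> space M" for \<omega>
    unfolding abs_mult using b[OF that] by (intro mult_mono expb that) auto
qed

lemma iZ: "integrable M (\<lambda>\<omega>. exp (t * G \<omega>))"
  using int[of "\<lambda>_. 1" 1 t] by simp

text \<open>A Gronwall argument: \<open>key\<close> bounds the derivative of \<open>\<Psi>\<close>
  by \<open>\<kappa> * t * \<Psi> t\<close>, so
  \<open>\<Psi> t * exp (- (\<kappa> * t\<^sup>2 / 2))\<close> never exceeds its value 1 at 0. The
  gain \<open>1 / N\<close> comes from centring: \<open>N * G\<close> is a sum over pairs, and after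
  integration by parts all pairs together contribute at most
  \<open>t * D\<^sup>2 * s\<^sup>2 * \<Psi> t\<close>, without a factor \<open>N\<close>.\<close>

lemma mgf:
  assumes D: "\<And>i j. i < N \<Longrightarrow> j < N \<Longrightarrow> \<bar>a i - a j\<bar> \<le> D" and t: "t \<ge> 0"
  shows "expectation (\<lambda>\<omega>. exp (t * G \<omega>)) \<le> exp (D\<^sup>2 * s\<^sup>2 / N * t\<^sup>2 / 2)"
proof -
  define \<kappa> where "\<kappa> = D\<^sup>2 * s\<^sup>2 / N"
  have x_bd: "\<bar>x i j \<omega>\<bar> \<le> s" if "\<omega> \<in> space M" "i < N" "j < N" for i j \<omega>
  proof (rule power2_le_imp_le)
    have "(x i j \<omega>)\<^sup>2 \<le> s * s"
      by (rule order_trans[OF x2[OF that] mult_mono]) (use ps p0 that s_nonneg in auto)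
    then show "\<bar>x i j \<omega>\<bar>\<^sup>2 \<le> s\<^sup>2" by (simp add: power2_eq_square)
  qed (fact s_nonneg)
  have iG: "integrable M (\<lambda>\<omega>. G \<omega> * exp (t * G \<omega>))" for t by (rule int[OF G_meas G_bd])
  have pd_bd: "\<bar>p i \<omega> - p j \<omega>\<bar> \<le> s" if "\<omega> \<in> space M" "i < N" "j < N" for i j \<omega>
    using ps[OF that(1,2)] ps[OF that(1,3)] p0[OF that(1,2)] p0[OF that(1,3)] by linarith
  have ipd: "integrable M (\<lambda>\<omega>. (p i \<omega> - p j \<omega>) * exp (t * G \<omega>))" if "i < N" "j < N" for i j t
    using p_meas that by (intro int[of _ s] borel_measurable_diff pd_bd)
  have ix2: "integrable M (\<lambda>\<omega>. (x i j \<omega>)\<^sup>2 * exp (t * G \<omega>))" if "i < N" "j < N" for i j t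
    using x_bd that x_meas by (intro int[of _ "s\<^sup>2"] borel_measurable_power) (auto simp: abs_le_square_iff[symmetric] s_nonneg)
  have ipp: "integrable M (\<lambda>\<omega>. (p i \<omega> * p j \<omega>) * exp (t * G \<omega>))" if "i < N" "j < N" for i j t
    using that p_meas
    by (intro int[of _ "s * s"] borel_measurable_times) (auto simp: abs_mult p0 ps s_nonneg intro!: mult_mono)
  have ibp: "expectation (\<lambda>\<omega>. (p i \<omega> - p j \<omega>) * exp (t * G \<omega>)) =
      2 * t * (a i - a j) * expectation (\<lambda>\<omega>. (x i j \<omega>)\<^sup>2 * exp (t * G \<omega>))"
    if ij: "i < N" "j < N" for i j t
  proof (cases "i = j")
    case False
    have "expectation (\<lambda>\<omega>. (p i \<omega> - p j \<omega>) * exp (t * F \<omega>)) =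
      2 * t * (a i - a j) * expectation (\<lambda>\<omega>. (x i j \<omega>)\<^sup>2 * exp (t * F \<omega>))"
    proof (rule integration_by_parts_rotation[where R = R])
      show "\<bar>p i \<omega> - p j \<omega>\<bar> \<le> R \<and> \<bar>x i j \<omega>\<bar> \<le> R \<and> \<bar>F \<omega>\<bar> \<le> R" if "\<omega> \<in> space M" for \<omega>
        using pd_bd[OF that ij] x_bd[OF that ij] F_bd[OF that] unfolding R_def by auto
      show "(\<lambda>\<omega>. p i \<omega> - p j \<omega>) \<in> borel_measurable M" "x i j \<in> borel_measurable M"
        using p_meas x_meas ij by auto
    qed (use inv[OF ij False] in \<open>simp_all only: F_def F_meas[unfolded F_def]\<close>)
    \<comment> \<open>Centring multiplies both sides of the identity for \<open>F\<close> by the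
      same constant \<open>exp (- (t * c))\<close>.\<close>
    moreover have "exp (t * G \<omega>) = exp (- (t * c)) * exp (t * F \<omega>)" for \<omega>
      unfolding G_def by (simp add: algebra_simps flip: exp_add)
    ultimately show ?thesis by (simp add: mult.left_commute[of _ "exp (- (t * c))"])
  qed simp
  have key: "expectation (\<lambda>\<omega>. G \<omega> * exp (t * G \<omega>)) \<le> \<kappa> * t * expectation (\<lambda>\<omega>. exp (t * G \<omega>))"
    if t: "t \<ge> 0" for t
  proof -
    have "real N * G \<omega> = (\<Sum>i<N. \<Sum>j<N. (a i - a j) * (p i \<omega> - p j \<omega>)) / 2" if "\<omega> \<in> space M" for \<omega>
      unfolding half_double_sum_diff_prod psum[OF that] G_def F_def c_def using N by (simp add: algebra_simps)
    then have "real N * expectation (\<lambda>\<omega>. G \<omega> * exp (t * G \<omega>)) =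
        expectation (\<lambda>\<omega>. (\<Sum>i<N. \<Sum>j<N. (a i - a j) / 2 * ((p i \<omega> - p j \<omega>) * exp (t * G \<omega>))))"
      unfolding integral_mult_right_zero[symmetric]
      by (intro Bochner_Integration.integral_cong refl)
         (simp add: mult.assoc[symmetric] sum_distrib_right sum_divide_distrib del: integral_mult_right_zero)
    also have "\<dots> = (\<Sum>i<N. \<Sum>j<N. (a i - a j) / 2 * expectation (\<lambda>\<omega>. (p i \<omega> - p j \<omega>) * exp (t * G \<omega>)))"
      by (subst integral_double_sum) (auto intro!: integrable_mult_right ipd)
    also have "\<dots> = (\<Sum>i<N. \<Sum>j<N. t * (a i - a j)\<^sup>2 * expectation (\<lambda>\<omega>. (x i j \<omega>)\<^sup>2 * exp (t * G \<omega>)))"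
      by (intro sum.cong refl) (simp add: ibp power2_eq_square)
    \<comment> \<open>The sign of \<open>t\<close> matters here. Replacing
      \<open>(x i j \<omega>)\<^sup>2\<close> by \<open>p i \<omega> * p j \<omega>\<close> makes
      the double sum factorise into \<open>s\<^sup>2\<close>.\<close>
    also have "\<dots> \<le> (\<Sum>i<N. \<Sum>j<N. t * D\<^sup>2 * expectation (\<lambda>\<omega>. (p i \<omega> * p j \<omega>) * exp (t * G \<omega>)))"
    proof (intro sum_mono, rule mult_mono)
      fix i j assume ij: "i \<in> {..<N}" "j \<in> {..<N}"
      have "(a i - a j)\<^sup>2 \<le> D\<^sup>2" using D[of i j] ij by (simp add: abs_le_square_iff[symmetric])
      then show "t * (a i - a j)\<^sup>2 \<le> t * D\<^sup>2" using t by (intro mult_left_mono)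
      show "expectation (\<lambda>\<omega>. (x i j \<omega>)\<^sup>2 * exp (t * G \<omega>)) \<le> expectation (\<lambda>\<omega>. (p i \<omega> * p j \<omega>) * exp (t * G \<omega>))"
        using ij by (intro integral_mono ix2 ipp mult_right_mono x2) auto
      show "0 \<le> expectation (\<lambda>\<omega>. (x i j \<omega>)\<^sup>2 * exp (t * G \<omega>))" by (intro integral_nonneg_AE) auto
      show "0 \<le> t * D\<^sup>2" using t by simp
    qed
    also have "\<dots> = t * D\<^sup>2 * expectation (\<lambda>\<omega>. \<Sum>i<N. \<Sum>j<N. (p i \<omega> * p j \<omega>) * exp (t * G \<omega>))"
      by (subst integral_double_sum) (auto simp: sum_distrib_left intro!: ipp)
    also have "expectation (\<lambda>\<omega>. \<Sum>i<N. \<Sum>j<N. (p i \<omega> * p j \<omega>) * exp (t * G \<omega>)) =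
        expectation (\<lambda>\<omega>. s\<^sup>2 * exp (t * G \<omega>))"
      by (intro Bochner_Integration.integral_cong refl)
         (simp add: psum power2_eq_square flip: sum_product sum_distrib_right)
    finally have "real N * expectation (\<lambda>\<omega>. G \<omega> * exp (t * G \<omega>)) \<le>
        t * D\<^sup>2 * (s\<^sup>2 * expectation (\<lambda>\<omega>. exp (t * G \<omega>)))" by simp
    then show ?thesis using N by (simp add: \<kappa>_def field_simps)
  qed
  define \<Psi> where "\<Psi> = (\<lambda>t. expectation (\<lambda>\<omega>. exp (t * G \<omega>)))"
  have d\<Psi>: "(\<Psi> has_field_derivative expectation (\<lambda>\<omega>. G \<omega> * exp (t * G \<omega>))) (at t)" for t
    unfolding \<Psi>_def
  proof (rule has_field_derivative_expectation[OF iZ, where C = "(R + \<bar>c\<bar>) * exp ((\<bar>t\<bar> + 1) * (R + \<bar>c\<bar>))"])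
    fix u \<omega> assume \<omega>: "\<omega> \<in> space M"
    show "((\<lambda>t. exp (t * G \<omega>)) has_real_derivative G \<omega> * exp (u * G \<omega>)) (at u)"
      by (auto intro!: derivative_eq_intros)
    assume u: "\<bar>u - t\<bar> \<le> 1"
    have "0 \<le> R + \<bar>c\<bar>" using G_bd[OF \<omega>] by linarith
    then have "exp (\<bar>u\<bar> * (R + \<bar>c\<bar>)) \<le> exp ((\<bar>t\<bar> + 1) * (R + \<bar>c\<bar>))"
      using u by (simp only: exp_le_cancel_iff) (intro mult_right_mono; linarith)
    then have "\<bar>exp (u * G \<omega>)\<bar> \<le> exp ((\<bar>t\<bar> + 1) * (R + \<bar>c\<bar>))"
      using expb[OF \<omega>, of u] by (rule order_trans[rotated])
    then show "\<bar>G \<omega> * exp (u * G \<omega>)\<bar> \<le> (R + \<bar>c\<bar>) * exp ((\<bar>t\<bar> + 1) * (R + \<bar>c\<bar>))"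
      unfolding abs_mult[of "G \<omega>"] using G_bd[OF \<omega>] by (intro mult_mono) auto
  qed measurable
  have "\<Psi> t * exp (- (\<kappa> * t\<^sup>2 / 2)) \<le> \<Psi> 0 * exp (- (\<kappa> * 0\<^sup>2 / 2))"
  proof (rule DERIV_nonpos_imp_nonincreasing[OF t])
    fix u :: real assume u: "0 \<le> u" "u \<le> t"
    have "((\<lambda>t. \<Psi> t * exp (- (\<kappa> * t\<^sup>2 / 2))) has_field_derivative
        (expectation (\<lambda>\<omega>. G \<omega> * exp (u * G \<omega>)) - \<kappa> * u * \<Psi> u) * exp (- (\<kappa> * u\<^sup>2 / 2))) (at u)"
      by (rule derivative_eq_intros d\<Psi> refl | simp add: algebra_simps)+
    moreover have "(expectation (\<lambda>\<omega>. G \<omega> * exp (u * G \<omega>)) - \<kappa> * u * \<Psi> u) * exp (- (\<kappa> * u\<^sup>2 / 2)) \<le> 0"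
      using key[OF u(1)] by (intro mult_nonpos_nonneg) (auto simp: \<Psi>_def)
    ultimately show "\<exists>y. ((\<lambda>t. \<Psi> t * exp (- (\<kappa> * t\<^sup>2 / 2))) has_field_derivative y) (at u) \<and> y \<le> 0"
      by blast
  qed
  then have "\<Psi> t \<le> exp (\<kappa> * t\<^sup>2 / 2)"
    by (simp add: \<Psi>_def prob_space exp_minus field_simps)
  then show ?thesis unfolding \<Psi>_def \<kappa>_def .
qed

text \<open>Supplies negative \<open>t\<close>: \<open>mgf\<close> covers \<open>t \<ge> 0\<close>,
  and reversing \<open>a\<close> reverses \<open>G\<close>.\<close>

lemma uminus: "rotation_invariant_form M N p x s (\<lambda>k. - a k)"
proof unfold_locales
  fix i j t \<psi> assume ij: "i < N" "j < N" "i \<noteq> j"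
  have e: "t * ((\<Sum>k<N. - a k * p k \<omega>) - (- a i - - a j) * r) = - t * ((\<Sum>k<N. a k * p k \<omega>) - (a i - a j) * r)"
    and e': "t * (\<Sum>k<N. - a k * p k \<omega>) = - t * (\<Sum>k<N. a k * p k \<omega>)" for \<omega> r
    by (simp_all add: sum_negf algebra_simps)
  show "expectation (\<lambda>\<omega>. (sin \<psi> / 2 * (p i \<omega> - p j \<omega>) + cos \<psi> * x i j \<omega>) *
      exp (t * ((\<Sum>k<N. - a k * p k \<omega>) -
        (- a i - - a j) * ((1 - cos \<psi>) / 2 * (p i \<omega> - p j \<omega>) + sin \<psi> * x i j \<omega>)))) =
    expectation (\<lambda>\<omega>. x i j \<omega> * exp (t * (\<Sum>k<N. - a k * p k \<omega>)))"
    unfolding e e' by (rule inv[OF ij])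
qed (rule N p_meas x_meas p0 psum x2; assumption)+

text \<open>The exponent is written with an upper bound \<open>s'\<close> of \<open>s\<close>, so
  that it is the same for all points of a net, whose norms differ, and remains meaningful for
  \<open>s = 0\<close>.\<close>

lemma concentration:
  fixes \<eta> :: real
  assumes D: "\<And>i j. i < N \<Longrightarrow> j < N \<Longrightarrow> \<bar>a i - a j\<bar> \<le> D"
    and D0: "D > 0" and s: "s \<le> s'" and s': "s' > 0" and \<eta>: "\<eta> \<ge> 0"
  shows "prob {\<omega> \<in> space M. \<bar>G \<omega>\<bar> > \<eta>} \<le> 2 * exp (- (N * \<eta>\<^sup>2 / (2 * D\<^sup>2 * s'\<^sup>2)))"
proof -
  interpret neg: rotation_invariant_form M N p x s "\<lambda>k. - a k" by (rule uminus)
  have "prob {\<omega> \<in> space M. \<bar>G \<omega>\<bar> > \<eta>} \<le> 2 * exp (- (\<eta>\<^sup>2 / (2 * (D\<^sup>2 * s'\<^sup>2 / N))))"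
  proof (rule sub_gaussian_tail[OF G_meas iZ _ \<eta>])
    show "0 < D\<^sup>2 * s'\<^sup>2 / N" using D0 s' N by simp
    fix t :: real
    have "expectation (\<lambda>\<omega>. exp (t * G \<omega>)) \<le> exp (D\<^sup>2 * s\<^sup>2 / N * t\<^sup>2 / 2)"
    proof (cases "t \<ge> 0")
      case True
      show ?thesis by (rule mgf[OF D True])
    next
      case False
      have "neg.G \<omega> = - G \<omega>" for \<omega>
        by (simp add: G_def neg.G_def F_def neg.F_def c_def neg.c_def sum_negf)
      then show ?thesis using neg.mgf[of D "- t"] False D by (simp add: abs_minus_commute)
    qed
    also have "\<dots> \<le> exp (D\<^sup>2 * s'\<^sup>2 / N * t\<^sup>2 / 2)"
    proof -
      have "s\<^sup>2 \<le> s'\<^sup>2" using s s_nonneg by (rule power_mono)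
      then have "D\<^sup>2 * s\<^sup>2 / N * t\<^sup>2 / 2 \<le> D\<^sup>2 * s'\<^sup>2 / N * t\<^sup>2 / 2"
        by (intro divide_right_mono mult_right_mono mult_left_mono) auto
      then show ?thesis by simp
    qed
    finally show "expectation (\<lambda>\<omega>. exp (t * G \<omega>)) \<le> exp (D\<^sup>2 * s'\<^sup>2 / N * t\<^sup>2 / 2)" .
  qed
  also have "\<eta>\<^sup>2 / (2 * (D\<^sup>2 * s'\<^sup>2 / N)) = N * \<eta>\<^sup>2 / (2 * D\<^sup>2 * s'\<^sup>2)" by (simp add: mult_ac)
  finally show ?thesis .
qed

end

section \<open>Rotations in coordinate planes\<close>

definition plane_rotation :: "nat \<Rightarrow> nat \<Rightarrow> real \<Rightarrow> (nat \<Rightarrow> complex) \<Rightarrow> nat \<Rightarrow> complex" where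
  "plane_rotation i j \<phi> y k =
     (if k = i then of_real (cos \<phi>) * y i - of_real (sin \<phi>) * y j
      else if k = j then of_real (sin \<phi>) * y i + of_real (cos \<phi>) * y j else y k)"

text \<open>The difference of the squared moduli and twice the real part of \<open>u * cnj v\<close>
  form a plane vector that turns by the doubled angle, while the sum of the squared moduli is
  preserved. This is why invariance is parametrised by \<open>\<psi> = 2 * \<phi>\<close>.\<close>

lemma cmod_plane_rotation:
  fixes u v :: complex and \<phi> :: real
  shows "(cmod (cos \<phi> * u - sin \<phi> * v))\<^sup>2 = (cmod u)\<^sup>2 -
      ((1 - cos (2 * \<phi>)) / 2 * ((cmod u)\<^sup>2 - (cmod v)\<^sup>2) + sin (2 * \<phi>) * Re (u * cnj v))"
    and "(cmod (sin \<phi> * u + cos \<phi> * v))\<^sup>2 = (cmod v)\<^sup>2 +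
      ((1 - cos (2 * \<phi>)) / 2 * ((cmod u)\<^sup>2 - (cmod v)\<^sup>2) + sin (2 * \<phi>) * Re (u * cnj v))"
    and "Re ((cos \<phi> * u - sin \<phi> * v) * cnj (sin \<phi> * u + cos \<phi> * v)) =
      sin (2 * \<phi>) / 2 * ((cmod u)\<^sup>2 - (cmod v)\<^sup>2) + cos (2 * \<phi>) * Re (u * cnj v)"
proof -
  have c: "(cos \<phi>)\<^sup>2 = 1 - (sin \<phi>)\<^sup>2" by (simp add: cos_squared_eq)
  have d: "cos (2 * \<phi>) = 1 - 2 * (sin \<phi>)\<^sup>2" by (simp add: cos_double_sin)
  show "(cmod (cos \<phi> * u - sin \<phi> * v))\<^sup>2 = (cmod u)\<^sup>2 -
      ((1 - cos (2 * \<phi>)) / 2 * ((cmod u)\<^sup>2 - (cmod v)\<^sup>2) + sin (2 * \<phi>) * Re (u * cnj v))"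
    unfolding d sin_double
    by (simp add: cmod_power2 power2_diff power_mult_distrib c algebra_simps)
  show "(cmod (sin \<phi> * u + cos \<phi> * v))\<^sup>2 = (cmod v)\<^sup>2 +
      ((1 - cos (2 * \<phi>)) / 2 * ((cmod u)\<^sup>2 - (cmod v)\<^sup>2) + sin (2 * \<phi>) * Re (u * cnj v))"
    unfolding d sin_double
    by (simp add: cmod_power2 power2_sum power_mult_distrib c algebra_simps)
  show "Re ((cos \<phi> * u - sin \<phi> * v) * cnj (sin \<phi> * u + cos \<phi> * v)) =
      sin (2 * \<phi>) / 2 * ((cmod u)\<^sup>2 - (cmod v)\<^sup>2) + cos (2 * \<phi>) * Re (u * cnj v)"
    unfolding cos_double sin_double cmod_power2
    by (simp add: algebra_simps power2_eq_square)
qed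

text \<open>Invariance of the law of \<open>Y\<close> is expressed by a map \<open>\<tau>\<close> of
  the sample space that preserves expectations and acts on \<open>Y\<close> as a rotation. In this
  form it can be read off from left translations of the group, and no measure on a space of vectors
  is introduced.\<close>

lemma (in prob_space) rotation_invariant_concentration:
  fixes Y :: "'a \<Rightarrow> nat \<Rightarrow> complex" and a :: "nat \<Rightarrow> real"
  assumes N: "N > 0"
    and meas: "\<And>k. k < N \<Longrightarrow> (\<lambda>\<omega>. Y \<omega> k) \<in> borel_measurable M"
    and nrm: "\<And>\<omega>. \<omega> \<in> space M \<Longrightarrow> (\<Sum>k<N. (cmod (Y \<omega> k))\<^sup>2) = s"
    and inv: "\<And>i j \<phi>. i < N \<Longrightarrow> j < N \<Longrightarrow> i \<noteq> j \<Longrightarrow>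
      \<exists>\<tau>. (\<forall>g::'a \<Rightarrow> real. g \<in> borel_measurable M \<longrightarrow> expectation (\<lambda>\<omega>. g (\<tau> \<omega>)) = expectation g) \<and>
          (\<forall>\<omega>\<in>space M. \<forall>k<N. Y (\<tau> \<omega>) k = plane_rotation i j \<phi> (Y \<omega>) k)"
    and D: "\<And>i j. i < N \<Longrightarrow> j < N \<Longrightarrow> \<bar>a i - a j\<bar> \<le> D"
    and D0: "D > 0" and s: "s \<le> s0" and s0: "s0 > 0" and \<eta>: "\<eta> \<ge> 0"
  shows "prob {\<omega> \<in> space M. \<bar>(\<Sum>k<N. a k * (cmod (Y \<omega> k))\<^sup>2) - s * (\<Sum>k<N. a k) / N\<bar> > \<eta>} \<le>
    2 * exp (- (N * \<eta>\<^sup>2 / (2 * D\<^sup>2 * s0\<^sup>2)))"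
proof -
  interpret rotation_invariant_form M N "\<lambda>k \<omega>. (cmod (Y \<omega> k))\<^sup>2" "\<lambda>i j \<omega>. Re (Y \<omega> i * cnj (Y \<omega> j))" s a
  proof (unfold_locales, rule N)
    show p_meas: "(\<lambda>\<omega>. (cmod (Y \<omega> k))\<^sup>2) \<in> borel_measurable M" if "k < N" for k
      using meas[OF that] by measurable
    show x_meas: "(\<lambda>\<omega>. Re (Y \<omega> i * cnj (Y \<omega> j))) \<in> borel_measurable M" if "i < N" "j < N" for i j
    proof -
      have "(\<lambda>\<omega>. Re (Y \<omega> k)) \<in> borel_measurable M" "(\<lambda>\<omega>. Im (Y \<omega> k)) \<in> borel_measurable M" if "k < N" for k
        by (rule measurable_compose[OF meas[OF that]], rule borel_measurable_continuous_onI, intro continuous_intros)+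
      then show ?thesis using that by simp
    qed
    show "(Re (Y \<omega> i * cnj (Y \<omega> j)))\<^sup>2 \<le> (cmod (Y \<omega> i))\<^sup>2 * (cmod (Y \<omega> j))\<^sup>2" for \<omega> i j
    proof -
      have "\<bar>Re (Y \<omega> i * cnj (Y \<omega> j))\<bar> \<le> cmod (Y \<omega> i) * cmod (Y \<omega> j)"
        using abs_Re_le_cmod[of "Y \<omega> i * cnj (Y \<omega> j)"] by (simp add: norm_mult)
      then show ?thesis by (metis abs_ge_zero power2_abs power_mono power_mult_distrib)
    qed
    fix i j t \<psi>
    assume i: "i < N" and j: "j < N" and ij: "i \<noteq> j"
    from inv[OF this, of "\<psi> / 2"] obtain \<tau> where
      \<tau>: "\<And>g::'a \<Rightarrow> real. g \<in> borel_measurable M \<Longrightarrow> expectation (\<lambda>\<omega>. g (\<tau> \<omega>)) = expectation g"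
      and Y\<tau>: "\<And>\<omega> k. \<omega> \<in> space M \<Longrightarrow> k < N \<Longrightarrow> Y (\<tau> \<omega>) k = plane_rotation i j (\<psi> / 2) (Y \<omega>) k"
      by blast
    define b where "b = (\<lambda>\<omega>. (1 - cos \<psi>) / 2 * ((cmod (Y \<omega> i))\<^sup>2 - (cmod (Y \<omega> j))\<^sup>2) + sin \<psi> * Re (Y \<omega> i * cnj (Y \<omega> j)))"
    define F' where "F' = (\<lambda>\<omega>. \<Sum>k<N. a k * (cmod (Y \<omega> k))\<^sup>2)"
    have F'_meas: "F' \<in> borel_measurable M"
      unfolding F'_def using p_meas by (intro borel_measurable_sum borel_measurable_times) auto
    have h: "2 * (\<psi> / 2) = \<psi>" by simp
    note rot = cmod_plane_rotation[of "\<psi> / 2", unfolded h]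
    have Yi: "Y (\<tau> \<omega>) i = cos (\<psi> / 2) * Y \<omega> i - sin (\<psi> / 2) * Y \<omega> j"
      and Yj: "Y (\<tau> \<omega>) j = sin (\<psi> / 2) * Y \<omega> i + cos (\<psi> / 2) * Y \<omega> j" if "\<omega> \<in> space M" for \<omega>
      using Y\<tau>[OF that i] Y\<tau>[OF that j] ij[symmetric]
      by (simp_all only: plane_rotation_def if_True if_False refl simp_thms)
    \<comment> \<open>The two rotated coordinates change their squared moduli by
      \<open>- b \<omega>\<close> and \<open>b \<omega>\<close> and all others stay, so only the
      difference of the two weights is felt.\<close>
    have Ft: "F' (\<tau> \<omega>) = F' \<omega> - (a i - a j) * b \<omega>" if \<omega>: "\<omega> \<in> space M" for \<omega>
    proof -
      have e: "(cmod (Y (\<tau> \<omega>) i))\<^sup>2 = (cmod (Y \<omega> i))\<^sup>2 - b \<omega>" "(cmod (Y (\<tau> \<omega>) j))\<^sup>2 = (cmod (Y \<omega> j))\<^sup>2 + b \<omega>"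
        unfolding Yi[OF \<omega>] Yj[OF \<omega>] b_def by (rule rot)+
      have "F' (\<tau> \<omega>) - F' \<omega> = (\<Sum>k<N. a k * ((cmod (Y (\<tau> \<omega>) k))\<^sup>2 - (cmod (Y \<omega> k))\<^sup>2))"
        unfolding F'_def by (simp add: sum_subtractf algebra_simps)
      also have "\<dots> = (\<Sum>k\<in>{i, j}. a k * ((cmod (Y (\<tau> \<omega>) k))\<^sup>2 - (cmod (Y \<omega> k))\<^sup>2))"
        using i j Y\<tau>[OF \<omega>] by (intro sum.mono_neutral_right) (auto simp: plane_rotation_def)
      also have "\<dots> = - (a i - a j) * b \<omega>" using ij by (simp add: e algebra_simps)
      finally show ?thesis by (simp add: algebra_simps)
    qed
    have E: "(\<lambda>\<omega>. exp (t * F' \<omega>)) \<in> borel_measurable M" using F'_meas by measurable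
    have "expectation (\<lambda>\<omega>. (sin \<psi> / 2 * ((cmod (Y \<omega> i))\<^sup>2 - (cmod (Y \<omega> j))\<^sup>2) + cos \<psi> * Re (Y \<omega> i * cnj (Y \<omega> j))) *
            exp (t * (F' \<omega> - (a i - a j) * b \<omega>))) =
        expectation (\<lambda>\<omega>. Re (Y (\<tau> \<omega>) i * cnj (Y (\<tau> \<omega>) j)) * exp (t * F' (\<tau> \<omega>)))"
      by (intro Bochner_Integration.integral_cong refl) (simp only: Ft Yi Yj rot(3))
    also have "\<dots> = expectation (\<lambda>\<omega>. Re (Y \<omega> i * cnj (Y \<omega> j)) * exp (t * F' \<omega>))"
      by (rule \<tau>[OF borel_measurable_times[OF x_meas[OF i j] E]])
    finally show "expectation (\<lambda>\<omega>. (sin \<psi> / 2 * ((cmod (Y \<omega> i))\<^sup>2 - (cmod (Y \<omega> j))\<^sup>2) + cos \<psi> * Re (Y \<omega> i * cnj (Y \<omega> j))) *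
            exp (t * ((\<Sum>k<N. a k * (cmod (Y \<omega> k))\<^sup>2) -
              (a i - a j) * ((1 - cos \<psi>) / 2 * ((cmod (Y \<omega> i))\<^sup>2 - (cmod (Y \<omega> j))\<^sup>2) + sin \<psi> * Re (Y \<omega> i * cnj (Y \<omega> j)))))) =
          expectation (\<lambda>\<omega>. Re (Y \<omega> i * cnj (Y \<omega> j)) * exp (t * (\<Sum>k<N. a k * (cmod (Y \<omega> k))\<^sup>2)))"
      by (simp only: F'_def b_def)
  qed (use nrm in simp_all)
  show ?thesis
    using concentration[OF D D0 s s0 \<eta>] by (simp only: G_def F_def c_def)
qed

section \<open>Quadratic forms and a net of the complex sphere\<close>

text \<open>Vectors and matrices become plain functions with the sizes passed as arguments. Real and
  complex matrices thus meet in one complex setting, and the deterministic part is free of carrier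
  conditions.\<close>

definition lin_app :: "nat \<Rightarrow> (nat \<Rightarrow> nat \<Rightarrow> complex) \<Rightarrow> (nat \<Rightarrow> complex) \<Rightarrow> nat \<Rightarrow> complex" where
  "lin_app m X y k = (\<Sum>j<m. X k j * y j)"

definition lin_adj :: "nat \<Rightarrow> (nat \<Rightarrow> nat \<Rightarrow> complex) \<Rightarrow> (nat \<Rightarrow> complex) \<Rightarrow> nat \<Rightarrow> complex" where
  "lin_adj n X u j = (\<Sum>k<n. cnj (X k j) * u k)"

definition sq_norm :: "nat \<Rightarrow> (nat \<Rightarrow> complex) \<Rightarrow> real" where
  "sq_norm n y = (\<Sum>j<n. (cmod (y j))\<^sup>2)"

definition diag_form :: "nat \<Rightarrow> (nat \<Rightarrow> real) \<Rightarrow> (nat \<Rightarrow> complex) \<Rightarrow> real" where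
  "diag_form n c u = (\<Sum>k<n. c k * (cmod (u k))\<^sup>2)"

definition inner_sum :: "nat \<Rightarrow> (nat \<Rightarrow> complex) \<Rightarrow> (nat \<Rightarrow> complex) \<Rightarrow> complex" where
  "inner_sum n x y = (\<Sum>j<n. cnj (x j) * y j)"

lemma lin_app_add: "lin_app m X (\<lambda>j. a * y j + b * z j) k = a * lin_app m X y k + b * lin_app m X z k"
  by (simp add: lin_app_def sum.distrib sum_distrib_left algebra_simps)

lemma lin_app_scale: "lin_app m X (\<lambda>j. a * y j) k = a * lin_app m X y k"
  by (simp add: lin_app_def sum_distrib_left algebra_simps)

lemma sq_norm_nonneg: "0 \<le> sq_norm n y"
  by (simp add: sq_norm_def sum_nonneg)

lemma sq_norm_scale: "sq_norm n (\<lambda>j. a * y j) = (cmod a)\<^sup>2 * sq_norm n y"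
  by (simp add: sq_norm_def norm_mult power_mult_distrib sum_distrib_left)

lemma diag_form_scale: "diag_form n c (\<lambda>j. a * y j) = (cmod a)\<^sup>2 * diag_form n c y"
  by (simp add: diag_form_def norm_mult power_mult_distrib sum_distrib_left algebra_simps)

lemma sq_norm_eq_0_iff: "sq_norm n y = 0 \<longleftrightarrow> (\<forall>j<n. y j = 0)"
  by (auto simp: sq_norm_def sum_nonneg_eq_0_iff)

lemma cmod_sq_add: "(cmod (u + v))\<^sup>2 = (cmod u)\<^sup>2 + (cmod v)\<^sup>2 + 2 * Re (cnj u * v)"
  by (simp only: cmod_power2) (simp add: power2_eq_square algebra_simps)

lemma cmod_sq_diff: "(cmod (u - v))\<^sup>2 = (cmod u)\<^sup>2 + (cmod v)\<^sup>2 - 2 * Re (cnj u * v)"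
  by (simp only: cmod_power2) (simp add: power2_eq_square algebra_simps)

lemma sq_norm_parallelogram:
  "sq_norm n (\<lambda>j. u j + v j) + sq_norm n (\<lambda>j. u j - v j) = 2 * (sq_norm n u + sq_norm n v)"
  by (simp add: sq_norm_def cmod_sq_add cmod_sq_diff sum.distrib sum_subtractf)

text \<open>Gaussian elimination, by induction over the equations. They are indexed by an arbitrary
  finite set because the min-max arguments combine two families of constraints in a sum
  type.\<close>

lemma homogeneous_system:
  fixes a :: "'i \<Rightarrow> nat \<Rightarrow> complex"
  assumes "finite I" "card I < n"
  shows "\<exists>y. (\<exists>j<n. y j \<noteq> 0) \<and> (\<forall>i\<in>I. (\<Sum>j<n. a i j * y j) = 0)"
proof -
  have "\<exists>y. (\<exists>j\<in>J. y j \<noteq> 0) \<and> (\<forall>i\<in>I. (\<Sum>j\<in>J. a i j * y j) = 0)"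
    if "card I < card J" for J :: "nat set"
    using assms(1) that
  proof (induction I arbitrary: J a rule: finite_induct)
    case empty
    then have "J \<noteq> {}" by auto
    then show ?case by (intro exI[of _ "\<lambda>_. 1"]) auto
  next
    case (insert i I)
    have fin: "finite J" using insert.prems card.infinite by fastforce
    show ?case
    proof (cases "\<forall>j\<in>J. a i j = 0")
      case True
      from insert have "card I < card J" by simp
      from insert.IH[OF this, of a] True show ?thesis by auto
    next
      case False
      then obtain j0 where j0: "j0 \<in> J" "a i j0 \<noteq> 0" by auto
      have "card I < card (J - {j0})" using insert j0 fin by simp
      \<comment> \<open>Equation \<open>i\<close> is solved for the unknown \<open>j0\<close> and
        substituted into the others, which leaves a system without \<open>j0\<close>.\<close>
      from insert.IH[OF this, of "\<lambda>i' j. a i' j - a i' j0 / a i j0 * a i j"] obtain y where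
        y: "\<exists>j\<in>J - {j0}. y j \<noteq> 0"
          "\<And>i'. i' \<in> I \<Longrightarrow> (\<Sum>j\<in>J - {j0}. (a i' j - a i' j0 / a i j0 * a i j) * y j) = 0"
        by blast
      define s where "s = (\<Sum>j\<in>J - {j0}. a i j * y j)"
      define z where "z = y(j0 := - s / a i j0)"
      have z: "(\<Sum>j\<in>J. b j * z j) = - b j0 * s / a i j0 + (\<Sum>j\<in>J - {j0}. b j * y j)" for b
        unfolding sum.remove[OF fin j0(1)] z_def by (simp add: fin)
      have "(\<Sum>j\<in>J. a i j * z j) = 0" unfolding z using j0(2) by (simp add: s_def)
      moreover have "(\<Sum>j\<in>J. a i' j * z j) = 0" if "i' \<in> I" for i'
      proof -
        have "(\<Sum>j\<in>J - {j0}. a i' j * y j) = a i' j0 / a i j0 * s"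
          using y(2)[OF that] unfolding s_def sum_distrib_left
          by (simp add: left_diff_distrib sum_subtractf mult.assoc)
        then show ?thesis unfolding z by simp
      qed
      moreover have "\<exists>j\<in>J. z j \<noteq> 0" using y(1) by (auto simp: z_def)
      ultimately show ?thesis by (intro exI[of _ z]) auto
    qed
  qed
  from this[of "{..<n}"] assms show ?thesis by auto
qed

text \<open>For a net point \<open>p\<close> near \<open>y\<close>, polarisation writes
  \<open>q y - q p\<close> as a difference of values of \<open>q\<close> at two short vectors. These
  are at most a fraction of the supremum \<open>\<tau>\<close> over the sphere, so
  \<open>\<tau>\<close> can be absorbed into the left side.\<close>

lemma form_bounded_by_net:
  fixes X :: "nat \<Rightarrow> nat \<Rightarrow> complex"
  assumes iso: "\<And>y. sq_norm N (lin_app M X y) = sq_norm M y"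
    and c: "\<And>k. k < N \<Longrightarrow> \<bar>c k\<bar> \<le> C"
    and net_norm: "\<And>p. p \<in> Net \<Longrightarrow> sq_norm M p \<le> 25 / 16"
    and net_dense: "\<And>y. sq_norm M y = 1 \<Longrightarrow> \<exists>p\<in>Net. sq_norm M (\<lambda>j. y j - p j) \<le> 1 / 16"
    and net_form: "\<And>p. p \<in> Net \<Longrightarrow> \<bar>diag_form N c (lin_app M X p)\<bar> \<le> \<eta>"
  shows "\<bar>diag_form N c (lin_app M X y)\<bar> \<le> 3 * \<eta> * sq_norm M y"
proof -
  define q where "q = (\<lambda>y. diag_form N c (lin_app M X y))"
  define T where "T = {\<bar>q y\<bar> |y. sq_norm M y = 1}"
  define \<tau> where "\<tau> = Sup T"
  have qC: "\<bar>q y\<bar> \<le> C * sq_norm M y" for y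
  proof -
    have "\<bar>q y\<bar> \<le> (\<Sum>k<N. C * (cmod (lin_app M X y k))\<^sup>2)"
      unfolding q_def diag_form_def
      by (rule order_trans[OF sum_abs]) (auto intro!: sum_mono mult_right_mono c simp: abs_mult)
    also have "\<dots> = C * sq_norm N (lin_app M X y)" by (simp add: sq_norm_def sum_distrib_left)
    also have "\<dots> = C * sq_norm M y" by (simp only: iso)
    finally show ?thesis .
  qed
  have q_scale: "q (\<lambda>j. a * y j) = (cmod a)\<^sup>2 * q y" for a y
    unfolding q_def diag_form_scale[symmetric] by (simp add: lin_app_scale[abs_def])
  \<comment> \<open>The crude bound \<open>C\<close> makes the supremum finite, as the absorption
    requires.\<close>
  have bdd: "bdd_above T" unfolding T_def 
  proof (rule bdd_aboveI[of _ C], clarify)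
    show "\<bar>q y\<bar> \<le> C" if "sq_norm M y = 1" for y using qC[of y] that by simp
  qed
  have unit: "\<bar>q y\<bar> \<le> \<tau>" if "sq_norm M y = 1" for y
    unfolding \<tau>_def by (rule cSup_upper[OF _ bdd]) (use that in \<open>auto simp: T_def\<close>)
  have hom: "\<bar>q y\<bar> \<le> b * sq_norm M y"
    if b: "\<And>y. sq_norm M y = 1 \<Longrightarrow> \<bar>q y\<bar> \<le> b" for b y
  proof (cases "sq_norm M y = 0")
    case True
    with qC[of y] show ?thesis by simp
  next
    case False
    define r where "r = sqrt (sq_norm M y)"
    have r: "r > 0" "r\<^sup>2 = sq_norm M y" using False sq_norm_nonneg[of M y] by (auto simp: r_def less_le)
    define z where "z = (\<lambda>j. complex_of_real (1 / r) * y j)"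
    have z1: "sq_norm M z = 1" unfolding z_def sq_norm_scale norm_of_real r(2)[symmetric] using r(1) by (simp add: power_divide)
    have "y = (\<lambda>j. complex_of_real r * z j)" using r(1) by (simp add: z_def)
    then have "q y = r\<^sup>2 * q z" using q_scale[of "complex_of_real r" z] r(1) by simp
    moreover have "r\<^sup>2 * \<bar>q z\<bar> \<le> r\<^sup>2 * b" by (intro mult_left_mono b z1) simp
    ultimately show ?thesis unfolding r(2)[symmetric] by (simp add: abs_mult mult.commute)
  qed
  have step: "\<bar>q y\<bar> \<le> \<eta> + 163 / 288 * \<tau>" if y: "sq_norm M y = 1" for y
  proof -
    obtain p where p: "p \<in> Net" "sq_norm M (\<lambda>j. y j - p j) \<le> 1 / 16" using net_dense[OF y] by blast
    \<comment> \<open>The two factors have product \<open>1 / 4\<close>, which makes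
      \<open>q (u + v) - q (u - v)\<close> equal to \<open>q y - q p\<close>. Their ratio balances
      the squared norm of \<open>y + p\<close>, at most \<open>41 / 8\<close>, against that of
      \<open>y - p\<close>, at most \<open>1 / 16\<close>. The contraction factor is
      \<open>163 / 288 = 2 * (41 / 288 + 9 / 64)\<close>.\<close>
    define u v where "u = (\<lambda>j. 1 / 6 * (y j + p j))" and "v = (\<lambda>j. 3 / 2 * (y j - p j))"
    have "sq_norm M (\<lambda>j. y j + p j) \<le> 41 / 8"
      using sq_norm_parallelogram[of M y p] net_norm[OF p(1)] sq_norm_nonneg[of M "\<lambda>j. y j - p j"]
      unfolding y by (simp add: field_simps)
    then have un: "sq_norm M u \<le> (1 / 6)\<^sup>2 * (41 / 8)"
      unfolding u_def sq_norm_scale by (simp add: power_divide norm_divide)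
    have vn: "sq_norm M v \<le> (3 / 2)\<^sup>2 * (1 / 16)"
      unfolding v_def sq_norm_scale using p(2) by (simp add: power_divide norm_divide)
    have "q y - q p = q (\<lambda>j. u j + v j) - q (\<lambda>j. u j - v j)"
    proof -
      have L: "lin_app M X (\<lambda>j. u j + v j) k = 1/6 * (lin_app M X y k + lin_app M X p k) + 3/2 * (lin_app M X y k - lin_app M X p k)"
        "lin_app M X (\<lambda>j. u j - v j) k = 1/6 * (lin_app M X y k + lin_app M X p k) - 3/2 * (lin_app M X y k - lin_app M X p k)" for k
      proof -
        have uv: "(\<lambda>j. u j + v j) = (\<lambda>j. (1/6 + 3/2) * y j + (1/6 - 3/2) * p j)"
          "(\<lambda>j. u j - v j) = (\<lambda>j. (1/6 - 3/2) * y j + (1/6 + 3/2) * p j)"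
          by (simp_all add: u_def v_def fun_eq_iff field_simps)
        show "lin_app M X (\<lambda>j. u j + v j) k = 1/6 * (lin_app M X y k + lin_app M X p k) + 3/2 * (lin_app M X y k - lin_app M X p k)"
          "lin_app M X (\<lambda>j. u j - v j) k = 1/6 * (lin_app M X y k + lin_app M X p k) - 3/2 * (lin_app M X y k - lin_app M X p k)"
          unfolding uv lin_app_add by (simp_all add: field_simps)
      qed
      have "(cmod a)\<^sup>2 - (cmod b)\<^sup>2 = (cmod (1/6 * (a + b) + 3/2 * (a - b)))\<^sup>2 - (cmod (1/6 * (a + b) - 3/2 * (a - b)))\<^sup>2" for a b :: complex
        by (simp only: cmod_power2) (simp add: power2_eq_square field_simps)
      then show ?thesis unfolding q_def diag_form_def L
        by (simp only: sum_subtractf[symmetric] right_diff_distrib[symmetric])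
    qed
    then have "\<bar>q y\<bar> \<le> \<bar>q p\<bar> + \<bar>q (\<lambda>j. u j + v j)\<bar> + \<bar>q (\<lambda>j. u j - v j)\<bar>" by linarith
    also have "\<dots> \<le> \<eta> + \<tau> * sq_norm M (\<lambda>j. u j + v j) + \<tau> * sq_norm M (\<lambda>j. u j - v j)"
      using net_form[OF p(1)] by (intro add_mono hom unit) (auto simp: q_def)
    also have "\<dots> = \<eta> + \<tau> * (2 * (sq_norm M u + sq_norm M v))"
      unfolding sq_norm_parallelogram[symmetric] by (simp add: algebra_simps)
    also have "\<dots> \<le> \<eta> + \<tau> * (163 / 288)"
    proof -
      have "0 \<le> \<tau>" using unit[OF y] by linarith
      then show ?thesis using un vn by (intro add_left_mono mult_left_mono) (auto simp: power2_eq_square)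
    qed
    finally show ?thesis by simp
  qed
  have "\<bar>q y\<bar> \<le> 3 * \<eta>" if y: "sq_norm M y = 1" for y
  proof -
    have "\<tau> \<le> \<eta> + 163 / 288 * \<tau>"
    proof (subst (1) \<tau>_def, rule cSup_least)
      show "T \<noteq> {}" using y by (auto simp: T_def)
      show "x \<le> \<eta> + 163 / 288 * \<tau>" if "x \<in> T" for x using that step by (auto simp: T_def)
    qed
    moreover have "0 \<le> \<tau>" using unit[OF y] by linarith
    \<comment> \<open>\<open>1 - 163 / 288 = 125 / 288\<close> exceeds \<open>1 / 3\<close>.\<close>
    ultimately have "\<tau> \<le> 3 * \<eta>" by linarith
    with unit[OF y] show ?thesis by linarith
  qed
  from hom[OF this] show ?thesis by (simp add: q_def)
qed

section \<open>A net of the unit sphere\<close>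

lemma sum_half_power_abs_le: "(\<Sum>a\<in>{- int R..int R}. (1 / 2 :: real) ^ nat \<bar>a\<bar>) \<le> 3"
proof -
  have "(\<Sum>a\<in>{- int R..int R}. (1 / 2 :: real) ^ nat \<bar>a\<bar>) = 3 - 2 * (1 / 2) ^ R"
  proof (induction R)
    case (Suc R)
    have "{- int (Suc R)..int (Suc R)} = insert (- int (Suc R)) (insert (int (Suc R)) {- int R..int R})"
      by auto
    then show ?case using Suc by (simp add: nat_add_distrib)
  qed simp
  then show ?thesis by simp
qed

text \<open>The net consists of the points of a cubic lattice of mesh \<open>1 / sqrt (32 * M)\<close> in a ball;
  they are counted by weighting the lattice point \<open>k\<close> with \<open>2 ^ (50 * M - \<Sum> \<bar>k\<bar>)\<close>.\<close>

lemma ex_sphere_net: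
  assumes M: "M > 0"
  shows "\<exists>Net. finite Net \<and> real (card Net) \<le> (9 * 2 ^ 50) ^ M \<and>
    (\<forall>p\<in>Net. sq_norm M p \<le> 25 / 16) \<and>
    (\<forall>y. sq_norm M y = 1 \<longrightarrow> (\<exists>p\<in>Net. sq_norm M (\<lambda>j. y j - p j) \<le> 1 / 16))"
proof -
  \<comment> \<open>Rounding the real and the imaginary part of a coordinate errs by at most
    \<open>h\<close> each, so the squared distance is at most
    \<open>2 * h\<^sup>2 * M = 1 / 16\<close>.\<close>
  define h where "h = 1 / sqrt (32 * M)"
  have h: "h > 0" "h\<^sup>2 = 1 / (32 * M)" using M by (auto simp: h_def power_divide)
  define A where "A = {- int (50 * M)..int (50 * M)}"
  define Z where "Z = (\<lambda>k :: nat \<Rightarrow> int \<times> int. \<Sum>j<M. (fst (k j))\<^sup>2 + (snd (k j))\<^sup>2)"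
  \<comment> \<open>The condition on \<open>Z k\<close> bounds the squared norm by
    \<open>50 / 32 = 25 / 16\<close>; the finite box built from \<open>A\<close> contains all such
    points.\<close>
  define S where "S = {k \<in> PiE {..<M} (\<lambda>_. A \<times> A). Z k \<le> int (50 * M)}"
  define g where "g = (\<lambda>k :: nat \<Rightarrow> int \<times> int. \<lambda>j. Complex (h * of_int (fst (k j))) (h * of_int (snd (k j))))"
  have finA: "finite A" by (simp add: A_def)
  have finP: "finite (PiE {..<M} (\<lambda>_. A \<times> A))" using finA by (intro finite_PiE) auto
  then have finS: "finite S" by (simp add: S_def)
  have norm_g: "sq_norm M (g k) = h\<^sup>2 * of_int (Z k)" for k
    by (simp add: sq_norm_def g_def cmod_power2 power_mult_distrib Z_def sum_distrib_left algebra_simps)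
  have "real (card S) = (\<Sum>k\<in>S. 1)" by simp
  \<comment> \<open>Each weight on \<open>S\<close> is at least 1, because
    \<open>\<bar>a\<bar> \<le> a\<^sup>2\<close> for integers bounds the sum of the absolute values
    by \<open>Z k\<close>. Summed over the whole box instead of \<open>S\<close>, the weights
    factorise over the coordinates.\<close>
  also have "\<dots> \<le> (\<Sum>k\<in>S. \<Prod>j<M. 2 ^ 50 * ((1 / 2) ^ nat \<bar>fst (k j)\<bar> * (1 / 2) ^ nat \<bar>snd (k j)\<bar>))"
  proof (rule sum_mono)
    fix k assume "k \<in> S"
    then have "Z k \<le> int (50 * M)" by (simp add: S_def)
    moreover have "int (\<Sum>j<M. nat \<bar>fst (k j)\<bar> + nat \<bar>snd (k j)\<bar>) \<le> Z k"
    proof -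
      have "\<bar>a\<bar> \<le> a\<^sup>2" for a :: int
        using self_le_power[of "\<bar>a\<bar>" 2] by (cases "a = 0") auto
      then show ?thesis unfolding Z_def by (auto intro!: sum_mono add_mono)
    qed
    ultimately have le: "(\<Sum>j<M. nat \<bar>fst (k j)\<bar> + nat \<bar>snd (k j)\<bar>) \<le> 50 * M"
      by (simp only: flip: of_nat_le_iff)
    have "(\<Prod>j<M. 2 ^ 50 * ((1 / 2) ^ nat \<bar>fst (k j)\<bar> * (1 / 2) ^ nat \<bar>snd (k j)\<bar>)) =
        (2 :: real) ^ (50 * M) * (1 / 2) ^ (\<Sum>j<M. nat \<bar>fst (k j)\<bar> + nat \<bar>snd (k j)\<bar>)"
      by (simp only: prod.distrib prod_constant card_lessThan power_mult power_sum power_add)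
    also have "\<dots> \<ge> 2 ^ (50 * M) * (1 / 2) ^ (50 * M)"
      using le by (intro mult_left_mono power_decreasing) auto
    finally show "1 \<le> (\<Prod>j<M. (2 :: real) ^ 50 * ((1 / 2) ^ nat \<bar>fst (k j)\<bar> * (1 / 2) ^ nat \<bar>snd (k j)\<bar>))"
      by (simp only: power_mult_distrib[symmetric]) simp
  qed
  also have "\<dots> \<le> (\<Sum>k\<in>PiE {..<M} (\<lambda>_. A \<times> A). \<Prod>j<M. 2 ^ 50 * ((1 / 2) ^ nat \<bar>fst (k j)\<bar> * (1 / 2) ^ nat \<bar>snd (k j)\<bar>))"
    using finP by (rule sum_mono2) (use S_def in blast, intro prod_nonneg ballI, simp)
  also have "\<dots> = (\<Prod>j<M. \<Sum>ab\<in>A \<times> A. 2 ^ 50 * ((1 / 2) ^ nat \<bar>fst ab\<bar> * (1 / 2) ^ nat \<bar>snd ab\<bar>))"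
    using finA by (intro prod_sum_PiE[symmetric]) auto
  also have "\<dots> \<le> (\<Prod>j<M. 9 * 2 ^ 50)"
  proof (intro prod_mono conjI)
    have "(\<Sum>ab\<in>A \<times> A. (2 :: real) ^ 50 * ((1 / 2) ^ nat \<bar>fst ab\<bar> * (1 / 2) ^ nat \<bar>snd ab\<bar>)) =
        2 ^ 50 * ((\<Sum>a\<in>A. (1 / 2) ^ nat \<bar>a\<bar>) * (\<Sum>a\<in>A. (1 / 2) ^ nat \<bar>a\<bar>))"
    proof -
      have "(\<Sum>ab\<in>A \<times> A. u (fst ab) * u (snd ab)) = (\<Sum>a\<in>A. u a) * (\<Sum>a\<in>A. u a)" for u :: "int \<Rightarrow> real"
        by (simp only: sum_product sum.cartesian_product case_prod_unfold)
      then show ?thesis unfolding sum_distrib_left[symmetric] by (rule arg_cong)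
    qed
    also have "\<dots> \<le> 2 ^ 50 * (3 * 3)"
      unfolding A_def by (intro mult_left_mono mult_mono sum_half_power_abs_le sum_nonneg) auto
    finally show "(\<Sum>ab\<in>A \<times> A. (2 :: real) ^ 50 * ((1 / 2) ^ nat \<bar>fst ab\<bar> * (1 / 2) ^ nat \<bar>snd ab\<bar>)) \<le> 9 * 2 ^ 50"
      by simp
  qed (auto intro!: sum_nonneg)
  finally have cardS: "real (card S) \<le> (9 * 2 ^ 50) ^ M" by simp
  show ?thesis
  proof (intro exI[of _ "g ` S"] conjI ballI allI impI)
    show "finite (g ` S)" using finS by simp
    show "real (card (g ` S)) \<le> (9 * 2 ^ 50) ^ M"
      using cardS card_image_le[OF finS, of g] by linarith
  next
    fix p assume "p \<in> g ` S"
    then obtain k where k: "p = g k" "real_of_int (Z k) \<le> 50 * M" by (auto simp: S_def)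
    have "h\<^sup>2 * real_of_int (Z k) \<le> h\<^sup>2 * (50 * M)" using k(2) by (intro mult_left_mono) auto
    then show "sq_norm M p \<le> 25 / 16" unfolding k(1) norm_g using M by (simp add: h)
  next
    fix y assume y: "sq_norm M y = 1"
    define k where "k = (\<lambda>j\<in>{..<M}. (\<lfloor>Re (y j) / h\<rfloor>, \<lfloor>Im (y j) / h\<rfloor>))"
    have fl: "\<bar>t - h * of_int \<lfloor>t / h\<rfloor>\<bar> \<le> h" for t
    proof -
      have "of_int \<lfloor>t / h\<rfloor> \<le> t / h" "t / h < of_int \<lfloor>t / h\<rfloor> + 1" by linarith+
      then have "h * of_int \<lfloor>t / h\<rfloor> \<le> t" "t \<le> h * of_int \<lfloor>t / h\<rfloor> + h"
        using h(1) by (simp_all only: pos_le_divide_eq pos_divide_less_eq) (simp_all add: algebra_simps)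
      then show ?thesis by linarith
    qed
    have d: "(cmod (y j - g k j))\<^sup>2 \<le> 2 * h\<^sup>2" if "j < M" for j
    proof -
      have "(Re (y j) - h * of_int \<lfloor>Re (y j) / h\<rfloor>)\<^sup>2 \<le> h\<^sup>2" "(Im (y j) - h * of_int \<lfloor>Im (y j) / h\<rfloor>)\<^sup>2 \<le> h\<^sup>2"
        using fl h(1) by (auto simp: abs_le_square_iff[symmetric])
      then show ?thesis using that by (simp add: cmod_power2 g_def k_def)
    qed
    have "sq_norm M (\<lambda>j. y j - g k j) \<le> (\<Sum>j<M. 2 * h\<^sup>2)"
      unfolding sq_norm_def by (intro sum_mono d) auto
    also have "\<dots> = 1 / 16" using M by (simp add: h)
    finally have close: "sq_norm M (\<lambda>j. y j - g k j) \<le> 1 / 16" .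
    \<comment> \<open>Young's inequality with weights chosen to give
      \<open>5 / 4 + 5 / 16 = 25 / 16\<close>.\<close>
    have "sq_norm M (g k) \<le> 5 / 4 * sq_norm M y + 5 * sq_norm M (\<lambda>j. y j - g k j)"
    proof -
      have "(cmod b)\<^sup>2 \<le> 5 / 4 * (cmod a)\<^sup>2 + 5 * (cmod (a - b))\<^sup>2" for a b :: complex
      proof -
        have "cmod b \<le> cmod a + cmod (a - b)" using norm_triangle_ineq4[of a "a - b"] by simp
        then have "(cmod b)\<^sup>2 \<le> (cmod a + cmod (a - b))\<^sup>2" by (rule power_mono) simp
        moreover have "0 \<le> (cmod a / 2 - 2 * cmod (a - b))\<^sup>2" by simp
        ultimately show ?thesis by (simp add: power2_eq_square algebra_simps)
      qed
      then show ?thesis unfolding sq_norm_def sum_distrib_left sum.distrib[symmetric] by (intro sum_mono)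
    qed
    then have "sq_norm M (g k) \<le> 25 / 16" using y close by simp
    then have "real_of_int (Z k) \<le> 50 * M" unfolding norm_g h using M by (simp add: field_simps)
    then have Zk: "Z k \<le> int (50 * M)" by linarith
    have "k \<in> PiE {..<M} (\<lambda>_. A \<times> A)"
    proof (rule PiE_I)
      fix j assume j: "j \<in> {..<M}"
      have "(fst (k j))\<^sup>2 + (snd (k j))\<^sup>2 \<le> Z k" unfolding Z_def using j by (intro member_le_sum) auto
      from order_trans[OF this Zk] have "(fst (k j))\<^sup>2 \<le> int (50 * M)" "(snd (k j))\<^sup>2 \<le> int (50 * M)"
        by (auto intro: order_trans[rotated])
      moreover have "a \<in> A" if "a\<^sup>2 \<le> int (50 * M)" for a
      proof -
        have "\<bar>a\<bar> \<le> a\<^sup>2" using self_le_power[of "\<bar>a\<bar>" 2] by (cases "a = 0") auto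
        with that show ?thesis by (auto simp: A_def)
      qed
      ultimately show "k j \<in> A \<times> A" by (cases "k j") auto
    qed (auto simp: k_def)
    with Zk have "k \<in> S" by (simp add: S_def)
    with close show "\<exists>p\<in>g ` S. sq_norm M (\<lambda>j. y j - p j) \<le> 1 / 16" by blast
  qed
qed

section \<open>Localisation of outliers and their eigenvectors\<close>

lemma inner_sum_adj: "inner_sum n (lin_app m X y) u = inner_sum m y (lin_adj n X u)"
  unfolding inner_sum_def lin_app_def lin_adj_def
  by (simp add: sum_distrib_left sum_distrib_right) (subst sum.swap, simp add: mult_ac)

lemma inner_sum_self: "inner_sum n y y = of_real (sq_norm n y)"
  by (simp add: inner_sum_def sq_norm_def mult.commute[of "cnj _"] flip: complex_norm_square)

lemma sq_norm_diff: "sq_norm n (\<lambda>j. u j - v j) = sq_norm n u + sq_norm n v - 2 * Re (inner_sum n u v)"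
  by (simp only: sq_norm_def inner_sum_def cmod_sq_diff sum.distrib sum_subtractf sum_distrib_left Re_sum)

lemma diag_form_mono:
  assumes "\<And>k. k < n \<Longrightarrow> c k \<le> d k"
  shows "diag_form n c u \<le> diag_form n d u"
  unfolding diag_form_def by (intro sum_mono mult_right_mono assms) auto

lemma diag_form_const: "diag_form n (\<lambda>_. a) u = a * sq_norm n u"
  by (simp add: diag_form_def sq_norm_def sum_distrib_left)

lemma diag_form_add: "diag_form n (\<lambda>k. c k + d k) u = diag_form n c u + diag_form n d u"
  by (simp add: diag_form_def algebra_simps sum.distrib)

lemma diag_form_diff: "diag_form n (\<lambda>k. c k - d k) u = diag_form n c u - diag_form n d u"
  by (simp add: diag_form_def algebra_simps sum_subtractf)

lemma diag_form_le:
  assumes "\<And>k. k < n \<Longrightarrow> u k \<noteq> 0 \<Longrightarrow> c k \<le> a"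
  shows "diag_form n c u \<le> a * sq_norm n u"
  unfolding diag_form_def sq_norm_def sum_distrib_left
proof (rule sum_mono)
  fix k assume "k \<in> {..<n}"
  then show "c k * (cmod (u k))\<^sup>2 \<le> a * (cmod (u k))\<^sup>2"
    using assms[of k] by (cases "u k = 0") (auto intro: mult_right_mono)
qed

lemma diag_form_ge:
  assumes "\<And>k. k < n \<Longrightarrow> u k \<noteq> 0 \<Longrightarrow> a \<le> c k"
  shows "a * sq_norm n u \<le> diag_form n c u"
  unfolding diag_form_def sq_norm_def sum_distrib_left
proof (rule sum_mono)
  fix k assume "k \<in> {..<n}"
  then show "a * (cmod (u k))\<^sup>2 \<le> c k * (cmod (u k))\<^sup>2"
    using assms[of k] by (cases "u k = 0") (auto intro: mult_right_mono)
qed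

lemma diag_form_abs_le:
  assumes "\<And>k. k < n \<Longrightarrow> \<bar>c k\<bar> \<le> a"
  shows "\<bar>diag_form n c u\<bar> \<le> a * sq_norm n u"
  unfolding diag_form_def sq_norm_def sum_distrib_left
  by (rule order_trans[OF sum_abs]) (auto intro!: sum_mono mult_right_mono assms simp: abs_mult)

text \<open>The left side displays a coordinate of the compressed weighted operator as an explicit
  linear form in \<open>y\<close>, the shape in which it can be a row of a homogeneous
  system.\<close>

lemma lin_adj_compose:
  "(\<Sum>j'<m. (\<Sum>l<n. cnj (T l j) * (of_real (b l) * X l j')) * y j') =
    lin_adj n T (\<lambda>l. of_real (b l) * lin_app m X y l) j"
  unfolding lin_adj_def lin_app_def
  by (simp add: sum_distrib_left sum_distrib_right mult.assoc) (rule sum.swap)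

lemma Re_inner_sum_weighted:
  "Re (inner_sum n u (\<lambda>k. of_real (c k) * u k)) = diag_form n c u"
  unfolding inner_sum_def diag_form_def Re_sum cmod_power2
  by (intro sum.cong refl) (simp add: power2_eq_square algebra_simps)

lemma sq_norm_lin_app:
  assumes "\<And>y j. j < m \<Longrightarrow> lin_adj n X (lin_app m X y) j = y j"
  shows "sq_norm n (lin_app m X y) = sq_norm m y"
proof -
  have "inner_sum m y (lin_adj n X (lin_app m X y)) = inner_sum m y y"
    unfolding inner_sum_def using assms by (intro sum.cong) auto
  then show ?thesis
    unfolding inner_sum_adj[symmetric] inner_sum_self by (simp only: of_real_eq_iff)
qed

text \<open>\<open>X\<close> is the frame of eigenvectors of the perturbation in the eigenbasis of the unperturbed
  matrix \<open>diag h\<close>, and the columns of \<open>S\<close> are eigenvectors of the perturbed matrix.\<close>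

locale spiked_model =
  fixes N M :: nat and h \<theta> \<mu> :: "nat \<Rightarrow> real" and X S :: "nat \<Rightarrow> nat \<Rightarrow> complex"
  assumes adj_app: "\<And>y j. j < M \<Longrightarrow> lin_adj N X (lin_app M X y) j = y j"
    and S_iso: "\<And>v. sq_norm N (lin_adj N S v) = sq_norm N v"
    and S_diag: "\<And>v. diag_form N \<mu> (lin_adj N S v) = diag_form N h v + diag_form M \<theta> (lin_adj N X v)"
begin

lemma iso: "sq_norm N (lin_app M X y) = sq_norm M y"
  by (rule sq_norm_lin_app[OF adj_app])

lemma bessel: "sq_norm M (lin_adj N X v) \<le> sq_norm N v"
proof -
  let ?w = "lin_adj N X v"
  have "0 \<le> sq_norm N (\<lambda>k. lin_app M X ?w k - v k)" by (rule sq_norm_nonneg)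
  also have "\<dots> = sq_norm N v - sq_norm M ?w"
    unfolding sq_norm_diff iso inner_sum_adj inner_sum_self by simp
  finally show ?thesis by simp
qed

lemma form_shift:
  "diag_form N (\<lambda>k. c k + a) (lin_app M X y) = diag_form N c (lin_app M X y) + a * sq_norm M y"
  by (simp add: diag_form_add diag_form_const iso)

text \<open>The numerical radius of a Hermitian operator is its norm. With \<open>T\<close> the
  image of \<open>y\<close>, polarising the form at \<open>s * T + y\<close> and
  \<open>s * T - y\<close> produces \<open>4 * s * sq_norm M T\<close>; then
  \<open>s = 1 / \<epsilon>\<close> is inserted, or \<open>s = 1\<close> if
  \<open>\<epsilon> = 0\<close>.\<close>

lemma form_operator_bound:
  assumes form: "\<And>y. \<bar>diag_form N c (lin_app M X y)\<bar> \<le> \<epsilon> * sq_norm M y" and \<epsilon>: "\<epsilon> \<ge> 0"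
  shows "sq_norm M (lin_adj N X (\<lambda>k. of_real (c k) * lin_app M X y k)) \<le> \<epsilon>\<^sup>2 * sq_norm M y"
proof -
  define T where "T = lin_adj N X (\<lambda>k. of_real (c k) * lin_app M X y k)"
  have bil: "4 * s * sq_norm M T \<le> 2 * \<epsilon> * (s\<^sup>2 * sq_norm M T + sq_norm M y)" for s :: real
  proof -
    let ?x = "\<lambda>j. of_real s * T j"
    have L: "lin_app M X (\<lambda>j. ?x j + y j) k = of_real s * lin_app M X T k + lin_app M X y k"
      "lin_app M X (\<lambda>j. ?x j - y j) k = of_real s * lin_app M X T k - lin_app M X y k" for k
      using lin_app_add[of M X "of_real s" T 1 y k] lin_app_add[of M X "of_real s" T "- 1" y k] by simp_all
    have "diag_form N c (lin_app M X (\<lambda>j. ?x j + y j)) - diag_form N c (lin_app M X (\<lambda>j. ?x j - y j)) =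
        4 * s * Re (inner_sum N (lin_app M X T) (\<lambda>k. of_real (c k) * lin_app M X y k))"
      unfolding diag_form_def L cmod_sq_add cmod_sq_diff inner_sum_def Re_sum sum_distrib_left
        sum_subtractf[symmetric]
      by (intro sum.cong refl) (simp add: algebra_simps)
    also have "\<dots> = 4 * s * sq_norm M T"
      unfolding inner_sum_adj T_def[symmetric] inner_sum_self by simp
    finally have "4 * s * sq_norm M T \<le> \<epsilon> * sq_norm M (\<lambda>j. ?x j + y j) + \<epsilon> * sq_norm M (\<lambda>j. ?x j - y j)"
      using form[of "\<lambda>j. ?x j + y j"] form[of "\<lambda>j. ?x j - y j"] by linarith
    also have "\<dots> = \<epsilon> * (2 * (sq_norm M ?x + sq_norm M y))"
      unfolding sq_norm_parallelogram[symmetric] by (simp add: algebra_simps)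
    finally show ?thesis by (simp add: sq_norm_scale algebra_simps)
  qed
  show ?thesis
  proof (cases "\<epsilon> = 0")
    case True
    with bil[of 1] show ?thesis by (simp add: T_def)
  next
    case False
    with \<epsilon> have "\<epsilon> > 0" by simp
    with bil[of "1 / \<epsilon>"] show ?thesis unfolding T_def[symmetric]
      by (simp add: field_simps power2_eq_square)
  qed
qed

text \<open>The trial vectors are \<open>v = (x - D)\<^sup>-\<^sup>1 X y\<close>, with
  \<open>D\<close> diagonal with entries \<open>h k\<close>. On them the unperturbed form is
  \<open>x * sq_norm N v - G\<close>, and the perturbation gives back at least \<open>G\<close>,
  provided that \<open>u = X\<^sup>* v\<close> is supported on the spikes in \<open>J\<close>. One
  such \<open>v\<close> also avoids the eigenvectors in \<open>K - {k0}\<close>, so its energy is at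
  most \<open>l * sq_norm N v\<close>. The set \<open>K\<close> describes the position of
  \<open>l\<close> without fixing an order of \<open>\<mu>\<close>.\<close>

lemma eigenvalue_lower_bound:
  assumes hx: "\<And>k. k < N \<Longrightarrow> h k < x"
    and form: "\<And>y. g * sq_norm M y \<le> diag_form N (\<lambda>k. 1 / (x - h k)) (lin_app M X y)"
    and g: "g > 0" and t: "t > 0" and tg: "1 \<le> t * g"
    and J: "J \<subseteq> {..<M}" "\<And>j. j \<in> J \<Longrightarrow> t \<le> \<theta> j"
    and K: "K \<subseteq> {..<N}" "card K = card J" "k0 \<in> K" "\<And>k. k < N \<Longrightarrow> k \<notin> K - {k0} \<Longrightarrow> \<mu> k \<le> l"
  shows "x \<le> l"
proof -
  define b where "b = (\<lambda>k. 1 / (x - h k))"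
  have fin: "finite J" "finite K" using J(1) K(1) finite_subset by blast+
  have cK: "card (K - {k0}) = card J - 1" "card J > 0"
    using fin K(2,3) by (auto simp: card_gt_0_iff)
  have cJ: "card J \<le> M" using card_mono[OF _ J(1)] by simp
  \<comment> \<open>\<open>Inl\<close> equations annihilate \<open>u\<close> outside
    \<open>J\<close>, \<open>Inr\<close> equations annihilate \<open>c\<close> on
    \<open>K - {k0}\<close>. Together they are \<open>(M - card J) + (card J - 1) = M - 1\<close>
    equations for \<open>M\<close> unknowns.\<close>
  define I :: "(nat + nat) set" where "I = Inl ` ({..<M} - J) \<union> Inr ` (K - {k0})"
  have "card I = card ({..<M} - J) + card (K - {k0})"
    unfolding I_def using fin by (subst card_Un_disjoint) (auto simp: card_image)
  also have "\<dots> < M" using cK cJ J(1) fin by (simp add: card_Diff_subset)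
  finally have "card I < M" .
  moreover have "finite I" using fin by (simp add: I_def)
  ultimately obtain y where y: "\<exists>j<M. y j \<noteq> 0" and cons: "\<And>i. i \<in> I \<Longrightarrow>
      (\<Sum>j<M. (case i of Inl i \<Rightarrow> \<Sum>l<N. cnj (X l i) * (of_real (b l) * X l j)
        | Inr i \<Rightarrow> \<Sum>l<N. cnj (S l i) * (of_real (b l) * X l j)) * y j) = 0"
    using homogeneous_system[of I M "\<lambda>i j. case i of Inl i \<Rightarrow> \<Sum>l<N. cnj (X l i) * (of_real (b l) * X l j)
        | Inr i \<Rightarrow> \<Sum>l<N. cnj (S l i) * (of_real (b l) * X l j)"] by blast
  define v where "v = (\<lambda>l. of_real (b l) * lin_app M X y l)"
  define u where "u = lin_adj N X v"
  define c where "c = lin_adj N S v"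
  define G where "G = diag_form N b (lin_app M X y)"
  have u0: "u j = 0" if "j < M" "j \<notin> J" for j
    using cons[of "Inl j"] that unfolding lin_adj_compose[symmetric] u_def v_def by (simp add: I_def)
  have c0: "c k = 0" if "k \<in> K - {k0}" for k
    using cons[of "Inr k"] that unfolding lin_adj_compose[symmetric] c_def v_def by (simp add: I_def)
  have ypos: "sq_norm M y > 0" using y sq_norm_eq_0_iff[of M y] sq_norm_nonneg[of M y] by (auto simp: less_le)
  have Gy: "g * sq_norm M y \<le> G" using form[of y] by (simp add: G_def b_def)
  with ypos g have Gpos: "G > 0" by (meson mult_pos_pos order_less_le_trans)
  have ReG: "Re (inner_sum M y u) = G"
    unfolding u_def inner_sum_adj[symmetric] v_def Re_inner_sum_weighted G_def ..
  have vpos: "sq_norm N v > 0"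
  proof -
    have "sq_norm N v \<noteq> 0"
    proof
      assume "sq_norm N v = 0"
      then have "v k = 0" if "k < N" for k using that by (simp add: sq_norm_eq_0_iff)
      then have "u j = 0" for j unfolding u_def lin_adj_def by simp
      then show False using ReG Gpos by (simp add: inner_sum_def)
    qed
    then show ?thesis using sq_norm_nonneg[of N v] by simp
  qed
  \<comment> \<open>The squared norm of \<open>g y - u\<close> is nonnegative, \<open>G\<close> is
    the inner product of \<open>y\<close> and \<open>u\<close>, and
    \<open>g * sq_norm M y \<le> G\<close>.\<close>
  have "g * G \<le> sq_norm M u"
  proof -
    have "0 \<le> sq_norm M (\<lambda>j. of_real g * y j - u j)" by (rule sq_norm_nonneg)
    also have "\<dots> = g\<^sup>2 * sq_norm M y + sq_norm M u - 2 * (g * G)"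
    proof -
      have "inner_sum M (\<lambda>j. of_real g * y j) u = of_real g * inner_sum M y u"
        by (simp add: inner_sum_def sum_distrib_left mult.assoc)
      then show ?thesis unfolding sq_norm_diff sq_norm_scale by (simp add: ReG)
    qed
    also have "g\<^sup>2 * sq_norm M y \<le> g * G"
      using mult_left_mono[OF Gy, of g] g by (simp add: power2_eq_square mult.assoc)
    finally show ?thesis by linarith
  qed
  then have "t * (g * G) \<le> t * sq_norm M u" using t by (intro mult_left_mono) auto
  moreover have "G \<le> t * (g * G)" using mult_right_mono[OF tg, of G] Gpos by (simp add: mult.assoc)
  moreover have "t * sq_norm M u \<le> diag_form M \<theta> u"
    by (rule diag_form_ge) (use u0 J(2) in blast)
  ultimately have tu: "G \<le> diag_form M \<theta> u" by linarith
  have "diag_form N (\<lambda>k. x - h k) v = G"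
    unfolding diag_form_def G_def v_def
  proof (intro sum.cong refl)
    fix k assume "k \<in> {..<N}"
    then have "(x - h k) * b k = 1" using hx[of k] by (simp add: b_def)
    then have "(x - h k) * ((b k)\<^sup>2 * (cmod (lin_app M X y k))\<^sup>2) = b k * (cmod (lin_app M X y k))\<^sup>2"
      by (simp add: power2_eq_square flip: mult.assoc)
    then show "(x - h k) * (cmod (of_real (b k) * lin_app M X y k))\<^sup>2 = b k * (cmod (lin_app M X y k))\<^sup>2"
      by (simp add: norm_mult power_mult_distrib)
  qed
  then have hv: "diag_form N h v = x * sq_norm N v - G"
    unfolding diag_form_diff diag_form_const by linarith
  have "x * sq_norm N v \<le> diag_form N \<mu> c"
    unfolding c_def S_diag u_def[symmetric] using tu hv by linarith
  also have "\<dots> \<le> l * sq_norm N c"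
    by (rule diag_form_le) (use c0 K(4) in blast)
  also have "sq_norm N c = sq_norm N v" unfolding c_def by (rule S_iso)
  finally show ?thesis using vpos by simp
qed

text \<open>The dual count: now \<open>v\<close> is unrestricted in shape, lies in the span of the
  eigenvectors in \<open>K\<close>, and is orthogonal to the spikes in \<open>J - {i}\<close>. All
  remaining \<open>\<theta> j\<close> are at most \<open>t\<close>, so the perturbation contributes
  at most \<open>t * sq_norm M w\<close>, which the form \<open>A\<close> of \<open>x - D\<close>
  dominates.\<close>

lemma eigenvalue_upper_bound:
  assumes hx: "\<And>k. k < N \<Longrightarrow> h k < x"
    and form: "\<And>y. diag_form N (\<lambda>k. 1 / (x - h k)) (lin_app M X y) \<le> g * sq_norm M y"
    and g: "g > 0" and t: "t > 0" and tg: "t * g \<le> 1"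
    and J: "J \<subseteq> {..<M}" "i \<in> J" "\<And>j. j < M \<Longrightarrow> j \<notin> J - {i} \<Longrightarrow> \<theta> j \<le> t"
    and K: "K \<subseteq> {..<N}" "card K = card J" "\<And>k. k \<in> K \<Longrightarrow> l \<le> \<mu> k"
  shows "l \<le> x"
proof -
  define b where "b = (\<lambda>k. 1 / (x - h k))"
  have fin: "finite J" "finite K" using J(1) K(1) finite_subset by blast+
  have cJ: "card (J - {i}) = card J - 1" "card J > 0"
    using fin J(2) by (auto simp: card_gt_0_iff)
  have cK: "card K \<le> N" using card_mono[OF _ K(1)] by simp
  \<comment> \<open>These are \<open>(card J - 1) + (N - card K) = N - 1\<close> equations, for the
    \<open>N\<close> coordinates of \<open>v\<close> itself.\<close>
  define I :: "(nat + nat) set" where "I = Inl ` (J - {i}) \<union> Inr ` ({..<N} - K)"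
  have "card I = card (J - {i}) + card ({..<N} - K)"
    unfolding I_def using fin by (subst card_Un_disjoint) (auto simp: card_image)
  also have "\<dots> < N" using cK cJ K(1,2) fin by (simp add: card_Diff_subset)
  finally have "card I < N" .
  moreover have "finite I" using fin by (simp add: I_def)
  ultimately obtain v where v: "\<exists>k<N. v k \<noteq> 0" and cons: "\<And>i. i \<in> I \<Longrightarrow>
      (\<Sum>k<N. (case i of Inl i \<Rightarrow> cnj (X k i) | Inr i \<Rightarrow> cnj (S k i)) * v k) = 0"
    using homogeneous_system[of I N "\<lambda>i k. case i of Inl i \<Rightarrow> cnj (X k i) | Inr i \<Rightarrow> cnj (S k i)"] by blast
  define w where "w = lin_adj N X v"
  define c where "c = lin_adj N S v"
  define A where "A = diag_form N (\<lambda>k. x - h k) v"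
  have w0: "w j = 0" if "j \<in> J - {i}" for j
    using cons[of "Inl j"] that by (simp add: I_def w_def lin_adj_def)
  have c0: "c k = 0" if "k < N" "k \<notin> K" for k
    using cons[of "Inr k"] that by (simp add: I_def c_def lin_adj_def)
  have vpos: "sq_norm N v > 0" using v sq_norm_eq_0_iff[of N v] sq_norm_nonneg[of N v] by (auto simp: less_le)
  define s where "s = 1 / g"
  have s: "s > 0" "s * g = 1" using g by (auto simp: s_def)
  \<comment> \<open>A square is completed in the inner product with weights \<open>x - h k\<close>;
    the vector \<open>?e\<close> is the resolvent at \<open>x\<close> applied to
    \<open>s X w\<close>.\<close>
  have "s * sq_norm M w \<le> A"
  proof -
    let ?e = "\<lambda>k. of_real (s * b k) * lin_app M X w k"
    have "0 \<le> diag_form N (\<lambda>k. x - h k) (\<lambda>k. v k - ?e k)"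
      unfolding diag_form_def using hx by (intro sum_nonneg mult_nonneg_nonneg) (auto simp: less_imp_le)
    also have "\<dots> = A + s\<^sup>2 * diag_form N b (lin_app M X w) - 2 * s * Re (inner_sum N v (lin_app M X w))"
      unfolding A_def diag_form_def inner_sum_def Re_sum sum_distrib_left sum.distrib[symmetric] sum_subtractf[symmetric]
    proof (intro sum.cong refl)
      fix k assume "k \<in> {..<N}"
      then have xb: "(x - h k) * b k = 1" using hx[of k] by (simp add: b_def)
      have "Re (cnj (v k) * ?e k) = s * b k * Re (cnj (v k) * lin_app M X w k)"
        by (simp add: algebra_simps)
      moreover have "(cmod (?e k))\<^sup>2 = s\<^sup>2 * (b k)\<^sup>2 * (cmod (lin_app M X w k))\<^sup>2"
        by (simp add: norm_mult power_mult_distrib)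
      ultimately have "(x - h k) * (cmod (v k - ?e k))\<^sup>2 = (x - h k) * (cmod (v k))\<^sup>2
          + s\<^sup>2 * (((x - h k) * b k) * b k * (cmod (lin_app M X w k))\<^sup>2)
          - 2 * s * (((x - h k) * b k) * Re (cnj (v k) * lin_app M X w k))"
        unfolding cmod_sq_diff by (simp add: algebra_simps power2_eq_square)
      then show "(x - h k) * (cmod (v k - ?e k))\<^sup>2 = (x - h k) * (cmod (v k))\<^sup>2
          + s\<^sup>2 * (b k * (cmod (lin_app M X w k))\<^sup>2) - 2 * s * Re (cnj (v k) * lin_app M X w k)"
        unfolding xb by simp
    qed
    also have "Re (inner_sum N v (lin_app M X w)) = sq_norm M w"
    proof -
      have "inner_sum N v (lin_app M X w) = cnj (inner_sum N (lin_app M X w) v)"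
        by (simp add: inner_sum_def mult.commute)
      then show ?thesis unfolding inner_sum_adj w_def[symmetric] inner_sum_self by simp
    qed
    also have "s\<^sup>2 * diag_form N b (lin_app M X w) \<le> s\<^sup>2 * (g * sq_norm M w)"
      using form[of w] unfolding b_def by (intro mult_left_mono) auto
    also have "s\<^sup>2 * (g * sq_norm M w) = s * sq_norm M w" using s(2) by (simp add: power2_eq_square)
    finally show ?thesis by linarith
  qed
  moreover have "t * sq_norm M w \<le> s * sq_norm M w"
    using tg g sq_norm_nonneg by (intro mult_right_mono) (auto simp: s_def field_simps)
  moreover have "diag_form M \<theta> w \<le> t * sq_norm M w"
    by (rule diag_form_le) (use w0 J(3) in blast)
  ultimately have tw: "diag_form M \<theta> w \<le> A" by linarith
  have hv: "diag_form N h v = x * sq_norm N v - A"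
    unfolding A_def diag_form_diff diag_form_const by linarith
  have "l * sq_norm N v = l * sq_norm N c" unfolding c_def S_iso ..
  also have "\<dots> \<le> diag_form N \<mu> c"
    by (rule diag_form_ge) (use c0 K(3) in blast)
  also have "\<dots> \<le> x * sq_norm N v"
    unfolding c_def S_diag w_def[symmetric] using tw hv by linarith
  finally show ?thesis using vpos by simp
qed

text \<open>Moving \<open>z\<close> by \<open>r = 12 * B\<^sup>2 * \<epsilon>\<close> changes every
  \<open>1 / (z - h k)\<close> by at least \<open>\<epsilon>\<close>, which covers the error of the
  form. Hence the form is at least \<open>1 / t\<close> at \<open>z - r\<close> and at most
  \<open>1 / t\<close> at \<open>z + r\<close>, and both min-max bounds apply with
  \<open>g = 1 / t\<close>.\<close>

lemma eigenvalue_close: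
  assumes gap: "\<And>k. k < N \<Longrightarrow> 2 * \<delta> \<le> z - h k" and width: "\<And>k. k < N \<Longrightarrow> z - h k \<le> 3 * B"
    and \<delta>: "\<delta> > 0" "\<delta> \<le> B" and t: "t > 0"
    and form: "\<And>y. \<bar>diag_form N (\<lambda>k. 1 / (z - h k) - 1 / t) (lin_app M X y)\<bar> \<le> \<epsilon> * sq_norm M y"
    and \<epsilon>: "\<epsilon> \<ge> 0" "12 * B\<^sup>2 * \<epsilon> \<le> \<delta>"
    and J: "J \<subseteq> {..<M}" "i \<in> J" "\<And>j. j \<in> J \<Longrightarrow> t \<le> \<theta> j"
      "\<And>j. j < M \<Longrightarrow> j \<notin> J - {i} \<Longrightarrow> \<theta> j \<le> t"
    and K: "K \<subseteq> {..<N}" "card K = card J" "k0 \<in> K" "\<And>k. k \<in> K \<Longrightarrow> l \<le> \<mu> k"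
      "\<And>k. k < N \<Longrightarrow> k \<notin> K - {k0} \<Longrightarrow> \<mu> k \<le> l"
  shows "\<bar>l - z\<bar> \<le> 12 * B\<^sup>2 * \<epsilon>"
proof -
  define r where "r = 12 * B\<^sup>2 * \<epsilon>"
  have r: "0 \<le> r" "r \<le> \<delta>" using \<epsilon> by (auto simp: r_def)
  have shift: "1 / a + \<epsilon> \<le> 1 / c" if "0 < a" "0 < c" "\<epsilon> * (a * c) \<le> a - c" for a c :: real
    using that by (simp add: field_simps)
  \<comment> \<open>Here \<open>12 = 4 * 3\<close>: one denominator is at most \<open>3 * B\<close>,
    and the other at most \<open>3 * B + r\<close>, where
    \<open>r \<le> \<delta> \<le> B\<close>.\<close>
  have shift': "1 / a + \<epsilon> \<le> 1 / c" if "0 < a" "0 < c" "a \<le> 4 * B" "c \<le> 3 * B" "a - c = r" for a c :: real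
  proof (rule shift[OF that(1,2)])
    have "a * c \<le> (4 * B) * (3 * B)" using that by (intro mult_mono) auto
    then have "\<epsilon> * (a * c) \<le> \<epsilon> * ((4 * B) * (3 * B))" using \<epsilon>(1) by (rule mult_left_mono)
    then show "\<epsilon> * (a * c) \<le> a - c" unfolding that(5) r_def by (simp add: power2_eq_square mult_ac)
  qed
  have "z - r \<le> l"
  proof (rule eigenvalue_lower_bound[where g = "1 / t", OF _ _ _ t _ J(1,3) K(1,2,3,5)])
    show "h k < z - r" if "k < N" for k using gap[OF that] r \<delta> by linarith
    fix y
    have "1 / t * sq_norm M y \<le> diag_form N (\<lambda>k. 1 / (z - h k) - 1 / t) (lin_app M X y) + (1 / t + \<epsilon>) * sq_norm M y"
      using form[of y] by (simp add: distrib_right)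
    also have "\<dots> = diag_form N (\<lambda>k. (1 / (z - h k) - 1 / t) + (1 / t + \<epsilon>)) (lin_app M X y)"
      by (rule form_shift[symmetric])
    also have "\<dots> \<le> diag_form N (\<lambda>k. 1 / (z - r - h k)) (lin_app M X y)"
    proof (rule diag_form_mono)
      fix k assume k: "k < N"
      have "1 / (z - h k) + \<epsilon> \<le> 1 / (z - r - h k)"
        using gap[OF k] width[OF k] r \<delta> by (intro shift') linarith+
      then show "1 / (z - h k) - 1 / t + (1 / t + \<epsilon>) \<le> 1 / (z - r - h k)" by simp
    qed
    finally show "1 / t * sq_norm M y \<le> diag_form N (\<lambda>k. 1 / (z - r - h k)) (lin_app M X y)" .
  qed (use t in auto)
  moreover have "l \<le> z + r"
  proof (rule eigenvalue_upper_bound[where g = "1 / t", OF _ _ _ t _ J(1,2,4) K(1,2,4)])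
    show "h k < z + r" if "k < N" for k using gap[OF that] r \<delta> by linarith
    fix y
    have "diag_form N (\<lambda>k. 1 / (z + r - h k)) (lin_app M X y)
        \<le> diag_form N (\<lambda>k. (1 / (z - h k) - 1 / t) + (1 / t - \<epsilon>)) (lin_app M X y)"
    proof (rule diag_form_mono)
      fix k assume k: "k < N"
      have "1 / (z + r - h k) + \<epsilon> \<le> 1 / (z - h k)"
        using gap[OF k] width[OF k] r \<delta> by (intro shift') linarith+
      then show "1 / (z + r - h k) \<le> 1 / (z - h k) - 1 / t + (1 / t - \<epsilon>)" by simp
    qed
    also have "\<dots> = diag_form N (\<lambda>k. 1 / (z - h k) - 1 / t) (lin_app M X y) + (1 / t - \<epsilon>) * sq_norm M y"
      by (rule form_shift)
    also have "\<dots> \<le> 1 / t * sq_norm M y"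
      using form[of y] by (simp add: left_diff_distrib)
    finally show "diag_form N (\<lambda>k. 1 / (z + r - h k)) (lin_app M X y) \<le> 1 / t * sq_norm M y" .
  qed (use t in auto)
  ultimately show ?thesis unfolding r_def[symmetric] by linarith
qed

text \<open>Replacing \<open>l\<close> by \<open>z\<close> costs
  \<open>r / (2 * \<delta>\<^sup>2)\<close> in the resolvent and
  \<open>3 * r / (4 * \<delta>^3)\<close> in its square, since the \<open>h k\<close> keep distance
  \<open>\<delta>\<close> from \<open>l\<close> and \<open>2 * \<delta>\<close> from
  \<open>z\<close>. The first estimate also yields that \<open>d\<close>, the image of
  \<open>w\<close> under the spikes, has nearly the norm of \<open>t w\<close>; the second estimate
  then follows from the norm of \<open>v\<close>.\<close>

lemma eigenvector_estimates:
  assumes gap: "\<And>k. k < N \<Longrightarrow> 2 * \<delta> \<le> z - h k" and \<delta>: "\<delta> > 0"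
    and t: "t > 0" "t \<le> B" and m2: "m2 \<ge> 0"
    and form1: "\<And>y. \<bar>diag_form N (\<lambda>k. 1 / (z - h k) - 1 / t) (lin_app M X y)\<bar> \<le> \<epsilon> * sq_norm M y"
    and form2: "\<And>y. \<bar>diag_form N (\<lambda>k. (1 / (z - h k))\<^sup>2 - m2) (lin_app M X y)\<bar> \<le> \<epsilon> * sq_norm M y"
    and \<epsilon>: "\<epsilon> \<ge> 0"
    and \<theta>: "\<And>j. j < M \<Longrightarrow> \<bar>\<theta> j\<bar> \<le> B"
    and r: "\<bar>l - z\<bar> \<le> r" "r \<le> \<delta>"
    and eig: "\<And>k. k < N \<Longrightarrow> of_real (l - h k) * v k = lin_app M X (\<lambda>j. of_real (\<theta> j) * lin_adj N X v j) k"
    and v: "sq_norm N v = 1"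
  shows "sqrt (sq_norm M (\<lambda>j. of_real (\<theta> j) * lin_adj N X v j - of_real t * lin_adj N X v j))
      \<le> B\<^sup>2 * (\<epsilon> + r / (2 * \<delta>\<^sup>2))" (is "?P \<le> _")
    and "\<bar>1 - m2 * t\<^sup>2 * sq_norm M (lin_adj N X v)\<bar>
      \<le> B\<^sup>2 * (\<epsilon> + 3 * r / (4 * \<delta>^3)) + 2 * m2 * B^3 * (\<epsilon> + r / (2 * \<delta>\<^sup>2))"
proof -
  define w where "w = lin_adj N X v"
  define d where "d = (\<lambda>j. of_real (\<theta> j) * w j)"
  define b where "b = (\<lambda>k. 1 / (l - h k))"
  define E where "E = \<epsilon> + r / (2 * \<delta>\<^sup>2)"
  have r0: "r \<ge> 0" using r(1) by linarith
  have E0: "E \<ge> 0" using \<epsilon> r0 by (simp add: E_def)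
  have B: "B > 0" using t by linarith
  have lh: "\<delta> \<le> l - h k" if "k < N" for k using gap[OF that] r by linarith
  have ba: "\<bar>b k - 1 / (z - h k)\<bar> \<le> r / (2 * \<delta>\<^sup>2)" if k: "k < N" for k
  proof -
    have pos: "0 < l - h k" "0 < z - h k" using lh[OF k] gap[OF k] \<delta> by linarith+
    have "b k - 1 / (z - h k) = (z - l) / ((l - h k) * (z - h k))"
      using pos by (simp add: b_def field_simps)
    then have "\<bar>b k - 1 / (z - h k)\<bar> = \<bar>l - z\<bar> / ((l - h k) * (z - h k))"
      using pos by (simp add: abs_mult abs_divide abs_minus_commute)
    also have "\<dots> \<le> r / (\<delta> * (2 * \<delta>))"
      using r(1) lh[OF k] gap[OF k] \<delta> pos by (intro frac_le mult_mono) auto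
    finally show ?thesis by (simp add: power2_eq_square mult_ac)
  qed
  have a_le: "1 / (z - h k) \<le> 1 / (2 * \<delta>)" "0 \<le> 1 / (z - h k)" if "k < N" for k
    using gap[OF that] \<delta> by (auto intro!: frac_le)
  have b_le: "b k \<le> 1 / \<delta>" "0 \<le> b k" if "k < N" for k
    using lh[OF that] \<delta> by (auto simp: b_def intro!: frac_le)
  have vb: "v k = of_real (b k) * lin_app M X d k" if k: "k < N" for k
  proof -
    have "of_real (l - h k) * v k = lin_app M X d k"
      using eig[OF k] by (simp add: d_def w_def)
    then have "of_real (b k) * lin_app M X d k = of_real (b k * (l - h k)) * v k" by simp
    also have "b k * (l - h k) = 1" using lh[OF k] \<delta> by (simp add: b_def)
    finally show ?thesis by simp
  qed
  have form_b: "\<bar>diag_form N (\<lambda>k. b k - 1 / t) (lin_app M X y)\<bar> \<le> E * sq_norm M y" for y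
  proof -
    have "diag_form N (\<lambda>k. b k - 1 / t) (lin_app M X y) =
        diag_form N (\<lambda>k. 1 / (z - h k) - 1 / t) (lin_app M X y) + diag_form N (\<lambda>k. b k - 1 / (z - h k)) (lin_app M X y)"
      unfolding diag_form_add[symmetric] by simp
    moreover have "\<bar>diag_form N (\<lambda>k. b k - 1 / (z - h k)) (lin_app M X y)\<bar> \<le> r / (2 * \<delta>\<^sup>2) * sq_norm M y"
      using diag_form_abs_le[of N "\<lambda>k. b k - 1 / (z - h k)" _ "lin_app M X y", OF ba] iso by simp
    ultimately show ?thesis using form1[of y] unfolding E_def distrib_right by linarith
  qed
  have w_d: "lin_adj N X (\<lambda>k. of_real (b k - 1 / t) * lin_app M X d k) j = w j - of_real (1 / t) * d j" if "j < M" for j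
  proof -
    have "w j = lin_adj N X (\<lambda>k. of_real (b k) * lin_app M X d k) j"
      unfolding w_def lin_adj_def using vb by (intro sum.cong) auto
    moreover have "lin_adj N X (\<lambda>k. of_real (b k - 1 / t) * lin_app M X d k) j =
        lin_adj N X (\<lambda>k. of_real (b k) * lin_app M X d k) j - of_real (1 / t) * lin_adj N X (lin_app M X d) j"
      unfolding lin_adj_def sum_distrib_left sum_subtractf[symmetric]
      by (intro sum.cong refl) (simp add: algebra_simps)
    ultimately show ?thesis using adj_app[OF that] by simp
  qed
  have w1: "sq_norm M w \<le> 1" using bessel[of v] v by (simp add: w_def)
  have dw: "sq_norm M d \<le> B\<^sup>2 * sq_norm M w"
    unfolding d_def sq_norm_def sum_distrib_left using \<theta> B
    by (intro sum_mono) (auto simp: norm_mult power_mult_distrib abs_le_square_iff[symmetric] intro!: mult_right_mono)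
  also have "\<dots> \<le> B\<^sup>2" using w1 by (simp add: mult_left_le)
  finally have d1: "sq_norm M d \<le> B\<^sup>2" .
  \<comment> \<open>By \<open>w_d\<close> the vector \<open>w - d / t\<close> is the compressed
    operator with weights \<open>b k - 1 / t\<close> applied to \<open>d\<close>, so a bound for its
    form bounds its norm.\<close>
  have "sq_norm M (\<lambda>j. w j - of_real (1 / t) * d j) \<le> E\<^sup>2 * sq_norm M d"
    using form_operator_bound[OF form_b E0, of d] w_d by (simp add: sq_norm_def)
  also have "\<dots> \<le> E\<^sup>2 * B\<^sup>2" using d1 by (intro mult_left_mono) auto
  finally have wd: "sq_norm M (\<lambda>j. w j - of_real (1 / t) * d j) \<le> (E * B)\<^sup>2" by (simp add: power_mult_distrib)
  have "sq_norm M (\<lambda>j. d j - of_real t * w j) = sq_norm M (\<lambda>j. of_real (- t) * (w j - of_real (1 / t) * d j))"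
    using t by (simp add: algebra_simps)
  also have "\<dots> \<le> B\<^sup>2 * (E * B)\<^sup>2"
    unfolding sq_norm_scale using t sq_norm_nonneg wd by (intro mult_mono) (auto simp: abs_le_square_iff[symmetric])
  also have "\<dots> = (B\<^sup>2 * E)\<^sup>2" by (simp add: power2_eq_square algebra_simps)
  finally have "sqrt (sq_norm M (\<lambda>j. d j - of_real t * w j)) \<le> B\<^sup>2 * E"
    using E0 by (simp add: real_le_lsqrt sq_norm_nonneg)
  then show P: "sqrt (sq_norm M (\<lambda>j. of_real (\<theta> j) * lin_adj N X v j - of_real t * lin_adj N X v j))
      \<le> B\<^sup>2 * (\<epsilon> + r / (2 * \<delta>\<^sup>2))" by (simp add: d_def w_def E_def)
  have nrm: "sqrt (sq_norm M y) = L2_set (\<lambda>j. cmod (y j)) {..<M}" for y by (simp add: sq_norm_def L2_set_def)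
  have tri: "sqrt (sq_norm M (\<lambda>j. x j + y j)) \<le> sqrt (sq_norm M x) + sqrt (sq_norm M y)" for x y
    unfolding nrm by (rule order_trans[OF L2_set_mono L2_set_triangle_ineq]) (auto intro: norm_triangle_ineq)
  define p where "p = sqrt (sq_norm M (\<lambda>j. d j - of_real t * w j))"
  have p: "p \<le> B\<^sup>2 * E" using P by (simp add: p_def d_def w_def E_def)
  define nd where "nd = sqrt (sq_norm M d)"
  define nw where "nw = t * sqrt (sq_norm M w)"
  have nw: "nw = sqrt (sq_norm M (\<lambda>j. of_real t * w j))"
    unfolding sq_norm_scale nw_def using t by (simp add: real_sqrt_mult)
  have "nd \<le> p + nw" unfolding nd_def p_def nw using tri[of "\<lambda>j. d j - of_real t * w j" "\<lambda>j. of_real t * w j"] by simp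
  moreover have "nw \<le> p + nd"
  proof -
    have "sq_norm M (\<lambda>j. of_real t * w j - d j) = sq_norm M (\<lambda>j. d j - of_real t * w j)"
      by (simp add: sq_norm_def norm_minus_commute)
    then show ?thesis
      unfolding nd_def p_def nw using tri[of "\<lambda>j. of_real t * w j - d j" d] by simp
  qed
  ultimately have diff: "\<bar>nd - nw\<bar> \<le> B\<^sup>2 * E" using p by linarith
  have ndB: "0 \<le> nd" "nd \<le> B" unfolding nd_def using d1 B sq_norm_nonneg by (auto intro!: real_le_lsqrt)
  have nwB: "0 \<le> nw" "nw \<le> B"
  proof -
    have "sqrt (sq_norm M w) \<le> 1" using w1 by simp
    then have "t * sqrt (sq_norm M w) \<le> B * 1" using t sq_norm_nonneg by (intro mult_mono) auto
    then show "nw \<le> B" by (simp add: nw_def)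
    show "0 \<le> nw" using t sq_norm_nonneg by (simp add: nw_def)
  qed
  \<comment> \<open>Both norms are at most \<open>B\<close>, so passing to squares costs a factor
    \<open>2 * B\<close>.\<close>
  have "\<bar>nd\<^sup>2 - nw\<^sup>2\<bar> = \<bar>nd - nw\<bar> * (nd + nw)"
    using ndB nwB by (simp add: power2_eq_square square_diff_square_factored abs_mult mult.commute)
  also have "\<dots> \<le> (B\<^sup>2 * E) * (2 * B)"
    using diff ndB nwB E0 by (intro mult_mono) auto
  also have "\<dots> = 2 * B^3 * E" by (simp add: power2_eq_square power3_eq_cube)
  finally have sqd: "\<bar>sq_norm M d - t\<^sup>2 * sq_norm M w\<bar> \<le> 2 * B^3 * E"
    using sq_norm_nonneg by (simp add: nd_def nw_def power_mult_distrib)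
  \<comment> \<open>The squared norm of \<open>v\<close>, read as a form in \<open>d\<close> with
    the squared resolvent as weights.\<close>
  have "1 = diag_form N (\<lambda>k. (b k)\<^sup>2) (lin_app M X d)"
    unfolding v[symmetric] sq_norm_def diag_form_def using vb
    by (intro sum.cong) (auto simp: norm_mult power_mult_distrib)
  also have "\<dots> = diag_form N (\<lambda>k. (1 / (z - h k))\<^sup>2 - m2) (lin_app M X d)
      + diag_form N (\<lambda>k. (b k)\<^sup>2 - (1 / (z - h k))\<^sup>2) (lin_app M X d) + m2 * sq_norm M d"
    unfolding iso[symmetric] diag_form_const[symmetric] diag_form_add[symmetric] by simp
  finally have one: "1 = diag_form N (\<lambda>k. (1 / (z - h k))\<^sup>2 - m2) (lin_app M X d)
      + diag_form N (\<lambda>k. (b k)\<^sup>2 - (1 / (z - h k))\<^sup>2) (lin_app M X d) + m2 * sq_norm M d" .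
  have "\<bar>(b k)\<^sup>2 - (1 / (z - h k))\<^sup>2\<bar> \<le> 3 * r / (4 * \<delta>^3)" if k: "k < N" for k
  proof -
    have "(b k)\<^sup>2 - (1 / (z - h k))\<^sup>2 = (b k - 1 / (z - h k)) * (b k + 1 / (z - h k))"
      by (simp add: power2_eq_square algebra_simps)
    then have "\<bar>(b k)\<^sup>2 - (1 / (z - h k))\<^sup>2\<bar> = \<bar>b k - 1 / (z - h k)\<bar> * (b k + 1 / (z - h k))"
      using a_le[OF k] b_le[OF k] by (simp add: abs_mult)
    also have "\<dots> \<le> (r / (2 * \<delta>\<^sup>2)) * (1 / \<delta> + 1 / (2 * \<delta>))"
      using ba[OF k] a_le[OF k] b_le[OF k] r0 \<delta> by (intro mult_mono add_mono) auto
    also have "\<dots> = 3 * r / (4 * \<delta>^3)" using \<delta> by (simp add: field_simps power2_eq_square power3_eq_cube)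
    finally show ?thesis .
  qed
  from diag_form_abs_le[of N "\<lambda>k. (b k)\<^sup>2 - (1 / (z - h k))\<^sup>2" _ "lin_app M X d", OF this]
  have "\<bar>diag_form N (\<lambda>k. (b k)\<^sup>2 - (1 / (z - h k))\<^sup>2) (lin_app M X d)\<bar> \<le> 3 * r / (4 * \<delta>^3) * sq_norm M d"
    using iso by simp
  with form2[of d] have "\<bar>1 - m2 * sq_norm M d\<bar> \<le> (\<epsilon> + 3 * r / (4 * \<delta>^3)) * sq_norm M d"
    unfolding distrib_right using one by linarith
  also have "\<dots> \<le> (\<epsilon> + 3 * r / (4 * \<delta>^3)) * B\<^sup>2" using d1 \<epsilon> r0 \<delta> by (intro mult_left_mono) auto
  finally have "\<bar>1 - m2 * sq_norm M d\<bar> \<le> B\<^sup>2 * (\<epsilon> + 3 * r / (4 * \<delta>^3))" by (simp add: mult.commute)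
  moreover have "\<bar>m2 * sq_norm M d - m2 * t\<^sup>2 * sq_norm M w\<bar> \<le> 2 * m2 * B^3 * E"
  proof -
    have "m2 * sq_norm M d - m2 * t\<^sup>2 * sq_norm M w = m2 * (sq_norm M d - t\<^sup>2 * sq_norm M w)"
      by (simp add: algebra_simps)
    moreover have "m2 * \<bar>sq_norm M d - t\<^sup>2 * sq_norm M w\<bar> \<le> m2 * (2 * B^3 * E)"
      using sqd m2 by (rule mult_left_mono)
    ultimately show ?thesis using m2 by (simp add: abs_mult mult_ac)
  qed
  ultimately show "\<bar>1 - m2 * t\<^sup>2 * sq_norm M (lin_adj N X v)\<bar>
      \<le> B\<^sup>2 * (\<epsilon> + 3 * r / (4 * \<delta>^3)) + 2 * m2 * B^3 * (\<epsilon> + r / (2 * \<delta>\<^sup>2))"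
    unfolding E_def[symmetric] w_def[symmetric] by linarith
qed

end

section \<open>Hermitian matrices\<close>

lemma mat_adjoint_dim [simp]:
  "dim_row (mat_adjoint A) = dim_col A" "dim_col (mat_adjoint A) = dim_row A"
  by (simp_all add: mat_adjoint_def)

lemma mat_adjoint_carrier [simp]: "mat_adjoint A \<in> carrier_mat m n \<longleftrightarrow> A \<in> carrier_mat n m"
  unfolding carrier_mat_def mem_Collect_eq mat_adjoint_dim by (rule conj_commute)

lemma index_mat_adjoint [simp]:
  assumes "i < dim_col A" "j < dim_row A"
  shows "mat_adjoint A $$ (i, j) = conjugate (A $$ (j, i))"
  using assms by (simp add: mat_adjoint_def mat_of_rows_def)

lemma mat_adjoint_twice [simp]: "mat_adjoint (mat_adjoint A) = A"
  by (rule eq_matI) auto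

lemma index_mat_mult_sum:
  fixes A B :: "'a :: semiring_0 mat"
  assumes "i < dim_row A" "j < dim_col B" "dim_col A = n" "dim_row B = n"
  shows "(A * B) $$ (i, j) = (\<Sum>k<n. A $$ (i, k) * B $$ (k, j))"
  using assms by (simp add: scalar_prod_def lessThan_atLeast0)

lemma index_mat_vec_sum:
  fixes A :: "'a :: semiring_0 mat"
  assumes "i < dim_row A" "dim_col A = n" "dim_vec v = n"
  shows "vec_index (A *\<^sub>v v) i = (\<Sum>k<n. A $$ (i, k) * vec_index v k)"
  using assms by (simp add: scalar_prod_def lessThan_atLeast0)

lemma mat_adjoint_mult:
  assumes "A \<in> carrier_mat n m" "B \<in> carrier_mat m p"
  shows "mat_adjoint (A * B) = mat_adjoint B * mat_adjoint A"
proof (rule eq_matI)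
  fix i j assume "i < dim_row (mat_adjoint B * mat_adjoint A)" "j < dim_col (mat_adjoint B * mat_adjoint A)"
  then have ij: "i < p" "j < n" using assms by auto
  have "(mat_adjoint B * mat_adjoint A) $$ (i, j) = (\<Sum>k<m. mat_adjoint B $$ (i, k) * mat_adjoint A $$ (k, j))"
    using assms ij by (intro index_mat_mult_sum) auto
  also have "\<dots> = conjugate (\<Sum>k<m. A $$ (j, k) * B $$ (k, i))"
    using assms ij by (simp add: sum_conjugate conjugate_dist_mul mult.commute)
  also have "(\<Sum>k<m. A $$ (j, k) * B $$ (k, i)) = (A * B) $$ (j, i)"
    using assms ij by (intro index_mat_mult_sum[symmetric]) auto
  finally show "mat_adjoint (A * B) $$ (i, j) = (mat_adjoint B * mat_adjoint A) $$ (i, j)"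
    using assms ij by simp
qed (use assms in auto)

lemma mat_adjoint_minus:
  assumes "A \<in> carrier_mat n m" "B \<in> carrier_mat n m"
  shows "mat_adjoint (A - B) = mat_adjoint A - mat_adjoint B"
  using assms by (intro eq_matI) (auto simp: conjugate_dist_add conjugate_neg simp flip: add_uminus_conv_diff)

lemma hermitian_matD:
  assumes "hermitian_mat n A"
  shows "A \<in> carrier_mat n n" "mat_adjoint A = A"
    and "i < n \<Longrightarrow> j < n \<Longrightarrow> conjugate (A $$ (j, i)) = A $$ (i, j)"
proof -
  show *: "A \<in> carrier_mat n n" "mat_adjoint A = A" using assms by (auto simp: hermitian_mat_def)
  show "conjugate (A $$ (j, i)) = A $$ (i, j)" if "i < n" "j < n"
    using index_mat_adjoint[of i A j] * that by simp
qed

lemma unitary_groupD: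
  assumes "U \<in> unitary_group n"
  shows "U \<in> carrier_mat n n" "mat_adjoint U * U = 1\<^sub>m n" "U * mat_adjoint U = 1\<^sub>m n"
  using assms by (auto simp: unitary_group_def)

lemma unitary_groupI:
  assumes "U \<in> carrier_mat n n" "mat_adjoint U * U = 1\<^sub>m n"
  shows "U \<in> unitary_group n"
  using assms mat_mult_left_right_inverse[of "mat_adjoint U" n U] by (auto simp: unitary_group_def)

lemma unitary_group_mult:
  assumes "U \<in> unitary_group n" "W \<in> unitary_group n"
  shows "U * W \<in> unitary_group n"
proof (rule unitary_groupI)
  note U = unitary_groupD[OF assms(1)] and W = unitary_groupD[OF assms(2)]
  show "U * W \<in> carrier_mat n n" using U W by auto
  have "mat_adjoint (U * W) * (U * W) = mat_adjoint W * (mat_adjoint U * U) * W"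
    unfolding mat_adjoint_mult[OF U(1) W(1)] using U(1) W(1)
    by (simp add: assoc_mult_mat[of _ n n _ n _ n])
  then show "mat_adjoint (U * W) * (U * W) = 1\<^sub>m n"
    unfolding U(2) using W by simp
qed

lemma unitary_group_adjoint: "U \<in> unitary_group n \<Longrightarrow> mat_adjoint U \<in> unitary_group n"
  by (auto simp: unitary_group_def)

lemma hermitian_mat_conj:
  assumes A: "hermitian_mat n A" and U: "U \<in> carrier_mat n m"
  shows "hermitian_mat m (mat_adjoint U * A * U)"
proof -
  note A' = hermitian_matD[OF A]
  have "mat_adjoint (mat_adjoint U * A * U) = mat_adjoint U * (mat_adjoint (mat_adjoint U * A))"
    using A' U by (intro mat_adjoint_mult[of _ m n]) auto
  also have "mat_adjoint (mat_adjoint U * A) = A * U"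
    using A' U by (subst mat_adjoint_mult[of _ m n]) auto
  also have "mat_adjoint U * (A * U) = mat_adjoint U * A * U"
    using A' U by (intro assoc_mult_mat[symmetric, of _ m n _ n _ m]) auto
  finally show ?thesis using A' U by (auto simp: hermitian_mat_def)
qed

lemma hermitian_mat_add:
  assumes "hermitian_mat n A" "hermitian_mat n B"
  shows "hermitian_mat n (A + B)"
  using hermitian_matD[OF assms(1)] hermitian_matD[OF assms(2)]
  unfolding hermitian_mat_def
  by (auto intro!: eq_matI simp: conjugate_dist_add)

text \<open>In a decreasing list the head is the largest root of the product, so the heads agree and
  their linear factor cancels. This gives the definite description in \<open>eigval_list\<close> its
  uniqueness.\<close>

lemma sorted_linear_factors_unique:
  assumes "sorted_wrt (\<ge>) xs" "sorted_wrt (\<ge>) ys"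
    and "(\<Prod>l\<leftarrow>xs. [:- of_real l, 1:]) = (\<Prod>l\<leftarrow>ys. [:- of_real l, 1 :: 'a :: real_normed_field:])"
  shows "xs = (ys :: real list)"
  using assms
proof (induction xs arbitrary: ys)
  case Nil
  have "ys = []"
  proof (rule ccontr)
    assume "ys \<noteq> []"
    then obtain y ys' where "ys = y # ys'" by (cases ys) auto
    then have "poly (\<Prod>l\<leftarrow>ys. [:- of_real l, 1 :: 'a:]) (of_real y) = 0" by simp
    then show False unfolding Nil.prems(3)[symmetric] by simp
  qed
  then show ?case by simp
next
  case (Cons x xs)
  let ?p = "\<lambda>zs. (\<Prod>l\<leftarrow>zs. [:- of_real l, 1 :: 'a:])"
  have root: "poly (?p zs) (of_real z) = 0 \<longleftrightarrow> z \<in> set zs" for z zs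
    by (induction zs) auto
  have "poly (?p ys) (of_real x) = 0" unfolding Cons.prems(3)[symmetric] by simp
  then have "x \<in> set ys" by (rule root[THEN iffD1])
  then obtain y ys' where ys: "ys = y # ys'" by (cases ys) auto
  have "poly (?p (x # xs)) (of_real y) = 0" unfolding Cons.prems(3) by (simp add: ys)
  then have "y \<in> set (x # xs)" by (rule root[THEN iffD1])
  then have "y \<le> x" using Cons.prems(1) by auto
  moreover have "x \<le> y" using \<open>x \<in> set ys\<close> Cons.prems(2) by (auto simp: ys)
  ultimately have xy: "y = x" by simp
  have "?p xs = ?p ys'"
  proof -
    have "[:- of_real x, 1:] * ?p xs = [:- of_real x, 1:] * ?p ys'"
      using Cons.prems(3) by (simp add: ys xy)
    then show ?thesis by (subst (asm) mult_cancel_left) auto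
  qed
  then show ?case using Cons.IH[of ys'] Cons.prems(1,2) by (simp add: ys xy)
qed

lemma eigval_list_eqI:
  assumes "sorted_wrt (\<ge>) ls" "char_poly A = (\<Prod>l\<leftarrow>ls. [:- of_real l, 1:])"
  shows "eigval_list A = ls"
  unfolding eigval_list_def
proof (rule the_equality, intro conjI assms)
  fix ls' assume *: "sorted_wrt (\<ge>) ls' \<and> char_poly A = (\<Prod>l\<leftarrow>ls'. [:- of_real l, 1:])"
  then have "(\<Prod>l\<leftarrow>ls'. [:- of_real l, 1:]) = (\<Prod>l\<leftarrow>ls. [:- of_real l, 1 :: 'a:])"
    using assms(2) by simp
  with * assms(1) show "ls' = ls" by (intro sorted_linear_factors_unique) auto
qed

section \<open>Spectral theorem over real and complex scalars\<close>

lemma complex_hermitian_eigenvalue_real: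
  fixes A :: "complex mat"
  assumes A: "hermitian_mat n A" and ev: "eigenvalue A a"
  shows "a \<in> \<real>"
proof -
  note A' = hermitian_matD[OF A]
  from ev obtain v where v: "v \<in> carrier_vec n" "v \<noteq> 0\<^sub>v n" "A *\<^sub>v v = a \<cdot>\<^sub>v v"
    using A' by (auto simp: eigenvalue_def eigenvector_def)
  define q where "q = (\<Sum>i<n. (cmod (vec_index v i))\<^sup>2)"
  have "q \<noteq> 0"
  proof
    assume "q = 0"
    then have "vec_index v i = 0" if "i < n" for i using that by (auto simp: q_def sum_nonneg_eq_0_iff)
    then have "v = 0\<^sub>v n" using v(1) by (intro eq_vecI) auto
    with v(2) show False by simp
  qed
  define s where "s = (\<Sum>i<n. cnj (vec_index v i) * vec_index (A *\<^sub>v v) i)"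
  have "vec_index (A *\<^sub>v v) i = a * vec_index v i" if "i < n" for i using v that by simp
  then have "s = (\<Sum>i<n. a * of_real ((cmod (vec_index v i))\<^sup>2))"
    unfolding s_def by (intro sum.cong) (auto simp: complex_norm_square simp del: of_real_power)
  then have s1: "s = a * of_real q" by (simp add: q_def sum_distrib_left)
  have s2: "s = (\<Sum>i<n. \<Sum>j<n. cnj (vec_index v i) * A $$ (i, j) * vec_index v j)"
    unfolding s_def
  proof (rule sum.cong[OF refl])
    fix i assume "i \<in> {..<n}"
    then have "vec_index (A *\<^sub>v v) i = (\<Sum>j<n. A $$ (i, j) * vec_index v j)"
      using A'(1) v(1) by (intro index_mat_vec_sum) auto
    then show "cnj (vec_index v i) * vec_index (A *\<^sub>v v) i = (\<Sum>j<n. cnj (vec_index v i) * A $$ (i, j) * vec_index v j)"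
      by (simp add: sum_distrib_left mult.assoc)
  qed
  have "cnj s = (\<Sum>i<n. \<Sum>j<n. cnj (vec_index v j) * A $$ (j, i) * vec_index v i)"
    unfolding s2 cnj_sum using A'(3) by (intro sum.cong refl) (auto simp: mult_ac)
  also have "\<dots> = s" unfolding s2 by (rule sum.swap)
  finally have "cnj (a * of_real q) = a * of_real q" unfolding s1 .
  then have "cnj a = a" using \<open>q \<noteq> 0\<close> by simp
  then show ?thesis by (simp add: Reals_cnj_iff)
qed

text \<open>Covers both scalar types at once: \<open>e\<close> will be the inclusion of the reals or
  the identity of the complex numbers. Matrices, the group and its Haar measure stay over
  \<open>'a\<close>, where the theorem speaks of them; only entries are mapped into the complex
  numbers, by a homomorphism that preserves norm and conjugation.\<close>

locale scalar_embedding =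
  fixes e :: "'a :: {conjugatable_ordered_field, real_normed_field, second_countable_topology} \<Rightarrow> complex"
  assumes e_add: "e (x + y) = e x + e y"
    and e_mult: "e (x * y) = e x * e y"
    and e_of_real: "e (of_real r) = of_real r"
    and e_norm: "cmod (e x) = norm x"
    and e_conj: "e (conjugate x) = cnj (e x)"
begin

lemma e_0 [simp]: "e 0 = 0" using e_of_real[of 0] by simp
lemma e_1 [simp]: "e 1 = 1" using e_of_real[of 1] by simp

sublocale field_hom e
  by unfold_locales (simp_all add: e_add e_mult)

lemma e_sum: "e (sum f A) = (\<Sum>x\<in>A. e (f x))"
  by (rule hom_sum)

lemma e_inj: "e x = e y \<longleftrightarrow> x = y" by simp

lemma hermitian_map_mat:
  assumes "hermitian_mat n A"
  shows "hermitian_mat n (map_mat e A)"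
  using hermitian_matD[OF assms] unfolding hermitian_mat_def
  by (auto intro!: eq_matI simp: e_conj[symmetric])

text \<open>The characteristic polynomial of the embedded matrix splits over the complex numbers,
  its roots are real because that matrix is Hermitian, and injectivity of \<open>map_poly e\<close>
  pulls the factorisation back to \<open>'a\<close>.\<close>

lemma hermitian_char_poly:
  fixes A :: "'a mat"
  assumes A: "hermitian_mat n A"
  obtains ls where "length ls = n" "sorted_wrt (\<ge>) ls" "eigval_list A = ls"
    "char_poly A = (\<Prod>l\<leftarrow>ls. [:- of_real l, 1:])"
proof -
  note A' = hermitian_matD[OF A]
  let ?B = "map_mat e A"
  have B: "hermitian_mat n ?B" by (rule hermitian_map_mat[OF A])
  then have Bc: "?B \<in> carrier_mat n n" by (rule hermitian_matD)
  from char_poly_factorized[OF Bc] obtain as where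
    as: "char_poly ?B = (\<Prod>a\<leftarrow>as. [:- a, 1:])" "length as = n" by blast
  have "a \<in> \<real>" if "a \<in> set as" for a
  proof -
    have "poly (char_poly ?B) a = 0" unfolding as(1) using that by (induction as) auto
    then have "eigenvalue ?B a" using eigenvalue_root_char_poly[OF Bc] by simp
    then show ?thesis by (rule complex_hermitian_eigenvalue_real[OF B])
  qed
  then have as_re: "as = map (\<lambda>a. of_real (Re a)) as"
    by (intro map_idI[symmetric]) auto
  define ls where "ls = rev (sort (map Re as))"
  have perm: "(\<Prod>l\<leftarrow>ls. f l) = (\<Prod>l\<leftarrow>map Re as. f l)" for f :: "real \<Rightarrow> 'b :: comm_monoid_mult"
    unfolding prod_mset_prod_list[symmetric] by (simp add: ls_def multiset.map_comp)
  have "map_poly e (char_poly A) = char_poly ?B" using char_poly_hom[OF A'(1)] by simp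
  also have "\<dots> = (\<Prod>l\<leftarrow>map Re as. [:- of_real l, 1:])"
    unfolding as(1) by (subst as_re) (simp add: o_def)
  also have "\<dots> = (\<Prod>l\<leftarrow>ls. [:- of_real l, 1:])" unfolding perm ..
  also have "\<dots> = map_poly e (\<Prod>l\<leftarrow>ls. [:- of_real l, 1:])"
  proof -
    interpret mp: map_poly_inj_comm_ring_hom e ..
    have "map_poly e [:- of_real l, 1:] = [:- of_real l, 1:]" for l
      by (simp add: hom_distribs e_of_real)
    then show ?thesis by (simp add: mp.hom_prod_list o_def)
  qed
  finally have cp: "char_poly A = (\<Prod>l\<leftarrow>ls. [:- of_real l, 1:])"
  proof -
    interpret mp: map_poly_inj_comm_ring_hom e ..
    assume "map_poly e (char_poly A) = map_poly e (\<Prod>l\<leftarrow>ls. [:- of_real l, 1:])"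
    then show ?thesis by (simp only: mp.eq_iff)
  qed
  have sorted: "sorted_wrt (\<ge>) ls" unfolding ls_def sorted_wrt_rev by simp
  show ?thesis
    by (rule that[OF _ sorted eigval_list_eqI[OF sorted cp] cp]) (simp add: ls_def as(2))
qed

text \<open>Gram-Schmidt, applied to a basis that starts with \<open>v\<close>, keeps this first
  vector; normalising then changes it only by the scalar \<open>c\<close>.\<close>

lemma ex_unitary_first_column:
  fixes v :: "'a Matrix.vec"
  assumes v: "v \<in> carrier_vec n" "v \<noteq> 0\<^sub>v n"
  obtains W c where "W \<in> unitary_group n" "col W 0 = c \<cdot>\<^sub>v v" "n > 0"
proof -
  interpret cof_vec_space n "TYPE('a)" .
  define bs where "bs = basis_completion v"
  note bc = basis_completion[OF v, folded bs_def]
  have n: "n > 0" using v by (cases n) auto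
  define ws where "ws = gram_schmidt n bs"
  have ws: "set ws \<subseteq> carrier_vec n" "corthogonal ws" "length ws = n"
    using gram_schmidt_result[OF bc(2,4,5) ws_def] bc(6) by auto
  obtain vs where bsv: "bs = v # vs" using bc(6,7) n by (cases bs) auto
  have hd: "ws ! 0 = v"
    using gram_schmidt_hd[OF v(1), of vs, folded bsv ws_def] ws(3) n by (cases ws) auto
  define q where "q = (\<lambda>i. \<Sum>k<n. (norm (vec_index (ws ! i) k))\<^sup>2)"
  have wsc: "ws ! i \<in> carrier_vec n" if "i < n" for i using ws that by auto
  have prod: "ws ! i \<bullet>c ws ! j = (\<Sum>k<n. vec_index (ws ! i) k * conjugate (vec_index (ws ! j) k))"
    if "i < n" "j < n" for i j
    using wsc[OF that(1)] wsc[OF that(2)] by (simp add: scalar_prod_def lessThan_atLeast0)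
  have qq: "ws ! i \<bullet>c ws ! i = of_real (q i)" if "i < n" for i
  proof -
    have "x * conjugate x = of_real ((norm x)\<^sup>2)" for x :: 'a
      unfolding e_inj[symmetric] by (simp add: e_mult e_conj e_of_real complex_norm_square e_norm[symmetric] del: of_real_power)
    then show ?thesis unfolding prod[OF that that] by (simp add: q_def)
  qed
  have qpos: "q i > 0" if "i < n" for i
  proof -
    have "of_real (q i) \<noteq> (0 :: 'a)" unfolding qq[OF that, symmetric] using corthogonalD[OF ws(2)] ws(3) that by blast
    then have "q i \<noteq> 0" by auto
    moreover have "q i \<ge> 0" unfolding q_def by (intro sum_nonneg) auto
    ultimately show ?thesis by simp
  qed
  define c where "c = (\<lambda>i. of_real (1 / sqrt (q i)) :: 'a)"
  have conj_c: "conjugate (c i) = c i" for i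
    unfolding e_inj[symmetric] e_conj c_def e_of_real by simp
  define W where "W = mat n n (\<lambda>(k, i). c i * vec_index (ws ! i) k)"
  have W: "W \<in> carrier_mat n n" by (simp add: W_def)
  have "mat_adjoint W * W = 1\<^sub>m n"
  proof (rule eq_matI)
    fix i j assume "i < dim_row (1\<^sub>m n :: 'a mat)" "j < dim_col (1\<^sub>m n :: 'a mat)"
    then have ij: "i < n" "j < n" by auto
    have "(mat_adjoint W * W) $$ (i, j) = (\<Sum>k<n. mat_adjoint W $$ (i, k) * W $$ (k, j))"
      using W ij by (intro index_mat_mult_sum) auto
    also have "\<dots> = c i * c j * (ws ! j \<bullet>c ws ! i)"
      unfolding prod[OF ij(2,1)] sum_distrib_left
      using ij W by (intro sum.cong refl) (auto simp: W_def conjugate_dist_mul conj_c mult_ac)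
    also have "\<dots> = (if i = j then 1 else 0)"
    proof (cases "i = j")
      case True
      have "1 / sqrt (q j) * (1 / sqrt (q j)) * q j = 1" using qpos[OF ij(2)] by simp
      then have "c j * c j * of_real (q j) = 1" unfolding c_def of_real_mult[symmetric] by simp
      then show ?thesis unfolding True qq[OF ij(2)] by simp
    next
      case False
      then have "ws ! j \<bullet>c ws ! i = 0" using corthogonalD[OF ws(2)] ws(3) ij by metis
      then show ?thesis using False by simp
    qed
    finally show "(mat_adjoint W * W) $$ (i, j) = 1\<^sub>m n $$ (i, j)" using ij by simp
  qed (use W in auto)
  then have "W \<in> unitary_group n" by (rule unitary_groupI[OF W])
  moreover have "col W 0 = c 0 \<cdot>\<^sub>v v"
    using n v(1) by (intro eq_vecI) (auto simp: W_def hd)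
  ultimately show ?thesis using n that by blast
qed

text \<open>Deflation: an eigenvector for the first root becomes the first column of a unitary
  matrix, and the induction hypothesis treats the remaining block. The induction runs over the given
  list of roots, so the diagonal appears in the prescribed order and needs no sorting
  afterwards.\<close>

lemma spectral_theorem_aux:
  fixes A :: "'a mat"
  assumes "hermitian_mat n A" "char_poly A = (\<Prod>a\<leftarrow>es. [:- a, 1:])"
  shows "\<exists>U\<in>unitary_group n. mat_adjoint U * A * U = mat n n (\<lambda>(i, j). if i = j then es ! i else 0)"
  using assms
proof (induction es arbitrary: n A)
  case Nil
  note A = hermitian_matD[OF Nil.prems(1)]
  have "n = 0" using degree_monic_char_poly[OF A(1)] Nil.prems(2) by simp
  then show ?case using A(1) by (intro bexI[of _ "1\<^sub>m 0"]) (auto intro!: eq_matI unitary_groupI)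
next
  case (Cons a es)
  note A = hermitian_matD[OF Cons.prems(1)]
  have "poly (char_poly A) a = 0" unfolding Cons.prems(2) by simp
  then have "eigenvalue A a" using eigenvalue_root_char_poly[OF A(1)] by simp
  then obtain v where v: "v \<in> carrier_vec n" "v \<noteq> 0\<^sub>v n" "A *\<^sub>v v = a \<cdot>\<^sub>v v"
    using A by (auto simp: eigenvalue_def eigenvector_def)
  obtain W c where W: "W \<in> unitary_group n" "col W 0 = c \<cdot>\<^sub>v v" and n: "n > 0"
    using ex_unitary_first_column[OF v(1,2)] .
  note W' = unitary_groupD[OF W(1)]
  define m where "m = n - 1"
  have nm: "n = 1 + m" using n by (simp add: m_def)
  define A' where "A' = mat_adjoint W * A * W"
  have A'h: "hermitian_mat n A'" unfolding A'_def by (rule hermitian_mat_conj[OF Cons.prems(1) W'(1)])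
  note A'D = hermitian_matD[OF A'h]
  have AW: "A * W \<in> carrier_mat n n" using A(1) W'(1) by auto
  have dims: "dim_row W = n" "dim_col W = n" "dim_row (A * W) = n" "dim_col (A * W) = n"
    using W'(1) AW by (simp_all only: carrier_matD)
  have A'alt: "A' = mat_adjoint W * (A * W)"
    unfolding A'_def using A(1) W'(1) by (intro assoc_mult_mat[of _ n n _ n _ n]) auto
  have col0: "A' $$ (i, 0) = (if i = 0 then a else 0)" if "i < n" for i
  proof -
    have W0: "W $$ (k, 0) = c * vec_index v k" if "k < n" for k
      using arg_cong[OF W(2), of "\<lambda>u. vec_index u k"] W'(1) v(1) that n by simp
    have AW0: "(A * W) $$ (k, 0) = a * W $$ (k, 0)" if k: "k < n" for k
    proof -
      have "(A * W) $$ (k, 0) = (\<Sum>l<n. A $$ (k, l) * W $$ (l, 0))"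
        using A(1) W'(1) k n by (intro index_mat_mult_sum) auto
      also have "\<dots> = c * (\<Sum>l<n. A $$ (k, l) * vec_index v l)"
        unfolding sum_distrib_left by (intro sum.cong refl) (simp add: W0 mult_ac)
      also have "(\<Sum>l<n. A $$ (k, l) * vec_index v l) = vec_index (A *\<^sub>v v) k"
        using A(1) v(1) k by (intro index_mat_vec_sum[symmetric]) auto
      also have "\<dots> = a * vec_index v k" using v(1,3) k by simp
      finally show ?thesis using W0[OF k] by (simp add: mult_ac)
    qed
    have "A' $$ (i, 0) = (\<Sum>k<n. mat_adjoint W $$ (i, k) * (A * W) $$ (k, 0))"
      unfolding A'alt by (rule index_mat_mult_sum) (simp_all only: dims mat_adjoint_dim that n)
    also have "\<dots> = a * (\<Sum>k<n. mat_adjoint W $$ (i, k) * W $$ (k, 0))"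
      unfolding sum_distrib_left by (intro sum.cong refl) (simp add: AW0 mult_ac)
    also have "(\<Sum>k<n. mat_adjoint W $$ (i, k) * W $$ (k, 0)) = (mat_adjoint W * W) $$ (i, 0)"
      by (rule index_mat_mult_sum[symmetric]) (simp_all only: dims mat_adjoint_dim that n)
    finally show ?thesis unfolding W'(2) using that n by simp
  qed
  define A3 where "A3 = mat m m (\<lambda>(i, j). A' $$ (Suc i, Suc j))"
  have A3h: "hermitian_mat m A3"
    unfolding hermitian_mat_def using A'D(3) nm by (auto simp: A3_def intro!: eq_matI)
  note A3 = hermitian_matD[OF A3h]
  define A1 where "A1 = mat 1 1 (\<lambda>_. a)"
  have blk: "A' = four_block_mat A1 (0\<^sub>m 1 m) (0\<^sub>m m 1) A3"
  proof (rule eq_matI)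
    fix i j assume "i < dim_row (four_block_mat A1 (0\<^sub>m 1 m) (0\<^sub>m m 1) A3)" "j < dim_col (four_block_mat A1 (0\<^sub>m 1 m) (0\<^sub>m m 1) A3)"
    then have ij: "i < n" "j < n" by (auto simp: A1_def A3_def nm)
    \<comment> \<open>The eigenvector equation produces zeros in the first column; Hermitian
      symmetry carries them to the first row.\<close>
    have "A' $$ (0, j) = conjugate (A' $$ (j, 0))" using A'D(3)[of 0 j] ij n by simp
    then have "A' $$ (0, j) = 0" if "j \<noteq> 0" using col0[OF ij(2)] that by simp
    then show "A' $$ (i, j) = four_block_mat A1 (0\<^sub>m 1 m) (0\<^sub>m m 1) A3 $$ (i, j)"
      using ij col0[OF ij(1)] by (cases i; cases j) (auto simp: A1_def A3_def nm)
  qed (use A'D(1) in \<open>auto simp: A1_def A3_def nm\<close>)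
  have "similar_mat_wit A' A (mat_adjoint W) W"
    using W'(1) A(1) A'D(1) by (intro similar_mat_witI[of _ _ n] W'(2,3)) (auto simp: A'_def)
  then have "char_poly A' = char_poly A" by (intro char_poly_similar) (auto simp: similar_mat_def)
  moreover have "char_poly A' = char_poly A1 * char_poly A3"
    unfolding blk by (intro char_poly_four_block_zeros_col) (auto simp: A1_def A3_def)
  moreover have "char_poly A1 = [:- a, 1:]" by (simp add: A1_def char_poly_defs det_def sign_def)
  \<comment> \<open>Similarity and the block form split off one linear factor; cancelling it shows
    that \<open>es\<close> are exactly the roots of the smaller block.\<close>
  ultimately have "[:- a, 1:] * char_poly A3 = [:- a, 1:] * (\<Prod>a\<leftarrow>es. [:- a, 1:])"
    unfolding Cons.prems(2) by simp
  then have "char_poly A3 = (\<Prod>a\<leftarrow>es. [:- a, 1:])" by (subst (asm) mult_cancel_left) auto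
  from Cons.IH[OF A3h this] obtain U3 where U3: "U3 \<in> unitary_group m"
    "mat_adjoint U3 * A3 * U3 = mat m m (\<lambda>(i, j). if i = j then es ! i else 0)" by blast
  note U3' = unitary_groupD[OF U3(1)]
  define Q where "Q = four_block_mat (1\<^sub>m 1) (0\<^sub>m 1 m) (0\<^sub>m m 1) U3"
  have Qc: "Q \<in> carrier_mat n n"
    unfolding Q_def nm by (rule four_block_carrier_mat) (use U3'(1) in auto)
  have Qa: "mat_adjoint Q = four_block_mat (1\<^sub>m 1) (0\<^sub>m 1 m) (0\<^sub>m m 1) (mat_adjoint U3)"
  proof (rule eq_matI)
    have conj1: "conjugate (1 :: 'a) = 1" unfolding e_inj[symmetric] e_conj by simp
    fix i j assume "i < dim_row (four_block_mat (1\<^sub>m 1) (0\<^sub>m 1 m) (0\<^sub>m m 1) (mat_adjoint U3))"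
      "j < dim_col (four_block_mat (1\<^sub>m 1) (0\<^sub>m 1 m) (0\<^sub>m m 1) (mat_adjoint U3))"
    then have ij: "i < n" "j < n" using U3'(1) by (auto simp: nm)
    then show "mat_adjoint Q $$ (i, j) = four_block_mat (1\<^sub>m 1) (0\<^sub>m 1 m) (0\<^sub>m m 1) (mat_adjoint U3) $$ (i, j)"
      using Qc U3'(1) conj1 by (cases i; cases j) (auto simp: Q_def nm)
  qed (use Qc U3'(1) in \<open>auto simp: nm\<close>)
  have "mat_adjoint Q * Q = four_block_mat (1\<^sub>m 1) (0\<^sub>m 1 m) (0\<^sub>m m 1) (1\<^sub>m m)"
    unfolding Qa unfolding Q_def using U3'(1,2)
    by (subst mult_four_block_mat[of _ 1 1 _ m _ m _ _ 1 _ m]) auto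
  then have Q: "Q \<in> unitary_group n" using Qc by (intro unitary_groupI) (auto simp: nm)
  have "mat_adjoint Q * A' * Q = four_block_mat A1 (0\<^sub>m 1 m) (0\<^sub>m m 1) (mat_adjoint U3 * A3 * U3)"
  proof -
    have A1c: "A1 \<in> carrier_mat 1 1" by (simp add: A1_def)
    have "mat_adjoint Q * A' = four_block_mat A1 (0\<^sub>m 1 m) (0\<^sub>m m 1) (mat_adjoint U3 * A3)"
      unfolding Qa blk using U3'(1) A3(1) A1c
      by (subst mult_four_block_mat[of _ 1 1 _ m _ m _ _ 1 _ m]) auto
    then show ?thesis unfolding Q_def using U3'(1) A3(1) A1c
      by (simp, subst mult_four_block_mat[of _ 1 1 _ m _ m _ _ 1 _ m]) auto
  qed
  also have "\<dots> = mat n n (\<lambda>(i, j). if i = j then (a # es) ! i else 0)"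
    unfolding U3(2)
  proof (rule eq_matI)
    fix i j assume "i < dim_row (mat n n (\<lambda>(i, j). if i = j then (a # es) ! i else 0))"
      "j < dim_col (mat n n (\<lambda>(i, j). if i = j then (a # es) ! i else 0))"
    then have "i < n" "j < n" by auto
    then show "four_block_mat A1 (0\<^sub>m 1 m) (0\<^sub>m m 1) (mat m m (\<lambda>(i, j). if i = j then es ! i else 0)) $$ (i, j) =
        mat n n (\<lambda>(i, j). if i = j then (a # es) ! i else 0) $$ (i, j)"
      by (cases i; cases j) (auto simp: A1_def nm)
  qed (auto simp: A1_def nm)
  also have "mat_adjoint Q * A' * Q = mat_adjoint (W * Q) * A * (W * Q)"
    unfolding A'_def mat_adjoint_mult[OF W'(1) Qc] using Qc W'(1) A(1)
    by (simp add: assoc_mult_mat[of _ n n _ n _ n])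
  finally show ?case using unitary_group_mult[OF W(1) Q] by blast
qed

lemma spectral_theorem:
  fixes A :: "'a mat"
  assumes A: "hermitian_mat n A"
  obtains S where "S \<in> unitary_group n"
    and "A = S * mat_diag n (\<lambda>k. of_real (eigval_list A ! k)) * mat_adjoint S"
proof -
  obtain ls where ls: "length ls = n" "eigval_list A = ls" "char_poly A = (\<Prod>l\<leftarrow>ls. [:- of_real l, 1:])"
    using hermitian_char_poly[OF A] by metis
  have "char_poly A = (\<Prod>a\<leftarrow>map of_real ls. [:- a, 1:])" using ls(3) by (simp add: o_def)
  from spectral_theorem_aux[OF A this] obtain S where
    S: "S \<in> unitary_group n" "mat_adjoint S * A * S = mat n n (\<lambda>(i, j). if i = j then map of_real ls ! i else 0)"
    by blast
  note S' = unitary_groupD[OF S(1)]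
  have Ac: "A \<in> carrier_mat n n" by (rule hermitian_matD[OF A])
  have "mat n n (\<lambda>(i, j). if i = j then map of_real ls ! i else 0) =
      (mat_diag n (\<lambda>k. of_real (eigval_list A ! k)) :: 'a mat)"
    using ls by (intro eq_matI) (auto simp: mat_diag_def)
  then have "S * mat_diag n (\<lambda>k. of_real (eigval_list A ! k)) * mat_adjoint S =
      S * (mat_adjoint S * A * S) * mat_adjoint S" using S(2) by simp
  also have "\<dots> = (S * mat_adjoint S) * A * (S * mat_adjoint S)"
    using S'(1) Ac by (simp add: assoc_mult_mat[of _ n n _ n _ n])
  also have "\<dots> = A" unfolding S'(3) using Ac by simp
  finally show ?thesis using S(1) that by metis
qed

end

section \<open>Rank and trace of diagonalised matrices\<close>

lemma mat_diag_carrier [simp]: "mat_diag n f \<in> carrier_mat n n"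
  by (simp add: mat_diag_def)

lemma vec_space_rank_eq_if_col_space_eq:
  fixes A B :: "'a :: field mat"
  assumes "A \<in> carrier_mat n m" "B \<in> carrier_mat n p"
    and "{A *\<^sub>v x |x. x \<in> carrier_vec m} = {B *\<^sub>v x |x. x \<in> carrier_vec p}"
  shows "vec_space.rank n A = vec_space.rank n B"
proof -
  interpret vec_space "TYPE('a)" n .
  have cs: "col_space C = {C *\<^sub>v x |x. x \<in> carrier_vec q}" if "C \<in> carrier_mat n q" for C q
    unfolding col_space_eq[OF that] using that by auto
  have "col_space A = col_space B"
    unfolding cs[OF assms(1)] cs[OF assms(2)] by (rule assms(3))
  then show ?thesis unfolding rank_def col_space_def by simp
qed

text \<open>The nonzero columns form a maximal independent set of columns: they are columns of the
  invertible matrix \<open>G\<close>, and an independent set cannot contain the zero vector.\<close>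

lemma rank_diag_columns:
  fixes S :: "'a :: field mat"
  assumes S: "S \<in> carrier_mat n n" "T \<in> carrier_mat n n" "T * S = 1\<^sub>m n"
  shows "vec_space.rank n (S * mat_diag n f) = card {k. k < n \<and> f k \<noteq> 0}"
proof -
  interpret vec_space "TYPE('a)" n .
  \<comment> \<open>Replacing zeros by 1 makes the diagonal invertible and keeps the columns with
    nonzero scaling.\<close>
  define g where "g = (\<lambda>k. if f k = 0 then 1 else f k)"
  define A where "A = S * mat_diag n f"
  define G where "G = S * mat_diag n g"
  have A: "A \<in> carrier_mat n n" and G: "G \<in> carrier_mat n n" using S(1) by (auto simp: A_def G_def)
  have "mat_diag n (\<lambda>k. inverse (g k)) * T * G = mat_diag n (\<lambda>k. inverse (g k)) * (T * S) * mat_diag n g"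
    unfolding G_def using S(1,2) by (simp add: assoc_mult_mat[of _ n n _ n _ n])
  also have "\<dots> = mat_diag n (\<lambda>k. inverse (g k) * g k)"
    unfolding S(3) right_mult_one_mat[OF mat_diag_carrier] by simp
  also have "\<dots> = 1\<^sub>m n" by (intro eq_matI) (auto simp: mat_diag_def g_def)
  finally have inv: "mat_diag n (\<lambda>k. inverse (g k)) * T * G = 1\<^sub>m n" .
  have "Determinant.det (mat_diag n (\<lambda>k. inverse (g k)) * T) * Determinant.det G = 1"
    using Determinant.det_mult[OF mult_carrier_mat[OF mat_diag_carrier[of n "\<lambda>k. inverse (g k)"] S(2)] G] unfolding inv by simp
  then have "Determinant.det G \<noteq> 0" by auto
  then have rG: "rank G = n" using low_rank_det_zero[OF G] by simp
  have dist: "distinct (cols G)" using non_distinct_low_rank[OF G] rG by fastforce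
  have li: "lin_indpt (set (cols G))" by (rule full_rank_lin_indpt[OF G rG dist])
  have colA: "col A k = f k \<cdot>\<^sub>v col S k" and colG: "col G k = g k \<cdot>\<^sub>v col S k" if "k < n" for k
    unfolding A_def G_def using S(1) that by (auto simp: mat_diag_mult_right mult.commute)
  define K where "K = {k. k < n \<and> f k \<noteq> 0}"
  have AG: "col A k = col G k" if "k \<in> K" for k using that colA colG by (auto simp: K_def g_def)
  define U where "U = col G ` K"
  have UG: "U \<subseteq> set (cols G)" using G by (auto simp: U_def K_def cols_def)
  have liU: "lin_indpt U"
    by (rule subset_li_is_li[OF li UG])
  have UA: "U \<subseteq> set (cols A)"
  proof
    fix u assume "u \<in> U"
    then obtain k where k: "k \<in> K" "u = col A k" using AG by (auto simp: U_def)
    then show "u \<in> set (cols A)" using A by (auto simp: K_def cols_def)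
  qed
  have "maximal U (\<lambda>T. T \<subseteq> set (cols A) \<and> lin_indpt T)"
    unfolding maximal_def
  proof (intro conjI allI impI UA liU)
    fix B assume B: "U \<subseteq> B \<and> B \<subseteq> set (cols A) \<and> lin_indpt B"
    have "B \<subseteq> U"
    proof
      fix b assume b: "b \<in> B"
      then obtain k where k: "k < n" "b = col A k" using B A by (auto simp: cols_def)
      have "f k \<noteq> 0"
      proof
        assume "f k = 0"
        then have "b = 0\<^sub>v n" using k colA S(1) by (auto intro!: eq_vecI)
        moreover have "0\<^sub>v n \<notin> B"
        proof -
          have Bc: "B \<subseteq> carrier_vec n" using B cols_dim[of A] A by (simp only: carrier_matD) blast
          have "lin_indpt B" using B by blast
          moreover have "(UNIV :: 'a set) \<noteq> {0}" by (metis UNIV_I singletonD one_neq_zero)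
          ultimately show ?thesis using zero_nin_lin_indpt[of B] Bc by simp
        qed
        ultimately show False using b by simp
      qed
      then show "b \<in> U" using k AG[of k] by (auto simp: U_def K_def)
    qed
    then show "B = U" using B by blast
  qed
  from rank_card_indpt[OF A this] have "rank A = card U" .
  also have "card U = card K"
    unfolding U_def
  proof (rule card_image, rule inj_onI)
    fix k l assume kl: "k \<in> K" "l \<in> K" "col G k = col G l"
    then have "cols G ! k = cols G ! l" using G by (simp add: K_def)
    moreover have "k < length (cols G)" "l < length (cols G)" using kl(1,2) G by (simp_all add: K_def)
    ultimately show "k = l" using nth_eq_iff_index_eq[OF dist] by blast
  qed
  finally show ?thesis unfolding A_def K_def .
qed

text \<open>An invertible right factor does not change the column space.\<close>

lemma rank_diagonalised:
  fixes S :: "'a :: field mat"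
  assumes S: "S \<in> carrier_mat n n" "T \<in> carrier_mat n n" "T * S = 1\<^sub>m n"
  shows "vec_space.rank n (S * mat_diag n f * T) = card {k. k < n \<and> f k \<noteq> 0}"
proof -
  have "vec_space.rank n (S * mat_diag n f * T) = vec_space.rank n (S * mat_diag n f)"
  proof (rule vec_space_rank_eq_if_col_space_eq)
    show "S * mat_diag n f * T \<in> carrier_mat n n" "S * mat_diag n f \<in> carrier_mat n n" using S(1,2) by auto
    have TS: "(S * mat_diag n f * T) *\<^sub>v x = (S * mat_diag n f) *\<^sub>v (T *\<^sub>v x)" if "x \<in> carrier_vec n" for x
      using S(1,2) that by (intro assoc_mult_mat_vec[of _ n n _ n]) auto
    moreover have "(S * mat_diag n f) *\<^sub>v y = (S * mat_diag n f * T) *\<^sub>v (S *\<^sub>v y)" if y: "y \<in> carrier_vec n" for y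
    proof -
      have "T *\<^sub>v (S *\<^sub>v y) = y" using assoc_mult_mat_vec[OF S(2,1) y] S(3) y by simp
      then show ?thesis using TS[of "S *\<^sub>v y"] S(1) y by simp
    qed
    moreover have "T *\<^sub>v x \<in> carrier_vec n" "S *\<^sub>v x \<in> carrier_vec n" if "x \<in> carrier_vec n" for x
      using mult_mat_vec_carrier[OF S(2) that] mult_mat_vec_carrier[OF S(1) that] .
    ultimately show "{(S * mat_diag n f * T) *\<^sub>v x |x. x \<in> carrier_vec n} = {(S * mat_diag n f) *\<^sub>v x |x. x \<in> carrier_vec n}"
      by blast
  qed
  then show ?thesis by (simp add: rank_diag_columns[OF S])
qed

lemma conj_mat_mult:
  fixes Y Z :: "'a :: comm_ring_1 mat"
  assumes Y: "Y \<in> carrier_mat n m" and Z: "Z \<in> carrier_mat m n" and ZY: "Z * Y = 1\<^sub>m m"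
    and L: "L \<in> carrier_mat m m" "L' \<in> carrier_mat m m"
  shows "(Y * L * Z) * (Y * L' * Z) = Y * (L * L') * Z"
proof -
  have c: "Y * L \<in> carrier_mat n m" "L' * Z \<in> carrier_mat m n" "Y * L' * Z \<in> carrier_mat n n"
    using Y Z L by auto
  have "Z * (Y * L' * Z) = (Z * Y) * (L' * Z)"
    unfolding assoc_mult_mat[OF Y L(2) Z] by (rule assoc_mult_mat[OF Z Y c(2), symmetric])
  then have ZYL: "Z * (Y * L' * Z) = L' * Z" unfolding ZY left_mult_one_mat[OF c(2)] .
  have "(Y * L * Z) * (Y * L' * Z) = (Y * L) * (L' * Z)"
    unfolding assoc_mult_mat[OF c(1) Z c(3)] ZYL ..
  also have "\<dots> = Y * L * L' * Z" by (rule assoc_mult_mat[OF c(1) L(2) Z, symmetric])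
  also have "Y * L * L' = Y * (L * L')" by (rule assoc_mult_mat[OF Y L])
  finally show ?thesis .
qed

text \<open>Cyclicity of the trace. The factors may be rectangular, so it serves the frame
  \<open>V\<close> as well as a full eigenbasis.\<close>

lemma trace_conj_diag:
  fixes Y Z :: "'a :: comm_ring_1 mat"
  assumes "Y \<in> carrier_mat n m" "Z \<in> carrier_mat m n" "Z * Y = 1\<^sub>m m"
  shows "(\<Sum>i<n. (Y * mat_diag m f * Z) $$ (i, i)) = (\<Sum>j<m. f j)"
proof -
  have "(\<Sum>i<n. (Y * mat_diag m f * Z) $$ (i, i)) = (\<Sum>i<n. \<Sum>j<m. Y $$ (i, j) * f j * Z $$ (j, i))"
  proof (rule sum.cong[OF refl])
    fix i assume "i \<in> {..<n}"
    then show "(Y * mat_diag m f * Z) $$ (i, i) = (\<Sum>j<m. Y $$ (i, j) * f j * Z $$ (j, i))"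
      using assms(1,2) by (subst index_mat_mult_sum[of _ _ _ _ m]) (auto simp: mat_diag_mult_right)
  qed
  also have "\<dots> = (\<Sum>j<m. f j * (\<Sum>i<n. Z $$ (j, i) * Y $$ (i, j)))"
    by (subst sum.swap) (simp add: sum_distrib_left mult_ac)
  also have "\<dots> = (\<Sum>j<m. f j)"
  proof (rule sum.cong[OF refl])
    fix j assume j: "j \<in> {..<m}"
    have "(\<Sum>i<n. Z $$ (j, i) * Y $$ (i, j)) = (Z * Y) $$ (j, j)"
      using assms(1,2) j by (subst index_mat_mult_sum[of _ _ _ _ n]) auto
    then show "f j * (\<Sum>i<n. Z $$ (j, i) * Y $$ (i, j)) = f j" using assms(3) j by simp
  qed
  finally show ?thesis .
qed

context scalar_embedding
begin

lemma mat_adjoint_diag: "mat_adjoint (mat_diag n (\<lambda>k. of_real (f k) :: 'a)) = mat_diag n (\<lambda>k. of_real (f k))"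
proof -
  have c: "conjugate (of_real r :: 'a) = of_real r" for r
    unfolding e_inj[symmetric] e_conj e_of_real by simp
  have c0: "conjugate (0 :: 'a) = 0" using c[of 0] by simp
  show ?thesis by (rule eq_matI) (auto simp: mat_diag_def c c0)
qed

text \<open>For a Hermitian matrix the trace of the square is the squared Frobenius norm.\<close>

lemma hermitian_square_trace_zero:
  fixes R :: "'a mat"
  assumes R: "hermitian_mat n R" and tr: "(\<Sum>i<n. (R * R) $$ (i, i)) = 0"
  shows "R = 0\<^sub>m n n"
proof -
  note R' = hermitian_matD[OF R]
  have "of_real (\<Sum>i<n. \<Sum>j<n. (norm (R $$ (i, j)))\<^sup>2) = e (\<Sum>i<n. (R * R) $$ (i, i))"
    unfolding e_sum of_real_sum
  proof (rule sum.cong[OF refl])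
    fix i assume i: "i \<in> {..<n}"
    have "e ((R * R) $$ (i, i)) = (\<Sum>j<n. e (R $$ (i, j)) * e (R $$ (j, i)))"
      using R'(1) i by (subst index_mat_mult_sum[of _ _ _ _ n]) (auto simp: e_sum e_mult)
    also have "\<dots> = (\<Sum>j<n. of_real ((norm (R $$ (i, j)))\<^sup>2))"
    proof (rule sum.cong[OF refl])
      fix j assume j: "j \<in> {..<n}"
      have "e (R $$ (j, i)) = cnj (e (R $$ (i, j)))"
        using R'(3)[of j i] i j by (simp flip: e_conj)
      then show "e (R $$ (i, j)) * e (R $$ (j, i)) = of_real ((norm (R $$ (i, j)))\<^sup>2)"
        by (simp only: e_norm[symmetric] complex_norm_square)
    qed
    finally show "(\<Sum>j<n. of_real ((norm (R $$ (i, j)))\<^sup>2)) = e ((R * R) $$ (i, i))" ..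
  qed
  also have "\<dots> = 0" unfolding tr by simp
  finally have "(\<Sum>i<n. \<Sum>j<n. (norm (R $$ (i, j)))\<^sup>2) = 0" by (simp only: of_real_eq_0_iff)
  then have "\<forall>i<n. \<forall>j<n. R $$ (i, j) = 0"
    by (simp add: sum_nonneg_eq_0_iff sum_nonneg)
  then show ?thesis using R'(1) by (intro eq_matI) auto
qed

text \<open>Links the rank, through which the theorem introduces \<open>M\<close>, with the list
  from which the \<open>\<theta>\<^sub>j\<close> are taken.\<close>

lemma length_nonzero_eigvals:
  fixes P :: "'a mat"
  assumes P: "hermitian_mat n P"
  shows "length (filter (\<lambda>l. l \<noteq> 0) (eigval_list P)) = vec_space.rank n P"
proof -
  obtain S where S: "S \<in> unitary_group n" "P = S * mat_diag n (\<lambda>k. of_real (eigval_list P ! k)) * mat_adjoint S"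
    using spectral_theorem[OF P] .
  note S' = unitary_groupD[OF S(1)]
  obtain ls where "length ls = n" "eigval_list P = ls" using hermitian_char_poly[OF P] by metis
  then have len: "length (eigval_list P) = n" by simp
  have "vec_space.rank n P = card {k. k < n \<and> of_real (eigval_list P ! k) \<noteq> (0 :: 'a)}"
    by (subst S(2), rule rank_diagonalised) (use S' in auto)
  then show ?thesis by (simp add: length_filter_conv_card len)
qed

text \<open>A trace argument that avoids extending \<open>V\<close> to a full eigenbasis. For
  \<open>K = V * D * mat_adjoint V\<close> the products \<open>P * K\<close>, \<open>K * P\<close>
  and \<open>K * K\<close> coincide, so \<open>(P - K) * (P - K) = P * P - Z\<close>. Both terms
  have as trace the sum of the squared nonzero eigenvalues, because zero eigenvalues contribute
  nothing; hence \<open>P - K\<close> vanishes.\<close>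

lemma nonzero_eigenbasis_decomposition:
  fixes P V :: "'a mat"
  assumes P: "hermitian_mat n P" and rank: "vec_space.rank n P = m" and V: "nonzero_eigenbasis n P m V"
  shows "P = V * nonzero_eigval_diag P m * mat_adjoint V"
proof -
  define D where "D = nonzero_eigval_diag P m"
  define t where "t = (\<lambda>j. nonzero_eigval P (j + 1))"
  have D: "D = mat_diag m (\<lambda>j. of_real (t j))" by (simp add: D_def nonzero_eigval_diag_def t_def)
  note P' = hermitian_matD[OF P]
  have Vc: "V \<in> carrier_mat n m" and VV: "mat_adjoint V * V = 1\<^sub>m m"
    and ev: "\<And>j. j < m \<Longrightarrow> eigenvector P (col V j) (of_real (t j))"
  proof -
    show "V \<in> carrier_mat n m" "mat_adjoint V * V = 1\<^sub>m m" using V by (auto simp: nonzero_eigenbasis_def)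
    show "eigenvector P (col V j) (of_real (t j))" if "j < m" for j
    proof -
      have "j + 1 \<in> {1..m}" using that by simp
      with V have "eigenvector P (col V (j + 1 - 1)) (of_real (nonzero_eigval P (j + 1)))"
        unfolding nonzero_eigenbasis_def by blast
      then show ?thesis by (simp add: t_def)
    qed
  qed
  have Dc: "D \<in> carrier_mat m m" unfolding D by simp
  have DD: "D * D = mat_diag m (\<lambda>j. of_real ((t j)\<^sup>2))" unfolding D by (simp add: power2_eq_square)
  have Da: "mat_adjoint D = D" unfolding D by (rule mat_adjoint_diag)
  define K where "K = V * D * mat_adjoint V"
  have Kc: "K \<in> carrier_mat n n" using Vc Dc by (simp add: K_def)
  have Kh: "hermitian_mat n K"
    using hermitian_mat_conj[of m D "mat_adjoint V" n] Dc Da Vc by (simp add: hermitian_mat_def K_def)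
  have PV: "P * V = V * D"
  proof (rule eq_matI)
    fix i j assume "i < dim_row (V * D)" "j < dim_col (V * D)"
    then have ij: "i < n" "j < m" using Vc Dc by auto
    have "(P * V) $$ (i, j) = vec_index (P *\<^sub>v col V j) i" using P'(1) Vc ij by simp
    also have "\<dots> = of_real (t j) * V $$ (i, j)" using ev[OF ij(2)] Vc ij by (simp add: eigenvector_def)
    also have "\<dots> = (V * D) $$ (i, j)" unfolding D mat_diag_mult_right[OF Vc] using ij by simp
    finally show "(P * V) $$ (i, j) = (V * D) $$ (i, j)" .
  qed (use P'(1) Vc Dc in auto)
  define Z where "Z = V * (D * D) * mat_adjoint V"
  have PK: "P * K = Z"
  proof -
    have "P * K = (P * V) * D * mat_adjoint V" unfolding K_def using P'(1) Vc Dc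
      by (simp add: assoc_mult_mat[of _ n n _ m _ m] assoc_mult_mat[of _ n n _ m _ n])
    also have "\<dots> = Z" unfolding PV Z_def using Vc Dc by (simp add: assoc_mult_mat[of _ n m _ m _ m])
    finally show ?thesis .
  qed
  have Zh: "mat_adjoint Z = Z"
  proof -
    have "hermitian_mat m (D * D)" using mat_adjoint_mult[OF Dc Dc] Dc Da by (simp add: hermitian_mat_def)
    from hermitian_matD(2)[OF hermitian_mat_conj[OF this, of "mat_adjoint V" n]] Vc show ?thesis by (simp add: Z_def)
  qed
  have KP: "K * P = Z"
    using mat_adjoint_mult[OF P'(1) Kc] unfolding PK Zh P'(2) hermitian_matD(2)[OF Kh] by simp
  have KK: "K * K = Z"
    unfolding K_def Z_def using Vc Dc VV by (intro conj_mat_mult) auto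
  have Rh: "hermitian_mat n (P - K)"
    using mat_adjoint_minus[OF P'(1) Kc] P' Kc hermitian_matD(2)[OF Kh] minus_carrier_mat[OF Kc, of P]
    by (simp add: hermitian_mat_def)
  have Zc: "Z \<in> carrier_mat n n" using PK P'(1) Kc by auto
  have PPc: "P * P \<in> carrier_mat n n" using P'(1) by auto
  have "(P - K) * (P - K) = P * P - Z - (Z - Z)"
    unfolding minus_mult_distrib_mat[OF P'(1) Kc minus_carrier_mat[OF Kc]]
      mult_minus_distrib_mat[OF P'(1) P'(1) Kc] mult_minus_distrib_mat[OF Kc P'(1) Kc] PK KP KK ..
  also have "\<dots> = P * P - Z" using PPc Zc by (intro eq_matI) auto
  finally have RR: "(P - K) * (P - K) = P * P - Z" .
  have trZ: "(\<Sum>i<n. Z $$ (i, i)) = of_real (\<Sum>j<m. (t j)\<^sup>2)"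
    unfolding Z_def DD using trace_conj_diag[OF Vc _ VV] Vc by simp
  obtain S where S: "S \<in> unitary_group n" "P = S * mat_diag n (\<lambda>k. of_real (eigval_list P ! k)) * mat_adjoint S"
    using spectral_theorem[OF P] .
  note S' = unitary_groupD[OF S(1)]
  have "P * P = S * mat_diag n (\<lambda>k. of_real ((eigval_list P ! k)\<^sup>2)) * mat_adjoint S"
  proof -
    let ?L = "mat_diag n (\<lambda>k. of_real (eigval_list P ! k)) :: 'a mat"
    have "(S * ?L * mat_adjoint S) * (S * ?L * mat_adjoint S) = S * (?L * ?L) * mat_adjoint S"
      using S'(1,2) by (intro conj_mat_mult) auto
    then show ?thesis unfolding S(2)[symmetric] by (simp add: power2_eq_square)
  qed
  then have "(\<Sum>i<n. (P * P) $$ (i, i)) = of_real (\<Sum>k<n. (eigval_list P ! k)\<^sup>2)"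
    using trace_conj_diag[OF S'(1) _ S'(2)] S'(1) by simp
  also have "(\<Sum>k<n. (eigval_list P ! k)\<^sup>2) = (\<Sum>j<m. (t j)\<^sup>2)"
  proof -
    obtain ls where ls: "length ls = n" "eigval_list P = ls" using hermitian_char_poly[OF P] by metis
    have len: "length (filter (\<lambda>l. l \<noteq> 0) ls) = m" using length_nonzero_eigvals[OF P] rank ls(2) by simp
    have "(\<Sum>k<n. (eigval_list P ! k)\<^sup>2) = (\<Sum>l\<leftarrow>ls. l\<^sup>2)"
      unfolding ls(2) ls(1)[symmetric] by (simp add: sum_list_sum_nth lessThan_atLeast0)
    also have "\<dots> = (\<Sum>l\<leftarrow>filter (\<lambda>l. l \<noteq> 0) ls. l\<^sup>2)" by (induction ls) auto
    also have "\<dots> = (\<Sum>j<m. (t j)\<^sup>2)"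
      unfolding t_def nonzero_eigval_def ls(2) len[symmetric] by (simp add: sum_list_sum_nth lessThan_atLeast0)
    finally show ?thesis .
  qed
  finally have "(\<Sum>i<n. ((P - K) * (P - K)) $$ (i, i)) = 0"
    unfolding RR using trZ PPc Zc by (simp add: sum_subtractf)
  from hermitian_square_trace_zero[OF Rh this] have "P - K = 0\<^sub>m n n" .
  then have "P = K" using P'(1) Kc by (intro eq_matI) (auto dest!: arg_cong[where f = "\<lambda>A. A $$ _"] simp: mat_eq_iff)
  then show ?thesis by (simp add: K_def D_def)
qed

end

section \<open>Bounds for an outlier of the spiked model\<close>

lemma diag_form_mult: "diag_form n (\<lambda>k. a * c k) u = a * diag_form n c u"
  by (simp add: diag_form_def sum_distrib_left mult.assoc)

text \<open>In both constants the last summand serves for \<open>12 B\<^sup>2 \<epsilon> > \<delta>\<close>, when localising the outlier is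
  pointless but both errors are bounded.\<close>

definition vector_const :: "real \<Rightarrow> real \<Rightarrow> real" where
  "vector_const \<delta> B = B\<^sup>2 * (1 + 6 * B\<^sup>2 / \<delta>\<^sup>2) + 24 * B^3 / \<delta>"

definition norm_const :: "real \<Rightarrow> real \<Rightarrow> real" where
  "norm_const \<delta> B = 9 * B\<^sup>2 / (4 * \<delta>\<^sup>2) *
     (B\<^sup>2 * (1 + 9 * B\<^sup>2 / \<delta>^3) + B^3 / (2 * \<delta>\<^sup>2) * (1 + 6 * B\<^sup>2 / \<delta>\<^sup>2)) +
     12 * B\<^sup>2 / \<delta> * (1 + 9 * B\<^sup>2 / (4 * \<delta>\<^sup>2))"

context spiked_model
begin

text \<open>The locale fixes no order of \<open>h\<close>, \<open>\<theta>\<close> and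
  \<open>\<mu>\<close>, so it survives a change of sign. With \<open>a = - 1\<close> an outlier
  below the spectrum becomes one above it.\<close>

lemma scale: "spiked_model N M (\<lambda>k. a * h k) (\<lambda>j. a * \<theta> j) (\<lambda>k. a * \<mu> k) X S"
  by unfold_locales (simp_all add: adj_app S_iso S_diag diag_form_mult distrib_left)

text \<open>The equation \<open>mean\<close> for \<open>z\<close> provides the a priori bounds:
  \<open>t\<close> is at least \<open>2 * \<delta>\<close>, all \<open>z - h k\<close> are at most
  \<open>3 * B\<close>, and \<open>m2\<close> lies between \<open>(1 / (3 * B))\<^sup>2\<close> and
  \<open>(1 / (2 * \<delta>))\<^sup>2\<close>. They make the constants depend on
  \<open>\<delta>\<close> and \<open>B\<close> alone.\<close>

lemma outlier_estimates:
  assumes N: "N > 0"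
    and gap: "\<And>k. k < N \<Longrightarrow> 2 * \<delta> \<le> z - h k" and hB: "\<And>k. k < N \<Longrightarrow> \<bar>h k\<bar> \<le> B"
    and \<delta>: "\<delta> > 0" and t: "t > 0" "t \<le> B"
    and mean: "(\<Sum>k<N. 1 / (z - h k)) / N = 1 / t"
    and m2: "m2 = (\<Sum>k<N. (1 / (z - h k))\<^sup>2) / N"
    and form1: "\<And>y. \<bar>diag_form N (\<lambda>k. 1 / (z - h k) - 1 / t) (lin_app M X y)\<bar> \<le> \<epsilon> * sq_norm M y"
    and form2: "\<And>y. \<bar>diag_form N (\<lambda>k. (1 / (z - h k))\<^sup>2 - m2) (lin_app M X y)\<bar> \<le> \<epsilon> * sq_norm M y"
    and \<epsilon>: "\<epsilon> \<ge> 0"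
    and \<theta>: "\<And>j. j < M \<Longrightarrow> \<bar>\<theta> j\<bar> \<le> B"
    and J: "J \<subseteq> {..<M}" "i \<in> J" "\<And>j. j \<in> J \<Longrightarrow> t \<le> \<theta> j"
      "\<And>j. j < M \<Longrightarrow> j \<notin> J - {i} \<Longrightarrow> \<theta> j \<le> t"
    and K: "K \<subseteq> {..<N}" "card K = card J" "k0 \<in> K" "\<And>k. k \<in> K \<Longrightarrow> l \<le> \<mu> k"
      "\<And>k. k < N \<Longrightarrow> k \<notin> K - {k0} \<Longrightarrow> \<mu> k \<le> l"
    and eig: "\<And>k. k < N \<Longrightarrow> of_real (l - h k) * v k = lin_app M X (\<lambda>j. of_real (\<theta> j) * lin_adj N X v j) k"
    and v: "sq_norm N v = 1"
  shows "sqrt (sq_norm M (\<lambda>j. of_real (\<theta> j) * lin_adj N X v j - of_real t * lin_adj N X v j))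
      \<le> \<epsilon> * vector_const \<delta> B" (is "sqrt ?P \<le> _")
    and "\<bar>sq_norm M (lin_adj N X v) - 1 / (m2 * t\<^sup>2)\<bar> \<le> \<epsilon> * norm_const \<delta> B"
proof -
  let ?w = "lin_adj N X v"
  have B: "B > 0" using t by linarith
  have pos: "0 < z - h k" if "k < N" for k using gap[OF that] \<delta> by linarith
  have mean_le: "(\<Sum>k<N. f k) / N \<le> b" if "\<And>k. k < N \<Longrightarrow> f k \<le> b" for f :: "nat \<Rightarrow> real" and b
    using sum_bounded_above[of "{..<N}" f b] that N by (simp add: field_simps)
  have mean_ge: "b \<le> (\<Sum>k<N. f k) / N" if "\<And>k. k < N \<Longrightarrow> b \<le> f k" for f :: "nat \<Rightarrow> real" and b
    using sum_bounded_below[of "{..<N}" b f] that N by (simp add: field_simps)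
  have "1 / t \<le> 1 / (2 * \<delta>)"
    unfolding mean[symmetric] using gap \<delta> by (intro mean_le frac_le) auto
  then have t2: "2 * \<delta> \<le> t" using t \<delta> by (simp add: field_simps)
  have width: "z - h k \<le> 3 * B" if k: "k < N" for k
  proof (rule ccontr)
    assume "\<not> z - h k \<le> 3 * B"
    \<comment> \<open>Beyond \<open>2 * B\<close> every \<open>z - h k\<close> is at least
      \<open>z - B\<close>, so the mean equation would give
      \<open>z - B \<le> t \<le> B\<close>.\<close>
    then have zk: "z > 2 * B" using hB[OF k] by linarith
    have "1 / t \<le> 1 / (z - B)"
      unfolding mean[symmetric]
    proof (intro mean_le frac_le)
      fix k assume "k < N"
      then show "z - B \<le> z - h k" using hB[of k] by linarith
    qed (use zk B in auto)
    then show False using t zk B by (simp add: field_simps)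
  qed
  have a_bd: "1 / (3 * B) \<le> 1 / (z - h k)" "1 / (z - h k) \<le> 1 / (2 * \<delta>)" if "k < N" for k
    using width[OF that] gap[OF that] pos[OF that] \<delta> by (auto intro!: frac_le)
  have m2_ge: "(1 / (3 * B))\<^sup>2 \<le> m2"
    unfolding m2 using a_bd(1) B by (intro mean_ge power_mono) auto
  have m2_le: "m2 \<le> (1 / (2 * \<delta>))\<^sup>2"
    unfolding m2 using a_bd(2) pos by (intro mean_le power_mono) (auto simp: less_imp_le)
  have m20: "m2 > 0" using m2_ge B by (meson less_le_trans zero_less_power zero_less_divide_1_iff zero_less_mult_iff zero_less_numeral)
  have mt: "1 / (m2 * t\<^sup>2) \<le> 9 * B\<^sup>2 / (4 * \<delta>\<^sup>2)"
  proof -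
    have "(1 / (3 * B))\<^sup>2 * (2 * \<delta>)\<^sup>2 \<le> m2 * t\<^sup>2"
      using m2_ge m20 t2 \<delta> by (intro mult_mono power_mono) auto
    then have "1 / (m2 * t\<^sup>2) \<le> 1 / ((1 / (3 * B))\<^sup>2 * (2 * \<delta>)\<^sup>2)"
      using B \<delta> by (intro frac_le) auto
    also have "\<dots> = 9 * B\<^sup>2 / (4 * \<delta>\<^sup>2)" by (simp add: power_divide power_mult_distrib)
    finally show ?thesis .
  qed
  have mt0: "0 < m2 * t\<^sup>2" using m20 t by simp
  have w1: "sq_norm M ?w \<le> 1" using bessel[of v] v by simp
  have cases2: "12 * B\<^sup>2 * \<epsilon> \<le> \<delta> \<or> \<delta> / (12 * B\<^sup>2) \<le> \<epsilon>" using B by (auto simp: field_simps)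
  define c1 where "c1 = B\<^sup>2 * (1 + 6 * B\<^sup>2 / \<delta>\<^sup>2)"
  define c2 where "c2 = 9 * B\<^sup>2 / (4 * \<delta>\<^sup>2) *
     (B\<^sup>2 * (1 + 9 * B\<^sup>2 / \<delta>^3) + B^3 / (2 * \<delta>\<^sup>2) * (1 + 6 * B\<^sup>2 / \<delta>\<^sup>2))"
  define c3 where "c3 = 24 * B^3 / \<delta>"
  define c4 where "c4 = 12 * B\<^sup>2 / \<delta> * (1 + 9 * B\<^sup>2 / (4 * \<delta>\<^sup>2))"
  have cpos: "0 \<le> c1" "0 \<le> c2" "0 \<le> c3" "0 \<le> c4"
    using B \<delta> by (auto simp: c1_def c2_def c3_def c4_def intro!: mult_nonneg_nonneg add_nonneg_nonneg)
  have "sqrt ?P \<le> \<epsilon> * c1 \<and> \<bar>sq_norm M ?w - 1 / (m2 * t\<^sup>2)\<bar> \<le> \<epsilon> * c2 \<or>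
      sqrt ?P \<le> \<epsilon> * c3 \<and> \<bar>sq_norm M ?w - 1 / (m2 * t\<^sup>2)\<bar> \<le> \<epsilon> * c4"
    using cases2
  proof
    assume small: "12 * B\<^sup>2 * \<epsilon> \<le> \<delta>"
    \<comment> \<open>Not assumed, but forced by
      \<open>2 * \<delta> \<le> t \<le> B\<close>.\<close>
    have "\<delta> \<le> B" using t t2 \<delta> by linarith
    note close = eigenvalue_close[OF gap width \<delta> this t(1) form1 \<epsilon> small J K]
    note est = eigenvector_estimates[OF gap \<delta> t less_imp_le[OF m20] form1 form2 \<epsilon> \<theta> close small eig v]
    have E1: "\<epsilon> + 12 * B\<^sup>2 * \<epsilon> / (2 * \<delta>\<^sup>2) = \<epsilon> * (1 + 6 * B\<^sup>2 / \<delta>\<^sup>2)"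
      and E2: "\<epsilon> + 3 * (12 * B\<^sup>2 * \<epsilon>) / (4 * \<delta>^3) = \<epsilon> * (1 + 9 * B\<^sup>2 / \<delta>^3)"
      using \<delta> by (simp_all add: field_simps)
    have 1: "sqrt ?P \<le> \<epsilon> * c1"
      using est(1) unfolding E1 by (simp add: c1_def mult_ac)
    let ?R = "B\<^sup>2 * (\<epsilon> * (1 + 9 * B\<^sup>2 / \<delta>^3)) + 2 * m2 * B^3 * (\<epsilon> * (1 + 6 * B\<^sup>2 / \<delta>\<^sup>2))"
    have "2 * m2 * B^3 * (\<epsilon> * (1 + 6 * B\<^sup>2 / \<delta>\<^sup>2)) \<le> 2 * (1 / (2 * \<delta>))\<^sup>2 * B^3 * (\<epsilon> * (1 + 6 * B\<^sup>2 / \<delta>\<^sup>2))"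
      using m2_le B \<epsilon> by (intro mult_right_mono) auto
    also have "\<dots> = \<epsilon> * (B^3 / (2 * \<delta>\<^sup>2) * (1 + 6 * B\<^sup>2 / \<delta>\<^sup>2))"
      by (simp add: power_divide power_mult_distrib)
    finally have R: "?R \<le> \<epsilon> * (B\<^sup>2 * (1 + 9 * B\<^sup>2 / \<delta>^3) + B^3 / (2 * \<delta>\<^sup>2) * (1 + 6 * B\<^sup>2 / \<delta>\<^sup>2))" (is "_ \<le> ?Q")
      by (simp add: distrib_left mult_ac)
    have "\<bar>x - 1 / q\<bar> = \<bar>1 - q * x\<bar> * (1 / q)" if q: "q > 0" for x q :: real
    proof -
      have "x - 1 / q = - ((1 - q * x) * (1 / q))" using q by (simp add: field_simps)
      then show ?thesis using q by (simp add: abs_mult)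
    qed
    from this[OF mt0] have "\<bar>sq_norm M ?w - 1 / (m2 * t\<^sup>2)\<bar> =
        \<bar>1 - m2 * t\<^sup>2 * sq_norm M ?w\<bar> * (1 / (m2 * t\<^sup>2))" .
    also have "\<dots> \<le> ?Q * (9 * B\<^sup>2 / (4 * \<delta>\<^sup>2))"
    proof (intro mult_mono mt)
      show "\<bar>1 - m2 * t\<^sup>2 * sq_norm M ?w\<bar> \<le> ?Q" using est(2) R unfolding E1 E2 by (rule order_trans)
      then show "0 \<le> ?Q" by (rule order_trans[rotated]) simp
    qed (use mt0 in simp)
    also have "\<dots> = \<epsilon> * c2" by (simp add: c2_def mult_ac)
    finally show ?thesis using 1 by blast
  next
    \<comment> \<open>The trivial bounds \<open>2 * B\<close> and
      \<open>1 + 9 * B\<^sup>2 / (4 * \<delta>\<^sup>2)\<close> are multiplied by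
      \<open>12 * B\<^sup>2 * \<epsilon> / \<delta>\<close>, which is at least 1; this is the origin
      of \<open>c3\<close> and \<open>c4\<close>.\<close>
    assume large: "\<delta> / (12 * B\<^sup>2) \<le> \<epsilon>"
    have "?P \<le> (\<Sum>j<M. (2 * B)\<^sup>2 * (cmod (?w j))\<^sup>2)"
      unfolding sq_norm_def
    proof (rule sum_mono)
      fix j assume "j \<in> {..<M}"
      then have "\<bar>\<theta> j - t\<bar> \<le> 2 * B" using \<theta>[of j] t by auto
      then have "(\<theta> j - t)\<^sup>2 \<le> (2 * B)\<^sup>2" using B by (intro abs_le_square_iff[THEN iffD1]) simp
      moreover have "of_real (\<theta> j) * ?w j - of_real t * ?w j = of_real (\<theta> j - t) * ?w j"
        by (simp add: left_diff_distrib)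
      ultimately show "(cmod (of_real (\<theta> j) * ?w j - of_real t * ?w j))\<^sup>2 \<le> (2 * B)\<^sup>2 * (cmod (?w j))\<^sup>2"
        by (simp only: norm_mult norm_of_real power_mult_distrib power2_abs mult_right_mono zero_le_power2)
    qed
    also have "\<dots> = (2 * B)\<^sup>2 * sq_norm M ?w" by (simp add: sq_norm_def sum_distrib_left)
    also have "\<dots> \<le> (2 * B)\<^sup>2" using mult_left_mono[OF w1, of "(2 * B)\<^sup>2"] by simp
    finally have "sqrt ?P \<le> 2 * B" using B by (intro real_le_lsqrt) (auto simp: sq_norm_nonneg)
    also have "\<dots> = \<delta> / (12 * B\<^sup>2) * c3" using B \<delta> by (simp add: c3_def power2_eq_square power3_eq_cube)
    also have "\<dots> \<le> \<epsilon> * c3" using large cpos by (intro mult_right_mono)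
    finally have 1: "sqrt ?P \<le> \<epsilon> * c3" .
    have "0 \<le> sq_norm M ?w" by (rule sq_norm_nonneg)
    moreover have "0 \<le> 1 / (m2 * t\<^sup>2)" using mt0 by simp
    ultimately have "\<bar>sq_norm M ?w - 1 / (m2 * t\<^sup>2)\<bar> \<le> 1 + 9 * B\<^sup>2 / (4 * \<delta>\<^sup>2)"
      using w1 mt by linarith
    also have "\<dots> = \<delta> / (12 * B\<^sup>2) * c4" using B \<delta> by (simp add: c4_def)
    also have "\<dots> \<le> \<epsilon> * c4" using large cpos by (intro mult_right_mono)
    finally show ?thesis using 1 by blast
  qed
  moreover have "\<epsilon> * vector_const \<delta> B = \<epsilon> * c1 + \<epsilon> * c3" "\<epsilon> * norm_const \<delta> B = \<epsilon> * c2 + \<epsilon> * c4"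
    by (simp_all add: vector_const_def norm_const_def c1_def c2_def c3_def c4_def distrib_left)
  moreover have "0 \<le> \<epsilon> * c1" "0 \<le> \<epsilon> * c2" "0 \<le> \<epsilon> * c3" "0 \<le> \<epsilon> * c4" using cpos \<epsilon> by simp_all
  ultimately show "sqrt ?P \<le> \<epsilon> * vector_const \<delta> B"
    "\<bar>sq_norm M ?w - 1 / (m2 * t\<^sup>2)\<bar> \<le> \<epsilon> * norm_const \<delta> B" by linarith+
qed

end

section \<open>The Stieltjes transform and the operator norm\<close>

lemma stieltjes_sum_inverse:
  fixes h :: "nat \<Rightarrow> real"
  assumes N: "N > 0" and b: "\<And>k. k < N \<Longrightarrow> h k \<le> b" "k0 < N" "h k0 = b" and y: "y > 0"
  defines "m \<equiv> \<lambda>z. (\<Sum>k<N. 1 / (z - h k)) / N"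
  shows "inj_on m {b<..}" and "y \<in> m ` {b<..}"
proof -
  show "inj_on m {b<..}"
  proof (rule linorder_inj_onI')
    fix z z' assume z: "z \<in> {b<..}" "z' \<in> {b<..}" "z < z'"
    have "(\<Sum>k<N. 1 / (z' - h k)) < (\<Sum>k<N. 1 / (z - h k))"
    proof (rule sum_strict_mono)
      fix k assume "k \<in> {..<N}"
      then have "h k \<le> b" using b(1) by simp
      then show "1 / (z' - h k) < 1 / (z - h k)" using z by (intro frac_less2) auto
    qed (use N in auto)
    then show "m z \<noteq> m z'" using N by (auto simp: m_def)
  qed
  \<comment> \<open>At \<open>z1\<close> the summand of \<open>k0\<close> alone brings the mean up
    to \<open>y\<close>; at \<open>z2\<close> no summand exceeds \<open>y\<close>. The intermediate
    value theorem applies in between.\<close>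
  define z1 z2 where "z1 = b + 1 / (N * y)" and "z2 = b + 1 / y"
  have z12: "b < z1" "z1 \<le> z2" using N y by (auto simp: z1_def z2_def intro!: frac_le)
  have "\<exists>z. z1 \<le> z \<and> z \<le> z2 \<and> m z = y"
  proof (rule IVT2'[OF _ _ z12(2)])
    have "(\<Sum>k<N. 1 / (z2 - h k)) \<le> (\<Sum>k<N. y)"
    proof (rule sum_mono)
      fix k assume "k \<in> {..<N}"
      then have "1 / y \<le> z2 - h k" using b(1)[of k] by (simp add: z2_def)
      then have "1 / (z2 - h k) \<le> 1 / (1 / y)" using y by (intro frac_le) auto
      then show "1 / (z2 - h k) \<le> y" by simp
    qed
    then show "m z2 \<le> y" using N by (simp add: m_def field_simps)
    have "1 / (z1 - h k0) \<le> (\<Sum>k<N. 1 / (z1 - h k))"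
    proof (rule member_le_sum)
      fix k assume "k \<in> {..<N} - {k0}"
      then show "0 \<le> 1 / (z1 - h k)" using b(1)[of k] z12 by auto
    qed (use b(2) in auto)
    moreover have "1 / (z1 - h k0) = N * y" by (simp add: b(3) z1_def)
    ultimately show "y \<le> m z1" using N by (simp add: m_def field_simps)
    show "continuous_on {z1..z2} m"
      unfolding m_def
    proof (intro continuous_intros ballI)
      fix z k assume "z \<in> {z1..z2}" "k \<in> {..<N}"
      then show "z - h k \<noteq> 0" using b(1)[of k] z12 by auto
    qed (use N in auto)
  qed
  then obtain z where "z1 \<le> z" "m z = y" by blast
  with z12(1) show "y \<in> m ` {b<..}" by (intro image_eqI[of _ _ z]) auto
qed

lemma deriv_stieltjes_sum:
  fixes h :: "nat \<Rightarrow> real"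
  assumes "\<And>k. k < N \<Longrightarrow> z \<noteq> h k"
  shows "deriv (\<lambda>z. (\<Sum>k<N. 1 / (z - h k)) / N) z = - ((\<Sum>k<N. (1 / (z - h k))\<^sup>2) / N)"
proof (rule DERIV_imp_deriv)
  have "((\<lambda>z. \<Sum>k<N. 1 / (z - h k)) has_field_derivative (\<Sum>k<N. - (1 / (z - h k))\<^sup>2)) (at z)"
  proof (rule DERIV_sum)
    fix k assume "k \<in> {..<N}"
    then have "z - h k \<noteq> 0" using assms by auto
    then show "((\<lambda>z. 1 / (z - h k)) has_field_derivative - (1 / (z - h k))\<^sup>2) (at z)"
      by (auto intro!: derivative_eq_intros simp: power2_eq_square)
  qed
  from DERIV_cdivide[OF this, of "real N"]
  show "((\<lambda>z. (\<Sum>k<N. 1 / (z - h k)) / N) has_real_derivative - ((\<Sum>k<N. (1 / (z - h k))\<^sup>2) / N)) (at z)"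
    by (simp add: sum_negf)
qed

lemma stieltjes_alt:
  assumes "dim_row H = n"
  shows "stieltjes H z = (\<Sum>k<n. 1 / (z - eigval_list H ! k)) / n"
proof -
  have "(\<Sum>k=1..n. 1 / (z - eigval H k)) = (\<Sum>k<n. 1 / (z - eigval H (Suc k)))"
    by (rule sum.reindex_bij_witness[of _ Suc "\<lambda>k. k - 1"]) auto
  then show ?thesis using assms by (simp add: stieltjes_def eigval_def)
qed

text \<open>A crude bound whose purpose is to make the supremum in \<open>mat_opnorm\<close> one of
  a bounded set, so that it is an upper bound.\<close>

lemma euclid_norm_mult_vec_bounded:
  fixes A :: "'a :: real_normed_field mat"
  assumes "v \<in> carrier_vec (dim_col A)" "euclid_norm v \<le> 1"
  shows "euclid_norm (A *\<^sub>v v) \<le> (\<Sum>i<dim_row A. \<Sum>j<dim_col A. norm (A $$ (i, j)))"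
proof -
  have v1: "norm (vec_index v j) \<le> 1" if "j < dim_col A" for j
    using member_le_L2_set[of "{..<dim_vec v}" j "\<lambda>i. norm (vec_index v i)"] assms that
    by (auto simp: euclid_norm_def)
  have "euclid_norm (A *\<^sub>v v) \<le> (\<Sum>i<dim_row A. norm (vec_index (A *\<^sub>v v) i))"
    unfolding euclid_norm_def dim_mult_mat_vec by (rule L2_set_le_sum) simp
  also have "\<dots> \<le> (\<Sum>i<dim_row A. \<Sum>j<dim_col A. norm (A $$ (i, j)))"
  proof (rule sum_mono)
    fix i assume "i \<in> {..<dim_row A}"
    then have "vec_index (A *\<^sub>v v) i = (\<Sum>j<dim_col A. A $$ (i, j) * vec_index v j)"
      using assms(1) by (intro index_mat_vec_sum) auto
    also have "norm \<dots> \<le> (\<Sum>j<dim_col A. norm (A $$ (i, j)) * 1)"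
      using v1 by (intro sum_norm_le) (auto simp: norm_mult mult_left_le)
    finally show "norm (vec_index (A *\<^sub>v v) i) \<le> (\<Sum>j<dim_col A. norm (A $$ (i, j)))" by simp
  qed
  finally show ?thesis .
qed

lemma eigenvalue_le_opnorm:
  fixes A :: "'a :: real_normed_field mat"
  assumes A: "A \<in> carrier_mat n n" and ev: "eigenvalue A a"
  shows "norm a \<le> mat_opnorm A"
proof -
  obtain v where v: "v \<in> carrier_vec n" "v \<noteq> 0\<^sub>v n" "A *\<^sub>v v = a \<cdot>\<^sub>v v"
    using ev A by (auto simp: eigenvalue_def eigenvector_def)
  have scale: "euclid_norm (c \<cdot>\<^sub>v u) = norm c * euclid_norm u" for c :: 'a and u
    by (simp add: euclid_norm_def L2_set_def norm_mult power_mult_distrib real_sqrt_mult flip: sum_distrib_left)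
  have "euclid_norm v \<noteq> 0"
  proof
    assume "euclid_norm v = 0"
    then have "vec_index v i = 0" if "i < n" for i
      using that v(1) by (auto simp: euclid_norm_def L2_set_eq_0_iff)
    then have "v = 0\<^sub>v n" using v(1) by (intro eq_vecI) auto
    with v(2) show False ..
  qed
  moreover have "euclid_norm v \<ge> 0" by (simp add: euclid_norm_def)
  ultimately have pos: "euclid_norm v > 0" by simp
  define u where "u = of_real (1 / euclid_norm v) \<cdot>\<^sub>v v"
  have u: "u \<in> carrier_vec n" "euclid_norm u = 1" using v(1) pos unfolding u_def scale by (auto simp: norm_divide)
  have "A *\<^sub>v u = a \<cdot>\<^sub>v u"
    unfolding u_def using A v by (simp add: mult_mat_vec smult_smult_assoc mult.commute)
  then have "norm a = euclid_norm (A *\<^sub>v u)" using u(2) by (simp add: scale)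
  also have "\<dots> \<le> mat_opnorm A"
    unfolding mat_opnorm_def
  proof (rule cSUP_upper)
    show "u \<in> {v \<in> carrier_vec (dim_col A). euclid_norm v \<le> 1}" using u A by auto
    show "bdd_above ((\<lambda>v. euclid_norm (A *\<^sub>v v)) ` {v \<in> carrier_vec (dim_col A). euclid_norm v \<le> 1})"
      by (rule bdd_aboveI2[where M = "\<Sum>i<dim_row A. \<Sum>j<dim_col A. norm (A $$ (i, j))"])
         (use euclid_norm_mult_vec_bounded in blast)
  qed
  finally show ?thesis .
qed

section \<open>From matrices to the spiked model\<close>

context scalar_embedding
begin

definition emb_vec :: "'a Matrix.vec \<Rightarrow> nat \<Rightarrow> complex" where
  "emb_vec v i = e (vec_index v i)"

definition emb_mat :: "'a mat \<Rightarrow> nat \<Rightarrow> nat \<Rightarrow> complex" where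
  "emb_mat A i j = e (A $$ (i, j))"

lemma emb_mat_mult:
  assumes "A \<in> carrier_mat n m" "B \<in> carrier_mat m p" "i < n" "j < p"
  shows "emb_mat (A * B) i j = (\<Sum>k<m. emb_mat A i k * emb_mat B k j)"
proof -
  have "(A * B) $$ (i, j) = (\<Sum>k<m. A $$ (i, k) * B $$ (k, j))"
    using assms by (intro index_mat_mult_sum) auto
  then show ?thesis by (simp add: emb_mat_def e_sum e_mult)
qed

lemma emb_mat_adjoint:
  assumes "A \<in> carrier_mat n m" "i < m" "j < n"
  shows "emb_mat (mat_adjoint A) i j = cnj (emb_mat A j i)"
  using assms by (simp add: emb_mat_def e_conj)

lemma emb_mult_vec:
  assumes "A \<in> carrier_mat n m" "v \<in> carrier_vec m" "i < n"
  shows "emb_vec (A *\<^sub>v v) i = lin_app m (emb_mat A) (emb_vec v) i"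
proof -
  have "vec_index (A *\<^sub>v v) i = (\<Sum>k<m. A $$ (i, k) * vec_index v k)"
    using assms by (intro index_mat_vec_sum) auto
  then show ?thesis by (simp add: emb_vec_def emb_mat_def lin_app_def e_sum e_mult)
qed

lemma lin_app_adjoint:
  assumes "A \<in> carrier_mat n m" "j < m"
  shows "lin_app n (emb_mat (mat_adjoint A)) x j = lin_adj n (emb_mat A) x j"
  unfolding lin_app_def lin_adj_def using assms by (intro sum.cong refl) (simp add: emb_mat_adjoint)

lemma lin_app_mult:
  assumes "A \<in> carrier_mat n m" "B \<in> carrier_mat m p" "i < n"
  shows "lin_app p (emb_mat (A * B)) x i = lin_app m (emb_mat A) (lin_app p (emb_mat B) x) i"
proof -
  have "lin_app p (emb_mat (A * B)) x i = (\<Sum>j<p. \<Sum>k<m. emb_mat A i k * (emb_mat B k j * x j))"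
    unfolding lin_app_def using assms
    by (intro sum.cong refl) (simp add: emb_mat_mult sum_distrib_right mult.assoc)
  also have "\<dots> = lin_app m (emb_mat A) (lin_app p (emb_mat B) x) i"
    by (subst sum.swap) (simp add: lin_app_def sum_distrib_left)
  finally show ?thesis .
qed

lemma lin_app_cong:
  assumes "\<And>j. j < m \<Longrightarrow> x j = y j"
  shows "lin_app m X x i = lin_app m X y i"
  unfolding lin_app_def using assms by (intro sum.cong) auto

lemma lin_app_diag:
  assumes "k < n"
  shows "lin_app n (emb_mat (mat_diag n (\<lambda>j. of_real (f j)))) x k = of_real (f k) * x k"
proof -
  have "lin_app n (emb_mat (mat_diag n (\<lambda>j. of_real (f j)))) x k = (\<Sum>j<n. if j = k then of_real (f k) * x k else 0)"
    unfolding lin_app_def using assms by (intro sum.cong refl) (auto simp: emb_mat_def mat_diag_def e_of_real)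
  then show ?thesis using assms by simp
qed

lemma lin_app_one: "k < n \<Longrightarrow> lin_app n (emb_mat (1\<^sub>m n)) x k = x k"
proof -
  assume k: "k < n"
  have "lin_app n (emb_mat (1\<^sub>m n)) x k = (\<Sum>j<n. if j = k then x k else 0)"
    unfolding lin_app_def using k by (intro sum.cong refl) (auto simp: emb_mat_def)
  then show ?thesis using k by simp
qed

lemma lin_adj_app_orthonormal:
  assumes "Y \<in> carrier_mat n m" "mat_adjoint Y * Y = 1\<^sub>m m" "j < m"
  shows "lin_adj n (emb_mat Y) (lin_app m (emb_mat Y) y) j = y j"
proof -
  have "lin_adj n (emb_mat Y) (lin_app m (emb_mat Y) y) j = lin_app m (emb_mat (mat_adjoint Y * Y)) y j"
    using assms by (subst lin_app_mult[of _ m n]) (auto simp: lin_app_adjoint)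
  then show ?thesis unfolding assms(2) using assms(3) by (simp add: lin_app_one)
qed

lemma sq_norm_orthonormal:
  assumes "Y \<in> carrier_mat n m" "mat_adjoint Y * Y = 1\<^sub>m m"
  shows "sq_norm n (lin_app m (emb_mat Y) y) = sq_norm m y"
  by (rule sq_norm_lin_app[OF lin_adj_app_orthonormal[OF assms]])

lemma sq_norm_unitary_adjoint:
  assumes "S \<in> unitary_group n"
  shows "sq_norm n (lin_adj n (emb_mat S) v) = sq_norm n v"
proof -
  note S = unitary_groupD[OF assms]
  have "sq_norm n (lin_adj n (emb_mat S) v) = sq_norm n (lin_app n (emb_mat (mat_adjoint S)) v)"
    unfolding sq_norm_def using S(1) by (intro sum.cong refl) (simp add: lin_app_adjoint)
  also have "\<dots> = sq_norm n v"
    using unitary_groupD[OF unitary_group_adjoint[OF assms]] by (intro sq_norm_orthonormal) auto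
  finally show ?thesis .
qed

lemma lin_app_conj_diag:
  assumes X: "X \<in> carrier_mat n m" and k: "k < n"
  shows "lin_app n (emb_mat (X * mat_diag m (\<lambda>j. of_real (f j)) * mat_adjoint X)) x k =
    lin_app m (emb_mat X) (\<lambda>j. of_real (f j) * lin_adj n (emb_mat X) x j) k"
proof -
  let ?D = "mat_diag m (\<lambda>j. of_real (f j)) :: 'a mat"
  have "lin_app n (emb_mat (X * ?D * mat_adjoint X)) x k =
      lin_app m (emb_mat (X * ?D)) (lin_app n (emb_mat (mat_adjoint X)) x) k"
    using X k by (intro lin_app_mult[of _ n m _ n]) auto
  also have "\<dots> = lin_app m (emb_mat X) (lin_app m (emb_mat ?D) (lin_app n (emb_mat (mat_adjoint X)) x)) k"
    using X k by (intro lin_app_mult[of _ n m _ m]) auto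
  also have "\<dots> = lin_app m (emb_mat X) (\<lambda>j. of_real (f j) * lin_adj n (emb_mat X) x j) k"
    using X by (intro lin_app_cong) (simp add: lin_app_diag lin_app_adjoint)
  finally show ?thesis .
qed

lemma inner_sum_conj_diag:
  assumes X: "X \<in> carrier_mat n m"
  shows "inner_sum n x (lin_app n (emb_mat (X * mat_diag m (\<lambda>j. of_real (f j)) * mat_adjoint X)) x) =
    of_real (diag_form m f (lin_adj n (emb_mat X) x))"
proof -
  let ?w = "lin_adj n (emb_mat X) x" and ?u = "\<lambda>j. of_real (f j) * lin_adj n (emb_mat X) x j"
  have "inner_sum n x (lin_app n (emb_mat (X * mat_diag m (\<lambda>j. of_real (f j)) * mat_adjoint X)) x) =
      inner_sum n x (lin_app m (emb_mat X) ?u)"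
    unfolding inner_sum_def by (intro sum.cong refl) (simp add: lin_app_conj_diag[OF X])
  also have "\<dots> = cnj (inner_sum n (lin_app m (emb_mat X) ?u) x)"
    by (simp add: inner_sum_def mult.commute)
  also have "\<dots> = cnj (inner_sum m ?u ?w)" unfolding inner_sum_adj ..
  also have "\<dots> = of_real (diag_form m f ?w)"
    unfolding inner_sum_def diag_form_def cnj_sum of_real_sum
    by (intro sum.cong refl) (simp add: complex_norm_square mult_ac del: of_real_power)
  finally show ?thesis .
qed

lemma euclid_norm_emb: "euclid_norm v = sqrt (sq_norm (dim_vec v) (emb_vec v))"
  by (simp add: euclid_norm_def L2_set_def sq_norm_def emb_vec_def e_norm)

text \<open>Conjugation by \<open>Q\<close> moves everything into the eigenbasis of
  \<open>H\<close>: the matrix becomes a fixed diagonal plus \<open>X \<Theta> X\<^sup>*\<close>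
  with the random frame \<open>X = Q V\<close>. The eigenvector \<open>v\<close> becomes
  \<open>Q v\<close>, and \<open>X\<^sup>* Q v = V\<^sup>* v\<close>, so the projection coordinates
  of the theorem are those of the model.\<close>

lemma spiked_model_conjugated:
  assumes H: "S \<in> unitary_group n" "H = S * mat_diag n (\<lambda>k. of_real (h k)) * mat_adjoint S"
    and V: "V \<in> carrier_mat n m" "mat_adjoint V * V = 1\<^sub>m m"
    and P: "P = V * mat_diag m (\<lambda>j. of_real (\<theta> j)) * mat_adjoint V"
    and U: "U \<in> unitary_group n"
    and T: "T \<in> unitary_group n"
      "mat_adjoint U * H * U + P = T * mat_diag n (\<lambda>k. of_real (\<mu> k)) * mat_adjoint T"
  defines "Q \<equiv> mat_adjoint S * U"
  shows "spiked_model n m h \<theta> \<mu> (emb_mat (Q * V)) (emb_mat (Q * T))"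
    and "\<And>v k. v \<in> carrier_vec n \<Longrightarrow> (mat_adjoint U * H * U + P) *\<^sub>v v = of_real l \<cdot>\<^sub>v v \<Longrightarrow> k < n \<Longrightarrow>
      of_real (l - h k) * emb_vec (Q *\<^sub>v v) k =
      lin_app m (emb_mat (Q * V)) (\<lambda>j. of_real (\<theta> j) * lin_adj n (emb_mat (Q * V)) (emb_vec (Q *\<^sub>v v)) j) k"
    and "\<And>v j. v \<in> carrier_vec n \<Longrightarrow> j < m \<Longrightarrow>
      lin_adj n (emb_mat (Q * V)) (emb_vec (Q *\<^sub>v v)) j = emb_vec (mat_adjoint V *\<^sub>v v) j"
    and "\<And>v. v \<in> carrier_vec n \<Longrightarrow> sq_norm n (emb_vec (Q *\<^sub>v v)) = (euclid_norm v)\<^sup>2"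
proof -
  note S' = unitary_groupD[OF H(1)] and U' = unitary_groupD[OF U] and T' = unitary_groupD[OF T(1)]
  have Q: "Q \<in> unitary_group n" unfolding Q_def by (intro unitary_group_mult unitary_group_adjoint H(1) U)
  note Q' = unitary_groupD[OF Q]
  let ?D = "mat_diag n (\<lambda>k. of_real (h k)) :: 'a mat"
  let ?Th = "mat_diag m (\<lambda>j. of_real (\<theta> j)) :: 'a mat"
  let ?L = "mat_diag n (\<lambda>k. of_real (\<mu> k)) :: 'a mat"
  define X where "X = Q * V"
  define R where "R = Q * T"
  have Xc: "X \<in> carrier_mat n m" using Q'(1) V(1) by (simp add: X_def)
  have Rc: "R \<in> carrier_mat n n" using Q'(1) T'(1) by (simp add: R_def)
  have R: "R \<in> unitary_group n" unfolding R_def by (intro unitary_group_mult Q T(1))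
  define W where "W = mat_adjoint U * H * U + P"
  have Hc: "H \<in> carrier_mat n n" 
    unfolding H(2) by (rule mult_carrier_mat[OF mult_carrier_mat[OF S'(1) mat_diag_carrier]]) (use S'(1) in simp)
  have Pc: "P \<in> carrier_mat n n" 
    unfolding P by (rule mult_carrier_mat[OF mult_carrier_mat[OF V(1) mat_diag_carrier]]) (use V(1) in simp)
  have Wc: "W \<in> carrier_mat n n" using U'(1) Hc Pc by (simp add: W_def)
  have Qa: "mat_adjoint Q \<in> carrier_mat n n" using Q'(1) by simp
  \<comment> \<open>Used for all three matrices: \<open>H\<close> with frame
    \<open>mat_adjoint U\<close>, \<open>P\<close> with frame \<open>V\<close>, and the perturbed
    matrix with frame \<open>T\<close>.\<close>
  have conj: "Q * (Y * L * mat_adjoint Y) * mat_adjoint Q = (Q * Y) * L * mat_adjoint (Q * Y)"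
    if Y: "Y \<in> carrier_mat n p" and L: "L \<in> carrier_mat p p" for Y L p
  proof -
    have Ya: "mat_adjoint Y \<in> carrier_mat p n" using Y by simp
    have YL: "Y * L \<in> carrier_mat n p" using Y L by simp
    have "Q * (Y * L * mat_adjoint Y) * mat_adjoint Q = Q * (Y * L) * mat_adjoint Y * mat_adjoint Q"
      using assoc_mult_mat[OF Q'(1) YL Ya] by simp
    also have "\<dots> = Q * (Y * L) * (mat_adjoint Y * mat_adjoint Q)"
      by (rule assoc_mult_mat[OF mult_carrier_mat[OF Q'(1) YL] Ya Qa])
    also have "Q * (Y * L) = Q * Y * L" by (rule assoc_mult_mat[OF Q'(1) Y L, symmetric])
    finally show ?thesis unfolding mat_adjoint_mult[OF Q'(1) Y] .
  qed
  have QH: "Q * (mat_adjoint U * H * U) * mat_adjoint Q = ?D"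
  proof -
    have QUa: "Q * mat_adjoint U = mat_adjoint S"
      unfolding Q_def using S'(1) U' by (simp add: assoc_mult_mat[of _ n n _ n _ n])
    have "mat_adjoint U * H * U = mat_adjoint U * H * mat_adjoint (mat_adjoint U)" by simp
    then have "Q * (mat_adjoint U * H * U) * mat_adjoint Q = (Q * mat_adjoint U) * H * mat_adjoint (Q * mat_adjoint U)"
      using conj[of "mat_adjoint U" n H] U'(1) Hc by simp
    also have "\<dots> = mat_adjoint S * H * S" unfolding QUa by simp
    also have "\<dots> = (mat_adjoint S * S) * ?D * (mat_adjoint S * S)"
    proof -
      have Sa: "mat_adjoint S \<in> carrier_mat n n" using S'(1) by simp
      have SD: "S * ?D \<in> carrier_mat n n" using S'(1) by simp
      have "mat_adjoint S * (S * ?D * mat_adjoint S) = mat_adjoint S * (S * ?D) * mat_adjoint S"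
        by (rule assoc_mult_mat[OF Sa SD Sa, symmetric])
      also have "mat_adjoint S * (S * ?D) = mat_adjoint S * S * ?D"
        by (rule assoc_mult_mat[OF Sa S'(1) mat_diag_carrier, symmetric])
      finally have "mat_adjoint S * H * S = mat_adjoint S * S * ?D * mat_adjoint S * S" unfolding H(2) by simp
      also have "\<dots> = mat_adjoint S * S * ?D * (mat_adjoint S * S)"
        by (rule assoc_mult_mat[OF mult_carrier_mat[OF mult_carrier_mat[OF Sa S'(1)] mat_diag_carrier] Sa S'(1)])
      finally show ?thesis .
    qed
    also have "\<dots> = ?D" unfolding S'(2) left_mult_one_mat[OF mat_diag_carrier] right_mult_one_mat[OF mat_diag_carrier] ..
    finally show ?thesis .
  qed
  have QW: "Q * W * mat_adjoint Q = ?D + X * ?Th * mat_adjoint X"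
  proof -
    have UHU: "mat_adjoint U * H * U \<in> carrier_mat n n" using U'(1) Hc by simp
    have "Q * W * mat_adjoint Q = Q * (mat_adjoint U * H * U) * mat_adjoint Q + Q * P * mat_adjoint Q"
      unfolding W_def mult_add_distrib_mat[OF Q'(1) UHU Pc]
      by (rule add_mult_distrib_mat[OF mult_carrier_mat[OF Q'(1) UHU] mult_carrier_mat[OF Q'(1) Pc] Qa])
    then show ?thesis unfolding QH P conj[OF V(1) mat_diag_carrier] X_def .
  qed
  have QW': "Q * W * mat_adjoint Q = R * ?L * mat_adjoint R"
    unfolding W_def T(2) R_def by (rule conj[OF T'(1) mat_diag_carrier])
  have XX: "mat_adjoint X * X = 1\<^sub>m m"
  proof -
    have Va: "mat_adjoint V \<in> carrier_mat m n" using V(1) by simp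
    have "mat_adjoint X * X = mat_adjoint V * mat_adjoint Q * (Q * V)"
      unfolding X_def mat_adjoint_mult[OF Q'(1) V(1)] ..
    also have "\<dots> = mat_adjoint V * (mat_adjoint Q * (Q * V))"
      by (rule assoc_mult_mat[OF Va Qa mult_carrier_mat[OF Q'(1) V(1)]])
    also have "mat_adjoint Q * (Q * V) = (mat_adjoint Q * Q) * V"
      by (rule assoc_mult_mat[OF Qa Q'(1) V(1), symmetric])
    finally show ?thesis unfolding Q'(2) left_mult_one_mat[OF V(1)] V(2) .
  qed
  have app: "lin_app n (emb_mat (Q * W * mat_adjoint Q)) x k =
      of_real (h k) * x k + lin_app m (emb_mat X) (\<lambda>j. of_real (\<theta> j) * lin_adj n (emb_mat X) x j) k"
    if k: "k < n" for x k
  proof -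
    have add: "lin_app n (emb_mat (A + B)) x k = lin_app n (emb_mat A) x k + lin_app n (emb_mat B) x k"
      if "A \<in> carrier_mat n n" "B \<in> carrier_mat n n" for A B
      unfolding lin_app_def sum.distrib[symmetric] using k that
      by (intro sum.cong refl) (auto simp: emb_mat_def e_add distrib_right)
    have "X * ?Th * mat_adjoint X \<in> carrier_mat n n"
      by (rule mult_carrier_mat[OF mult_carrier_mat[OF Xc mat_diag_carrier]]) (use Xc in simp)
    from add[OF mat_diag_carrier[of n "\<lambda>k. of_real (h k)"] this] show ?thesis
      unfolding QW lin_app_conj_diag[OF Xc k] lin_app_diag[OF k] .
  qed
  show "spiked_model n m h \<theta> \<mu> (emb_mat (Q * V)) (emb_mat (Q * T))"
    unfolding X_def[symmetric] R_def[symmetric]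
  proof
    show "lin_adj n (emb_mat X) (lin_app m (emb_mat X) y) j = y j" if "j < m" for y j
      by (rule lin_adj_app_orthonormal[OF Xc XX that])
    show "sq_norm n (lin_adj n (emb_mat R) v) = sq_norm n v" for v
      by (rule sq_norm_unitary_adjoint[OF R])
    show "diag_form n \<mu> (lin_adj n (emb_mat R) v) = diag_form n h v + diag_form m \<theta> (lin_adj n (emb_mat X) v)" for v
    proof -
      have "complex_of_real (diag_form n \<mu> (lin_adj n (emb_mat R) v)) =
          inner_sum n v (lin_app n (emb_mat (Q * W * mat_adjoint Q)) v)"
        unfolding QW' by (rule inner_sum_conj_diag[OF Rc, symmetric])
      also have "\<dots> = inner_sum n v (\<lambda>k. of_real (h k) * v k) +
          inner_sum n v (lin_app m (emb_mat X) (\<lambda>j. of_real (\<theta> j) * lin_adj n (emb_mat X) v j))"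
        unfolding inner_sum_def sum.distrib[symmetric] by (intro sum.cong refl) (simp add: app distrib_left)
      also have "inner_sum n v (\<lambda>k. of_real (h k) * v k) = of_real (diag_form n h v)"
        unfolding inner_sum_def diag_form_def of_real_sum
        by (intro sum.cong refl) (simp add: complex_norm_square mult_ac del: of_real_power)
      also have "inner_sum n v (lin_app m (emb_mat X) (\<lambda>j. of_real (\<theta> j) * lin_adj n (emb_mat X) v j)) =
          inner_sum n v (lin_app n (emb_mat (X * ?Th * mat_adjoint X)) v)"
        unfolding inner_sum_def by (intro sum.cong refl) (simp add: lin_app_conj_diag[OF Xc])
      also have "\<dots> = of_real (diag_form m \<theta> (lin_adj n (emb_mat X) v))"
        by (rule inner_sum_conj_diag[OF Xc])
      finally show ?thesis by (simp only: of_real_add[symmetric] of_real_eq_iff)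
    qed
  qed
  show "of_real (l - h k) * emb_vec (Q *\<^sub>v v) k =
      lin_app m (emb_mat (Q * V)) (\<lambda>j. of_real (\<theta> j) * lin_adj n (emb_mat (Q * V)) (emb_vec (Q *\<^sub>v v)) j) k"
    if v: "v \<in> carrier_vec n" and ev: "(mat_adjoint U * H * U + P) *\<^sub>v v = of_real l \<cdot>\<^sub>v v" and k: "k < n" for v k
  proof -
    have Qv: "Q *\<^sub>v v \<in> carrier_vec n" using Q'(1) v by simp
    have "Q * W * mat_adjoint Q *\<^sub>v (Q *\<^sub>v v) = Q * W *\<^sub>v (mat_adjoint Q *\<^sub>v (Q *\<^sub>v v))"
      by (rule assoc_mult_mat_vec[OF mult_carrier_mat[OF Q'(1) Wc] Qa Qv])
    also have "mat_adjoint Q *\<^sub>v (Q *\<^sub>v v) = v"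
      using assoc_mult_mat_vec[OF Qa Q'(1) v] unfolding Q'(2) using v by simp
    also have "Q * W *\<^sub>v v = Q *\<^sub>v (W *\<^sub>v v)" by (rule assoc_mult_mat_vec[OF Q'(1) Wc v])
    also have "\<dots> = of_real l \<cdot>\<^sub>v (Q *\<^sub>v v)"
      using ev unfolding W_def by (simp add: mult_mat_vec[OF Q'(1) v])
    finally have *: "Q * W * mat_adjoint Q *\<^sub>v (Q *\<^sub>v v) = of_real l \<cdot>\<^sub>v (Q *\<^sub>v v)" .
    have QWQ: "Q * W * mat_adjoint Q \<in> carrier_mat n n"
      using mult_carrier_mat[OF mult_carrier_mat[OF Q'(1) Wc] Qa] .
    have "lin_app n (emb_mat (Q * W * mat_adjoint Q)) (emb_vec (Q *\<^sub>v v)) k = of_real l * emb_vec (Q *\<^sub>v v) k"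
      unfolding emb_mult_vec[OF QWQ Qv k, symmetric] * using Q'(1) k by (simp add: emb_vec_def e_mult e_of_real)
    then show ?thesis unfolding app[OF k] X_def[symmetric] by (simp add: algebra_simps)
  qed
  show "lin_adj n (emb_mat (Q * V)) (emb_vec (Q *\<^sub>v v)) j = emb_vec (mat_adjoint V *\<^sub>v v) j"
    if v: "v \<in> carrier_vec n" and j: "j < m" for v j
  proof -
    have Va: "mat_adjoint V \<in> carrier_mat m n" using V(1) by simp
    have Qv: "Q *\<^sub>v v \<in> carrier_vec n" using Q'(1) v by simp
    have Xa: "mat_adjoint X \<in> carrier_mat m n" using Xc by simp
    have "mat_adjoint X *\<^sub>v (Q *\<^sub>v v) = mat_adjoint V *\<^sub>v (mat_adjoint Q *\<^sub>v (Q *\<^sub>v v))"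
      unfolding X_def mat_adjoint_mult[OF Q'(1) V(1)] by (rule assoc_mult_mat_vec[OF Va Qa Qv])
    also have "mat_adjoint Q *\<^sub>v (Q *\<^sub>v v) = v"
      using assoc_mult_mat_vec[OF Qa Q'(1) v] unfolding Q'(2) using v by simp
    finally have "emb_vec (mat_adjoint V *\<^sub>v v) j = emb_vec (mat_adjoint X *\<^sub>v (Q *\<^sub>v v)) j" by simp
    also have "\<dots> = lin_app n (emb_mat (mat_adjoint X)) (emb_vec (Q *\<^sub>v v)) j"
      by (rule emb_mult_vec[OF Xa Qv j])
    also have "\<dots> = lin_adj n (emb_mat X) (emb_vec (Q *\<^sub>v v)) j" by (rule lin_app_adjoint[OF Xc j])
    finally show ?thesis unfolding X_def ..
  qed
  show "sq_norm n (emb_vec (Q *\<^sub>v v)) = (euclid_norm v)\<^sup>2" if v: "v \<in> carrier_vec n" for v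
  proof -
    have "sq_norm n (emb_vec (Q *\<^sub>v v)) = sq_norm n (lin_app n (emb_mat Q) (emb_vec v))"
      unfolding sq_norm_def using Q'(1) v by (intro sum.cong refl) (simp add: emb_mult_vec)
    also have "\<dots> = sq_norm n (emb_vec v)" by (rule sq_norm_orthonormal[OF Q'(1,2)])
    finally show ?thesis using v by (simp add: euclid_norm_emb sq_norm_nonneg)
  qed
qed

end

section \<open>Haar distributed matrices\<close>

lemma space_haar:
  assumes "haar_distribution n \<mu>"
  shows "space \<mu> = unitary_group n"
proof -
  have "sets \<mu> = sets (restrict_space (mat_borel n) (unitary_group n))"
    using assms by (simp add: haar_distribution_def)
  then have "space \<mu> = space (restrict_space (mat_borel n) (unitary_group n))" by (rule sets_eq_imp_space_eq)
  also have "\<dots> = unitary_group n"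
    by (auto simp: space_restrict_space mat_borel_def unitary_group_def)
  finally show ?thesis .
qed

lemma measurable_haar_eq:
  assumes "haar_distribution n \<mu>"
  shows "measurable \<mu> L = measurable (restrict_space (mat_borel n) (unitary_group n)) L"
    and "measurable L \<mu> = measurable L (restrict_space (mat_borel n) (unitary_group n))"
  using assms by (auto intro!: measurable_cong_sets simp: haar_distribution_def)

lemma measurable_haar_entry:
  assumes haar: "haar_distribution n \<mu>" and ij: "i < n" "j < n"
  shows "(\<lambda>U. U $$ (i, j)) \<in> borel_measurable \<mu>"
proof -
  let ?I = "{..<n} \<times> {..<n}"
  have 1: "(\<lambda>A. \<lambda>ij\<in>?I. A $$ ij) \<in> measurable (mat_borel n) (PiM ?I (\<lambda>_. borel))"
    unfolding mat_borel_def by (rule measurable_vimage_algebra1) (simp add: space_PiM)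
  have 2: "(\<lambda>f. f (i, j)) \<in> measurable (PiM ?I (\<lambda>_. borel)) borel"
    by (rule measurable_component_singleton) (use ij in simp)
  have "(\<lambda>A. A $$ (i, j)) \<in> borel_measurable (mat_borel n)"
    using measurable_compose[OF 1 2] ij by simp
  then show ?thesis unfolding measurable_haar_eq(1)[OF haar] by (rule measurable_restrict_space1)
qed

lemma measurable_haar_mult:
  fixes \<mu> :: "'a :: {conjugatable_field, real_normed_field, second_countable_topology} mat measure"
  assumes haar: "haar_distribution n \<mu>" and Q: "Q \<in> unitary_group n"
  shows "(\<lambda>U. Q * U) \<in> measurable \<mu> \<mu>"
  unfolding measurable_haar_eq(2)[OF haar]
proof (rule measurable_restrict_space2)
  note Q' = unitary_groupD[OF Q]
  show "(\<lambda>U. Q * U) \<in> space \<mu> \<rightarrow> unitary_group n"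
    unfolding space_haar[OF haar] using unitary_group_mult[OF Q] by blast
  show "(\<lambda>U. Q * U) \<in> measurable \<mu> (mat_borel n)"
    unfolding mat_borel_def
  proof (rule measurable_vimage_algebra2)
    show "(\<lambda>U. Q * U) \<in> space \<mu> \<rightarrow> carrier_mat n n"
      unfolding space_haar[OF haar] using unitary_groupD(1)[OF unitary_group_mult[OF Q]] by blast
    show "(\<lambda>U. \<lambda>ij\<in>{..<n} \<times> {..<n}. (Q * U) $$ ij) \<in> measurable \<mu> (PiM ({..<n} \<times> {..<n}) (\<lambda>_. borel))"
    proof (rule measurable_restrict)
      fix ij assume "ij \<in> {..<n} \<times> {..<n}"
      then obtain i j where ij: "ij = (i, j)" "i < n" "j < n" by auto
      have "(\<lambda>U. \<Sum>k<n. Q $$ (i, k) * U $$ (k, j)) \<in> borel_measurable \<mu>"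
        using ij by (intro borel_measurable_sum borel_measurable_times borel_measurable_const measurable_haar_entry[OF haar]) auto
      moreover have "(\<Sum>k<n. Q $$ (i, k) * U $$ (k, j)) = (Q * U) $$ ij" if "U \<in> space \<mu>" for U
      proof -
        have "U \<in> carrier_mat n n" using that unitary_groupD(1) by (auto simp: space_haar[OF haar])
        then show ?thesis unfolding ij(1) using Q'(1) ij(2,3)
          by (intro index_mat_mult_sum[symmetric]) auto
      qed
      ultimately show "(\<lambda>U. (Q * U) $$ ij) \<in> borel_measurable \<mu>"
        by (subst measurable_cong[where g = "\<lambda>U. \<Sum>k<n. Q $$ (i, k) * U $$ (k, j)"]) auto
    qed
  qed
qed

lemma integral_haar_mult:
  fixes \<mu> :: "'a :: {conjugatable_field, real_normed_field, second_countable_topology} mat measure" and g :: "'a mat \<Rightarrow> real"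
  assumes haar: "haar_distribution n \<mu>" and Q: "Q \<in> unitary_group n" and g: "g \<in> borel_measurable \<mu>"
  shows "(\<integral>U. g (Q * U) \<partial>\<mu>) = (\<integral>U. g U \<partial>\<mu>)"
proof -
  have "(\<integral>U. g U \<partial>distr \<mu> \<mu> (\<lambda>U. Q * U)) = (\<integral>U. g (Q * U) \<partial>\<mu>)"
    by (rule integral_distr[OF measurable_haar_mult[OF haar Q] g])
  then show ?thesis using haar Q by (simp add: haar_distribution_def)
qed

section \<open>Concentration of the forms under the Haar measure\<close>

definition rotation_mat :: "nat \<Rightarrow> nat \<Rightarrow> nat \<Rightarrow> real \<Rightarrow> 'a :: real_normed_field mat" where
  "rotation_mat n i j \<phi> = mat n n (\<lambda>(k, l).
     if k = i then (if l = i then of_real (cos \<phi>) else if l = j then - of_real (sin \<phi>) else 0)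
     else if k = j then (if l = i then of_real (sin \<phi>) else if l = j then of_real (cos \<phi>) else 0)
     else (if k = l then 1 else 0))"

lemma sum_remove2:
  fixes f :: "nat \<Rightarrow> 'a :: comm_monoid_add"
  assumes "i < n" "j < n" "i \<noteq> j"
  shows "(\<Sum>k<n. f k) = f i + (f j + (\<Sum>k\<in>{..<n} - {i} - {j}. f k))"
  using assms by (subst sum.remove[of "{..<n}" i]; simp) (subst sum.remove[of "{..<n} - {i}" j]; simp)

context scalar_embedding
begin

lemma measurable_e: "e \<in> borel_measurable borel"
proof (rule borel_measurable_continuous_onI)
  have "dist (e x) (e y) = dist x y" for x y
    by (simp add: dist_norm e_norm flip: hom_minus)
  then show "continuous_on UNIV e" unfolding continuous_on_iff by auto
qed

lemma rotation_mat_unitary: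
  assumes ij: "i < n" "j < n" "i \<noteq> j"
  shows "(rotation_mat n i j \<phi> :: 'a mat) \<in> unitary_group n"
proof (rule unitary_groupI)
  let ?R = "rotation_mat n i j \<phi> :: 'a mat"
  show R: "?R \<in> carrier_mat n n" by (simp add: rotation_mat_def)
  have real: "conjugate (of_real r :: 'a) = of_real r" for r
    unfolding e_inj[symmetric] e_conj e_of_real by simp
  have real': "conjugate (0 :: 'a) = 0" "conjugate (1 :: 'a) = 1" "conjugate (- of_real r :: 'a) = - of_real r" for r
    using real[of 0] real[of 1] real[of "- r"] by simp_all
  have sc: "of_real (sin \<phi>) * of_real (sin \<phi>) + of_real (cos \<phi>) * of_real (cos \<phi>) = (1 :: 'a)"
    unfolding of_real_mult[symmetric] of_real_add[symmetric] by (simp flip: power2_eq_square)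
  show "mat_adjoint ?R * ?R = 1\<^sub>m n"
  proof (rule eq_matI)
    fix k l assume "k < dim_row (1\<^sub>m n :: 'a mat)" "l < dim_col (1\<^sub>m n :: 'a mat)"
    then have kl: "k < n" "l < n" by auto
    have "(mat_adjoint ?R * ?R) $$ (k, l) = (\<Sum>a<n. conjugate (?R $$ (a, k)) * ?R $$ (a, l))"
      using R kl by (subst index_mat_mult_sum[of _ _ _ _ n]) auto
    also have "\<dots> = conjugate (?R $$ (i, k)) * ?R $$ (i, l) + (conjugate (?R $$ (j, k)) * ?R $$ (j, l) +
        (\<Sum>a\<in>{..<n} - {i} - {j}. conjugate (?R $$ (a, k)) * ?R $$ (a, l)))"
      by (rule sum_remove2[OF ij])
    also have "(\<Sum>a\<in>{..<n} - {i} - {j}. conjugate (?R $$ (a, k)) * ?R $$ (a, l)) =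
        (\<Sum>a\<in>{..<n} - {i} - {j}. if a = k then (if k = l then 1 else 0) else 0)"
      using kl by (intro sum.cong refl) (auto simp: rotation_mat_def real real')
    also have "\<dots> = (if k \<noteq> i \<and> k \<noteq> j \<and> k = l then 1 else 0)" using kl by simp
    finally show "(mat_adjoint ?R * ?R) $$ (k, l) = 1\<^sub>m n $$ (k, l)"
      using ij kl sc by (auto simp: rotation_mat_def real real' add.commute)
  qed (use R in auto)
qed

lemma lin_app_rotation:
  assumes ij: "i < n" "j < n" "i \<noteq> j" and k: "k < n"
  shows "lin_app n (emb_mat (rotation_mat n i j \<phi>)) x k = plane_rotation i j \<phi> x k"
proof -
  let ?R = "rotation_mat n i j \<phi> :: 'a mat"
  have "lin_app n (emb_mat ?R) x k = emb_mat ?R k i * x i + (emb_mat ?R k j * x j +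
      (\<Sum>l\<in>{..<n} - {i} - {j}. emb_mat ?R k l * x l))"
    unfolding lin_app_def by (rule sum_remove2[OF ij])
  also have "(\<Sum>l\<in>{..<n} - {i} - {j}. emb_mat ?R k l * x l) =
      (\<Sum>l\<in>{..<n} - {i} - {j}. if l = k then x k else 0)"
    using k by (intro sum.cong refl) (auto simp: rotation_mat_def emb_mat_def)
  also have "\<dots> = (if k \<noteq> i \<and> k \<noteq> j then x k else 0)" using k by simp
  also have "emb_mat ?R k i = (if k = i then of_real (cos \<phi>) else if k = j then of_real (sin \<phi>) else 0)"
    using ij k by (simp add: rotation_mat_def emb_mat_def e_of_real)
  also have "emb_mat ?R k j = (if k = i then - of_real (sin \<phi>) else if k = j then of_real (cos \<phi>) else 0)"
    using ij k by (simp add: rotation_mat_def emb_mat_def e_of_real hom_uminus)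
  finally show ?thesis
    using ij by (auto simp: plane_rotation_def)
qed

text \<open>For fixed \<open>p\<close> the vector \<open>Y U\<close> has constant norm, and a left
  translation of \<open>U\<close> by a conjugated rotation rotates \<open>Y U\<close>; left
  invariance of the measure is therefore the required symmetry.\<close>

lemma haar_form_tail:
  fixes \<mu> :: "'a mat measure" and a :: "nat \<Rightarrow> real"
  assumes haar: "haar_distribution n \<mu>" and n: "n > 0" and S: "S \<in> unitary_group n"
    and V: "V \<in> carrier_mat n m" "mat_adjoint V * V = 1\<^sub>m m"
    and D: "\<And>i j. i < n \<Longrightarrow> j < n \<Longrightarrow> \<bar>a i - a j\<bar> \<le> D" "D > 0"
    and p: "sq_norm m p \<le> s0" "s0 > 0" and \<eta>: "\<eta> \<ge> 0"
  defines "q \<equiv> \<lambda>U. diag_form n (\<lambda>k. a k - (\<Sum>k<n. a k) / n) (lin_app m (emb_mat (mat_adjoint S * U * V)) p)"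
  shows "q \<in> borel_measurable \<mu>"
    and "measure \<mu> {U \<in> space \<mu>. \<bar>q U\<bar> > \<eta>} \<le> 2 * exp (- (n * \<eta>\<^sup>2 / (2 * D\<^sup>2 * s0\<^sup>2)))"
proof -
  interpret prob_space \<mu> using haar by (simp add: haar_distribution_def)
  note S' = unitary_groupD[OF S]
  have Sa: "mat_adjoint S \<in> carrier_mat n n" using S'(1) by simp
  define Y where "Y = (\<lambda>U. lin_app m (emb_mat (mat_adjoint S * U * V)) p)"
  define x where "x = lin_app m (emb_mat V) p"
  have Uc: "U \<in> carrier_mat n n" if "U \<in> space \<mu>" for U
    using that unitary_groupD(1) by (auto simp: space_haar[OF haar])
  have Yx: "Y U k = lin_app n (emb_mat (mat_adjoint S)) (lin_app n (emb_mat U) x) k" if "U \<in> space \<mu>" "k < n" for U k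
  proof -
    have "Y U k = lin_app n (emb_mat (mat_adjoint S * U)) x k"
      unfolding Y_def x_def by (rule lin_app_mult[OF mult_carrier_mat[OF Sa Uc[OF that(1)]] V(1) that(2)])
    also have "\<dots> = lin_app n (emb_mat (mat_adjoint S)) (lin_app n (emb_mat U) x) k"
      by (rule lin_app_mult[OF Sa Uc[OF that(1)] that(2)])
    finally show ?thesis .
  qed
  have Y_meas: "(\<lambda>U. Y U k) \<in> borel_measurable \<mu>" if k: "k < n" for k
  proof -
    have "(\<lambda>U. lin_app n (emb_mat (mat_adjoint S)) (lin_app n (emb_mat U) x) k) \<in> borel_measurable \<mu>"
      unfolding lin_app_def emb_mat_def
      by (intro borel_measurable_sum borel_measurable_times borel_measurable_const
          measurable_compose[OF measurable_haar_entry[OF haar] measurable_e]) auto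
    then show ?thesis using Yx[OF _ k] by (subst measurable_cong) auto
  qed
  have Y_norm: "(\<Sum>k<n. (cmod (Y U k))\<^sup>2) = sq_norm m p" if U: "U \<in> space \<mu>" for U
  proof -
    have "U \<in> unitary_group n" using U by (simp add: space_haar[OF haar])
    have iso: "sq_norm n (lin_app n (emb_mat A) y) = sq_norm n y" if "A \<in> unitary_group n" for A y
      using unitary_groupD[OF that] by (intro sq_norm_orthonormal) auto
    have "(\<Sum>k<n. (cmod (Y U k))\<^sup>2) = sq_norm n (lin_app n (emb_mat (mat_adjoint S)) (lin_app n (emb_mat U) x))"
      unfolding sq_norm_def using Yx[OF U] by (intro sum.cong) auto
    also have "\<dots> = sq_norm n x"
      using iso[OF unitary_group_adjoint[OF S]] iso[OF \<open>U \<in> unitary_group n\<close>] by simp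
    also have "\<dots> = sq_norm m p" unfolding x_def by (rule sq_norm_orthonormal[OF V])
    finally show ?thesis .
  qed
  \<comment> \<open>Because the norm of \<open>Y U\<close> is constant, subtracting the mean from
    the weights is the same as centring the form.\<close>
  have qY: "q U = (\<Sum>k<n. a k * (cmod (Y U k))\<^sup>2) - sq_norm m p * (\<Sum>k<n. a k) / n" if U: "U \<in> space \<mu>" for U
  proof -
    have "q U = (\<Sum>k<n. a k * (cmod (Y U k))\<^sup>2) - (\<Sum>k<n. a k) / n * (\<Sum>k<n. (cmod (Y U k))\<^sup>2)"
      unfolding q_def diag_form_def sum_distrib_left sum_subtractf[symmetric]
      by (simp add: Y_def left_diff_distrib)
    then show ?thesis unfolding Y_norm[OF U] by (simp add: mult.commute)
  qed
  have F_meas: "(\<lambda>U. (\<Sum>k<n. a k * (cmod (Y U k))\<^sup>2) - sq_norm m p * (\<Sum>k<n. a k) / n) \<in> borel_measurable \<mu>"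
    using Y_meas
    by (intro borel_measurable_diff borel_measurable_sum borel_measurable_times borel_measurable_const
        borel_measurable_power borel_measurable_norm) auto
  then show "q \<in> borel_measurable \<mu>" using qY by (subst measurable_cong) auto
  have "prob {U \<in> space \<mu>. \<bar>(\<Sum>k<n. a k * (cmod (Y U k))\<^sup>2) - sq_norm m p * (\<Sum>k<n. a k) / n\<bar> > \<eta>} \<le>
      2 * exp (- (n * \<eta>\<^sup>2 / (2 * D\<^sup>2 * s0\<^sup>2)))"
  proof (rule rotation_invariant_concentration[OF n Y_meas Y_norm _ D p \<eta>])
    fix i j \<phi> assume ij: "i < n" "j < n" "i \<noteq> j"
    let ?R = "rotation_mat n i j \<phi> :: 'a mat"
    note R = rotation_mat_unitary[OF ij, of \<phi>]
    note R' = unitary_groupD(1)[OF R]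
    \<comment> \<open>Conjugating by \<open>S\<close> lets the rotation pass through the fixed
      factor: \<open>mat_adjoint S * Q = ?R * mat_adjoint S\<close>.\<close>
    define Q where "Q = S * ?R * mat_adjoint S"
    have Q: "Q \<in> unitary_group n"
      unfolding Q_def by (intro unitary_group_mult S R unitary_group_adjoint)
    note Q' = unitary_groupD(1)[OF Q]
    show "\<exists>\<tau>. (\<forall>g::'a mat \<Rightarrow> real. g \<in> borel_measurable \<mu> \<longrightarrow> expectation (\<lambda>\<omega>. g (\<tau> \<omega>)) = expectation g) \<and>
          (\<forall>\<omega>\<in>space \<mu>. \<forall>k<n. Y (\<tau> \<omega>) k = plane_rotation i j \<phi> (Y \<omega>) k)"
    proof (intro exI[of _ "\<lambda>U. Q * U"] conjI allI impI ballI)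
      show "expectation (\<lambda>U. g (Q * U)) = expectation g" if "g \<in> borel_measurable \<mu>" for g :: "'a mat \<Rightarrow> real"
        by (rule integral_haar_mult[OF haar Q that])
      fix U k assume U: "U \<in> space \<mu>" and k: "k < n"
      have QU: "Q * U \<in> space \<mu>"
        using U unitary_group_mult[OF Q] by (simp add: space_haar[OF haar])
      have SU: "mat_adjoint S * U \<in> carrier_mat n n" using mult_carrier_mat[OF Sa Uc[OF U]] .
      have "mat_adjoint S * Q = ?R * mat_adjoint S"
      proof -
        have "mat_adjoint S * Q = mat_adjoint S * (S * (?R * mat_adjoint S))"
          unfolding Q_def using assoc_mult_mat[OF S'(1) R' Sa] by simp
        also have "\<dots> = (mat_adjoint S * S) * (?R * mat_adjoint S)"
          by (rule assoc_mult_mat[OF Sa S'(1) mult_carrier_mat[OF R' Sa], symmetric])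
        finally show ?thesis unfolding S'(2) left_mult_one_mat[OF mult_carrier_mat[OF R' Sa]] .
      qed
      then have SQU: "mat_adjoint S * (Q * U) * V = ?R * (mat_adjoint S * U * V)"
        unfolding assoc_mult_mat[OF Sa Q' Uc[OF U], symmetric]
        using assoc_mult_mat[OF R' Sa Uc[OF U]] assoc_mult_mat[OF R' SU V(1)] by simp
      have "Y (Q * U) k = lin_app n (emb_mat ?R) (Y U) k"
        unfolding Y_def SQU by (rule lin_app_mult[OF R' mult_carrier_mat[OF SU V(1)] k])
      then show "Y (Q * U) k = plane_rotation i j \<phi> (Y U) k"
        by (simp add: lin_app_rotation[OF ij k])
    qed
  qed
  also have "{U \<in> space \<mu>. \<bar>(\<Sum>k<n. a k * (cmod (Y U k))\<^sup>2) - sq_norm m p * (\<Sum>k<n. a k) / n\<bar> > \<eta>} =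
      {U \<in> space \<mu>. \<bar>q U\<bar> > \<eta>}" using qY by auto
  finally show "measure \<mu> {U \<in> space \<mu>. \<bar>q U\<bar> > \<eta>} \<le> 2 * exp (- (n * \<eta>\<^sup>2 / (2 * D\<^sup>2 * s0\<^sup>2)))" .
qed

text \<open>A union bound over the net at level \<open>\<epsilon> / 3\<close>, since passing from
  the net to all vectors costs a factor 3. The event does not depend on \<open>y\<close>, so the
  bound may later be used for vectors that depend on \<open>U\<close>.\<close>

lemma haar_form_concentration:
  fixes \<mu> :: "'a mat measure" and a :: "nat \<Rightarrow> real"
  assumes haar: "haar_distribution n \<mu>" and n: "n > 0" and S: "S \<in> unitary_group n"
    and V: "V \<in> carrier_mat n m" "mat_adjoint V * V = 1\<^sub>m m" and m: "m > 0"
    and D: "\<And>i j. i < n \<Longrightarrow> j < n \<Longrightarrow> \<bar>a i - a j\<bar> \<le> D" "D > 0" and \<epsilon>: "\<epsilon> \<ge> 0"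
  obtains E where "E \<in> sets \<mu>"
    "1 - measure \<mu> E \<le> 2 * (9 * 2 ^ 50) ^ m * exp (- (n * \<epsilon>\<^sup>2 / (18 * D\<^sup>2 * (25 / 16)\<^sup>2)))"
    "\<And>U y. U \<in> E \<Longrightarrow> \<bar>diag_form n (\<lambda>k. a k - (\<Sum>k<n. a k) / n)
      (lin_app m (emb_mat (mat_adjoint S * U * V)) y)\<bar> \<le> \<epsilon> * sq_norm m y"
proof -
  interpret prob_space \<mu> using haar by (simp add: haar_distribution_def)
  define c where "c = (\<lambda>k. a k - (\<Sum>k<n. a k) / n)"
  define q where "q = (\<lambda>p U. diag_form n c (lin_app m (emb_mat (mat_adjoint S * U * V)) p))"
  obtain Net where Net: "finite Net" "real (card Net) \<le> (9 * 2 ^ 50) ^ m"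
    "\<And>p. p \<in> Net \<Longrightarrow> sq_norm m p \<le> 25 / 16"
    "\<And>y. sq_norm m y = 1 \<Longrightarrow> \<exists>p\<in>Net. sq_norm m (\<lambda>j. y j - p j) \<le> 1 / 16"
    using ex_sphere_net[OF m] by blast
  have \<epsilon>3: "\<epsilon> / 3 \<ge> 0" using \<epsilon> by simp
  have s0: "(25 / 16 :: real) > 0" by simp
  define Bad where "Bad = (\<lambda>p. {U \<in> space \<mu>. \<bar>q p U\<bar> > \<epsilon> / 3})"
  have q_meas: "q p \<in> borel_measurable \<mu>" if "p \<in> Net" for p
    unfolding q_def c_def by (rule haar_form_tail(1)[OF haar n S V D Net(3)[OF that] s0 \<epsilon>3])
  have q_tail: "prob (Bad p) \<le> 2 * exp (- (n * (\<epsilon> / 3)\<^sup>2 / (2 * D\<^sup>2 * (25 / 16)\<^sup>2)))" if "p \<in> Net" for p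
    unfolding Bad_def q_def c_def by (rule haar_form_tail(2)[OF haar n S V D Net(3)[OF that] s0 \<epsilon>3])
  have Bad_meas: "Bad p \<in> sets \<mu>" if "p \<in> Net" for p
    unfolding Bad_def using q_meas[OF that] by measurable
  let ?x = "exp (- (n * \<epsilon>\<^sup>2 / (18 * D\<^sup>2 * (25 / 16)\<^sup>2)))"
  have Bad_le: "prob (Bad p) \<le> 2 * ?x" if "p \<in> Net" for p
    using q_tail[OF that] by (simp add: power_divide mult_ac)
  define E where "E = space \<mu> - (\<Union>p\<in>Net. Bad p)"
  have UBad: "(\<Union>p\<in>Net. Bad p) \<in> sets \<mu>" using Net(1) Bad_meas by (intro sets.finite_UN) auto
  have "1 - prob E = prob (\<Union>p\<in>Net. Bad p)"
    unfolding E_def using prob_compl[OF UBad] by simp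
  also have "\<dots> \<le> (\<Sum>p\<in>Net. prob (Bad p))"
    using Net(1) Bad_meas by (intro finite_measure_subadditive_finite) auto
  also have "\<dots> \<le> (\<Sum>p\<in>Net. 2 * ?x)" by (intro sum_mono Bad_le)
  also have "\<dots> = real (card Net) * (2 * ?x)" by simp
  also have "\<dots> \<le> (9 * 2 ^ 50) ^ m * (2 * ?x)" using Net(2) by (intro mult_right_mono) auto
  finally have pE: "1 - prob E \<le> 2 * (9 * 2 ^ 50) ^ m * ?x" by (simp only: mult_ac)
  have Em: "E \<in> sets \<mu>" unfolding E_def using UBad by blast
  show ?thesis
  proof (rule that[OF Em pE])
    fix U y assume U: "U \<in> E"
    then have Us: "U \<in> unitary_group n" by (simp add: E_def space_haar[OF haar])
    have SU: "mat_adjoint S * U \<in> unitary_group n" by (intro unitary_group_mult unitary_group_adjoint S Us)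
    note SU' = unitary_groupD[OF SU]
    let ?X = "emb_mat (mat_adjoint S * U * V)"
    have iso: "sq_norm n (lin_app m ?X y) = sq_norm m y" for y
    proof -
      have "sq_norm n (lin_app m ?X y) = sq_norm n (lin_app n (emb_mat (mat_adjoint S * U)) (lin_app m (emb_mat V) y))"
        unfolding sq_norm_def by (intro sum.cong refl) (simp add: lin_app_mult[OF SU'(1) V(1)])
      then show ?thesis unfolding sq_norm_orthonormal[OF SU'(1,2)] sq_norm_orthonormal[OF V] .
    qed
    have "\<bar>diag_form n c (lin_app m ?X y)\<bar> \<le> 3 * (\<epsilon> / 3) * sq_norm m y"
    proof (rule form_bounded_by_net[OF iso _ Net(3,4)])
      show "\<bar>c k\<bar> \<le> (\<Sum>k<n. \<bar>c k\<bar>)" if "k < n" for k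
        using that by (intro member_le_sum) auto
      show "\<bar>diag_form n c (lin_app m ?X p)\<bar> \<le> \<epsilon> / 3" if "p \<in> Net" for p
        using U that by (auto simp: E_def Bad_def q_def not_less)
    qed
    then show "\<bar>diag_form n (\<lambda>k. a k - (\<Sum>k<n. a k) / n) (lin_app m ?X y)\<bar> \<le> \<epsilon> * sq_norm m y"
      by (simp add: c_def)
  qed
qed

end

section \<open>Outlier eigenvectors\<close>

text \<open>The sub-Gaussian exponent: \<open>18 = 2 * 3\<^sup>2\<close> contains the level
  \<open>\<epsilon> / 3\<close>, \<open>25 / 16\<close> bounds the squared norm of net points, and
  \<open>1 / \<delta> + 1 / \<delta>\<^sup>2\<close> bounds the oscillation of the resolvent weights
  and of their squares.\<close>

definition rate_const :: "real \<Rightarrow> real" where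
  "rate_const \<delta> = 1 / (18 * (1 / \<delta> + 1 / \<delta>\<^sup>2)\<^sup>2 * (25 / 16)\<^sup>2)"

context scalar_embedding
begin

lemma eigval_list_facts:
  fixes A :: "'a mat"
  assumes A: "hermitian_mat n A"
  shows "length (eigval_list A) = n" and "sorted_wrt (\<ge>) (eigval_list A)"
    and "\<And>k l. k \<le> l \<Longrightarrow> l < n \<Longrightarrow> eigval_list A ! l \<le> eigval_list A ! k"
    and "\<And>k. k < n \<Longrightarrow> \<bar>eigval_list A ! k\<bar> \<le> mat_opnorm A"
proof -
  obtain ls where ls: "length ls = n" "sorted_wrt (\<ge>) ls" "eigval_list A = ls"
    "char_poly A = (\<Prod>l\<leftarrow>ls. [:- of_real l, 1:])" by (rule hermitian_char_poly[OF A])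
  show "length (eigval_list A) = n" "sorted_wrt (\<ge>) (eigval_list A)" using ls by simp_all
  show "eigval_list A ! l \<le> eigval_list A ! k" if "k \<le> l" "l < n" for k l
    using ls(1,2) that sorted_wrt_nth_less[of "(\<ge>)" ls k l] unfolding ls(3) by (cases "k = l") auto
  show "\<bar>eigval_list A ! k\<bar> \<le> mat_opnorm A" if "k < n" for k
  proof -
    have Ac: "A \<in> carrier_mat n n" by (rule hermitian_matD[OF A])
    have "poly (\<Prod>l\<leftarrow>xs. [:- of_real l, 1:]) (of_real x) = (0 :: 'a)" if "x \<in> set xs" for x :: real and xs
      using that by (induction xs) auto
    then have "poly (char_poly A) (of_real (ls ! k)) = 0" unfolding ls(4) using that ls(1) by simp
    then have "eigenvalue A (of_real (ls ! k))" using eigenvalue_root_char_poly[OF Ac] by simp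
    from eigenvalue_le_opnorm[OF Ac this] show ?thesis unfolding ls(3) by simp
  qed
qed

lemma nonzero_eigval_facts:
  fixes P :: "'a mat"
  assumes P: "hermitian_mat n P" and rank: "vec_space.rank n P = m"
  shows "m \<le> n"
    and "\<And>j l. j \<le> l \<Longrightarrow> l < m \<Longrightarrow> nonzero_eigval P (l + 1) \<le> nonzero_eigval P (j + 1)"
    and "\<And>j. j < m \<Longrightarrow> nonzero_eigval P (j + 1) \<noteq> 0"
    and "\<And>j. j < m \<Longrightarrow> \<bar>nonzero_eigval P (j + 1)\<bar> \<le> mat_opnorm P"
proof -
  define fs where "fs = filter (\<lambda>l. l \<noteq> 0) (eigval_list P)"
  have len: "length fs = m" using length_nonzero_eigvals[OF P] rank by (simp add: fs_def)
  have nz: "nonzero_eigval P (j + 1) = fs ! j" for j by (simp add: nonzero_eigval_def fs_def)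
  show "m \<le> n" unfolding len[symmetric] eigval_list_facts(1)[OF P, symmetric] fs_def by (rule length_filter_le)
  have sorted: "sorted_wrt (\<ge>) fs" unfolding fs_def by (intro sorted_wrt_filter eigval_list_facts(2)[OF P])
  show "nonzero_eigval P (l + 1) \<le> nonzero_eigval P (j + 1)" if "j \<le> l" "l < m" for j l
    unfolding nz using that sorted_wrt_nth_less[OF sorted, of j l] len by (cases "j = l") auto
  have mem: "fs ! j \<in> set fs" if "j < m" for j using that len by simp
  show "nonzero_eigval P (j + 1) \<noteq> 0" if "j < m" for j
    using mem[OF that] unfolding nz by (auto simp: fs_def)
  show "\<bar>nonzero_eigval P (j + 1)\<bar> \<le> mat_opnorm P" if "j < m" for j
  proof -
    have "fs ! j \<in> set (eigval_list P)" using mem[OF that] by (auto simp: fs_def)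
    then obtain k where "k < n" "fs ! j = eigval_list P ! k"
      using eigval_list_facts(1)[OF P] by (auto simp: in_set_conv_nth)
    then show ?thesis unfolding nz using eigval_list_facts(4)[OF P] by simp
  qed
qed

text \<open>The inverse of a restricted function is meaningful once injectivity and membership in
  the range are known. The branch below the spectrum is reflected onto the branch above it.\<close>

lemma stieltjes_stieltjes_inv:
  fixes H :: "'a mat"
  assumes H: "hermitian_mat n H" and n: "n > 0" and y: "y \<noteq> 0"
  shows "stieltjes H (stieltjes_inv H y) = y"
proof -
  define h where "h = (\<lambda>k. eigval_list H ! k)"
  have dim: "dim_row H = n" using hermitian_matD(1)[OF H] by simp
  have st: "stieltjes H = (\<lambda>z. (\<Sum>k<n. 1 / (z - h k)) / n)"
    unfolding h_def by (rule ext) (rule stieltjes_alt[OF dim])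
  note mono = eigval_list_facts(3)[OF H, folded h_def]
  show ?thesis
  proof (cases "y > 0")
    case True
    have "h k \<le> eigval H 1" if "k < n" for k using mono[of 0 k] that by (simp add: eigval_def h_def)
    note s = stieltjes_sum_inverse[where h = h, OF n this n _ True, folded st]
    have "h 0 = eigval H 1" by (simp add: eigval_def h_def)
    then show ?thesis using True s f_the_inv_into_f[of "stieltjes H" "{eigval H 1<..}" y]
      by (simp add: stieltjes_inv_def)
  next
    case False
    with y have y': "- y > 0" by simp
    let ?b = "eigval H n"
    let ?g = "\<lambda>z. (\<Sum>k<n. 1 / (z - (- h k))) / n"
    have b: "?b = h (n - 1)" by (simp add: eigval_def h_def)
    have "- h k \<le> - ?b" if "k < n" for k using mono[of k "n - 1"] that n by (simp add: b)
    note s = stieltjes_sum_inverse[where h = "\<lambda>k. - h k", OF n this _ _ y', of "n - 1"]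
    have inj: "inj_on ?g {- ?b<..}" and surj: "- y \<in> ?g ` {- ?b<..}"
      using s n b by simp_all
    \<comment> \<open>\<open>?g\<close> is the transform for the eigenvalues \<open>- h k\<close>,
      whose largest is \<open>- ?b\<close>.\<close>
    have flip: "stieltjes H z = - ?g (- z)" for z
    proof -
      have "1 / (z - h k) = - (1 / (- z - (- h k)))" for k
        by (simp only: minus_divide_right) simp
      then show ?thesis unfolding st by (simp add: sum_negf)
    qed
    have "inj_on (stieltjes H) {..<?b}"
    proof (rule inj_onI)
      fix u v assume uv: "u \<in> {..<?b}" "v \<in> {..<?b}" "stieltjes H u = stieltjes H v"
      then have "?g (- u) = ?g (- v)" unfolding flip by simp
      from inj_onD[OF inj this] uv(1,2) show "u = v" by simp
    qed
    moreover have "y \<in> stieltjes H ` {..<?b}"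
    proof -
      obtain u where "u \<in> {- ?b<..}" "- y = ?g u" using surj by blast
      then have "- u \<in> {..<?b}" "y = stieltjes H (- u)" unfolding flip by (simp_all add: minus_equation_iff)
      then show ?thesis by blast
    qed
    ultimately show ?thesis using False f_the_inv_into_f[of "stieltjes H" "{..<?b}" y]
      by (simp add: stieltjes_inv_def dim)
  qed
qed

text \<open>Joins the probabilistic and the deterministic parts: the two concentration events hold
  the two forms, and on their intersection \<open>outlier_estimates\<close> is applied to the model
  multiplied by the sign of the spike.\<close>

lemma outlier_eigenvector_bounds:
  fixes H P V :: "'a mat" and \<mu> :: "'a mat measure"
  assumes \<delta>: "\<delta> > 0"
    and H: "hermitian_mat N H" "mat_opnorm H \<le> B" and P: "hermitian_mat N P" "mat_opnorm P \<le> B"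
    and rank: "vec_space.rank N P = m" and V: "nonzero_eigenbasis N P m V"
    and haar: "haar_distribution N \<mu>" and i: "1 \<le> i" "i \<le> m"
    and pos: "nonzero_eigval P i > 0 \<longrightarrow> stieltjes_inv H (1 / nonzero_eigval P i) \<ge> eigval H 1 + 2 * \<delta>"
    and neg: "nonzero_eigval P i < 0 \<longrightarrow> stieltjes_inv H (1 / nonzero_eigval P i) \<le> eigval H N - 2 * \<delta>"
    and \<epsilon>: "0 \<le> \<epsilon>" and CB: "vector_const \<delta> B \<le> C" "norm_const \<delta> B \<le> C"
  shows "holds_with_prob_ge \<mu> (1 - 4 * exp (- rate_const \<delta> * real N * \<epsilon>\<^sup>2 + ln (9 * 2 ^ 50) * real m))
    (\<lambda>U. let \<theta> = nonzero_eigval P i;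
             W = mat_adjoint U * H * U + P;
             lam = (if \<theta> > 0 then eigval W i else eigval W (N - m + i))
         in \<forall>v. eigenvector W v (of_real lam) \<and> euclid_norm v = 1 \<longrightarrow>
              (let w = mat_adjoint V *\<^sub>v v in
               \<bar>(euclid_norm w)\<^sup>2 + 1 / (\<theta>\<^sup>2 * deriv (stieltjes H) (stieltjes_inv H (1 / \<theta>)))\<bar> \<le> \<epsilon> * C \<and>
               euclid_norm (nonzero_eigval_diag P m *\<^sub>v w - of_real \<theta> \<cdot>\<^sub>v w) \<le> \<epsilon> * C))"
  (is "holds_with_prob_ge _ _ ?Q")
proof -
  interpret prob_space \<mu> using haar by (simp add: haar_distribution_def)
  define \<theta> where "\<theta> = (\<lambda>j. nonzero_eigval P (j + 1))"
  define i0 where "i0 = i - 1"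
  have i0: "i0 < m" "i = i0 + 1" using i by (auto simp: i0_def)
  define t where "t = nonzero_eigval P i"
  have t\<theta>: "t = \<theta> i0" by (simp add: t_def \<theta>_def i0(2))
  note P\<theta> = nonzero_eigval_facts[OF P(1) rank]
  have \<theta>B: "\<bar>\<theta> j\<bar> \<le> B" if "j < m" for j using P\<theta>(4)[OF that] P(2) by (simp add: \<theta>_def)
  have t0: "t \<noteq> 0" using P\<theta>(3)[OF i0(1)] by (simp add: t\<theta> \<theta>_def)
  have N: "N > 0" using P\<theta>(1) i0(1) by linarith
  obtain S where S: "S \<in> unitary_group N" "H = S * mat_diag N (\<lambda>k. of_real (eigval_list H ! k)) * mat_adjoint S"
    by (rule spectral_theorem[OF H(1)])
  define h where "h = (\<lambda>k. eigval_list H ! k)"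
  have hB: "\<bar>h k\<bar> \<le> B" if "k < N" for k using eigval_list_facts(4)[OF H(1) that] H(2) by (simp add: h_def)
  have V': "V \<in> carrier_mat N m" "mat_adjoint V * V = 1\<^sub>m m" using V by (auto simp: nonzero_eigenbasis_def)
  have diag: "nonzero_eigval_diag P m = mat_diag m (\<lambda>j. of_real (\<theta> j))"
    by (simp add: nonzero_eigval_diag_def \<theta>_def)
  have PV: "P = V * mat_diag m (\<lambda>j. of_real (\<theta> j)) * mat_adjoint V"
    using nonzero_eigenbasis_decomposition[OF P(1) rank V] unfolding diag .
  define z where "z = stieltjes_inv H (1 / t)"
  have dim: "dim_row H = N" using hermitian_matD(1)[OF H(1)] by simp
  have st: "stieltjes H = (\<lambda>z. (\<Sum>k<N. 1 / (z - h k)) / N)"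
    unfolding h_def by (rule ext) (rule stieltjes_alt[OF dim])
  have mean: "(\<Sum>k<N. 1 / (z - h k)) / N = 1 / t"
    using stieltjes_stieltjes_inv[OF H(1) N, of "1 / t"] t0 unfolding z_def[symmetric] st by simp
  \<comment> \<open>Multiplying by the sign treats both kinds of outliers together; resolvent
    weights change sign with it, their squares do not.\<close>
  define \<sigma> where "\<sigma> = sgn t"
  have \<sigma>: "\<sigma> = 1 \<or> \<sigma> = - 1" "\<bar>\<sigma>\<bar> = 1" "\<sigma> * \<sigma> = 1" "\<sigma> * t = \<bar>t\<bar>"
    using t0 by (auto simp: \<sigma>_def sgn_if)
  have gap: "2 * \<delta> \<le> \<sigma> * z - \<sigma> * h k" if k: "k < N" for k
  proof (cases "t > 0")
    case True
    then have "h 0 + 2 * \<delta> \<le> z" using pos by (simp add: t_def[symmetric] z_def eigval_def h_def)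
    moreover have "h k \<le> h 0" using eigval_list_facts(3)[OF H(1), of 0 k] k by (simp add: h_def)
    ultimately show ?thesis using True by (simp add: \<sigma>_def)
  next
    case False
    then have "z \<le> h (N - 1) - 2 * \<delta>" using neg t0 by (simp add: t_def[symmetric] z_def eigval_def h_def)
    moreover have "h (N - 1) \<le> h k" using eigval_list_facts(3)[OF H(1), of k "N - 1"] k by (simp add: h_def)
    ultimately show ?thesis using False t0 by (simp add: \<sigma>_def)
  qed
  define a where "a = (\<lambda>k. 1 / (z - h k))"
  have \<sigma>a: "1 / (\<sigma> * z - \<sigma> * h k) = \<sigma> * a k" for k
    using \<sigma>(1) unfolding a_def by (auto simp: minus_divide_right)
  have a_bd: "\<bar>a k\<bar> \<le> 1 / (2 * \<delta>)" if k: "k < N" for k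
  proof -
    have "\<bar>a k\<bar> = \<bar>\<sigma> * a k\<bar>" unfolding abs_mult \<sigma>(2) by simp
    also have "\<dots> = 1 / (\<sigma> * z - \<sigma> * h k)" unfolding \<sigma>a[symmetric] using gap[OF k] \<delta> by simp
    also have "\<dots> \<le> 1 / (2 * \<delta>)" using gap[OF k] \<delta> by (intro frac_le) auto
    finally show ?thesis .
  qed
  define m2 where "m2 = (\<Sum>k<N. (a k)\<^sup>2) / N"
  \<comment> \<open>One oscillation bound for both families: the weights differ by at most
    \<open>1 / \<delta>\<close>, their squares by at most
    \<open>1 / \<delta>\<^sup>2\<close>.\<close>
  define D where "D = 1 / \<delta> + 1 / \<delta>\<^sup>2"
  have D: "D > 0" using \<delta> by (simp add: D_def add_pos_pos)
  have Da: "\<bar>a k - a l\<bar> \<le> D" if "k < N" "l < N" for k l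
  proof -
    have "\<bar>a k - a l\<bar> \<le> 1 / (2 * \<delta>) + 1 / (2 * \<delta>)" using a_bd[OF that(1)] a_bd[OF that(2)] by linarith
    also have "\<dots> \<le> D" using \<delta> by (simp add: D_def)
    finally show ?thesis .
  qed
  have Da2: "\<bar>(a k)\<^sup>2 - (a l)\<^sup>2\<bar> \<le> D" if "k < N" "l < N" for k l
  proof -
    have sq: "(a j)\<^sup>2 \<le> (1 / (2 * \<delta>))\<^sup>2" if "j < N" for j
    proof -
      have "\<bar>a j\<bar>\<^sup>2 \<le> (1 / (2 * \<delta>))\<^sup>2" using a_bd[OF that] by (intro power_mono) auto
      then show ?thesis by simp
    qed
    have "\<bar>(a k)\<^sup>2 - (a l)\<^sup>2\<bar> \<le> (1 / (2 * \<delta>))\<^sup>2 + (1 / (2 * \<delta>))\<^sup>2"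
      using sq[OF that(1)] sq[OF that(2)] by (intro abs_diff_le_add) simp_all
    also have "\<dots> = 1 / (2 * \<delta>\<^sup>2)" by (simp add: power_divide power_mult_distrib)
    also have "\<dots> \<le> 1 / \<delta>\<^sup>2" using \<delta> by (intro frac_le) auto
    also have "\<dots> \<le> D" using \<delta> by (simp add: D_def)
    finally show ?thesis .
  qed
  have m0: "m > 0" using i0 by linarith
  let ?x = "exp (- (N * \<epsilon>\<^sup>2 / (18 * D\<^sup>2 * (25 / 16)\<^sup>2)))"
  obtain E1 where E1: "E1 \<in> sets \<mu>" "1 - prob E1 \<le> 2 * (9 * 2 ^ 50) ^ m * ?x"
    "\<And>U y. U \<in> E1 \<Longrightarrow> \<bar>diag_form N (\<lambda>k. a k - 1 / t) (lin_app m (emb_mat (mat_adjoint S * U * V)) y)\<bar> \<le> \<epsilon> * sq_norm m y"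
    using haar_form_concentration[where a = a, OF haar N S(1) V' m0 Da D \<epsilon>] mean unfolding a_def by metis
  obtain E2 where E2: "E2 \<in> sets \<mu>" "1 - prob E2 \<le> 2 * (9 * 2 ^ 50) ^ m * ?x"
    "\<And>U y. U \<in> E2 \<Longrightarrow> \<bar>diag_form N (\<lambda>k. (a k)\<^sup>2 - m2) (lin_app m (emb_mat (mat_adjoint S * U * V)) y)\<bar> \<le> \<epsilon> * sq_norm m y"
    using haar_form_concentration[where a = "\<lambda>k. (a k)\<^sup>2", OF haar N S(1) V' m0 Da2 D \<epsilon>] unfolding m2_def by metis
  have prob: "1 - 4 * exp (- rate_const \<delta> * real N * \<epsilon>\<^sup>2 + ln (9 * 2 ^ 50) * real m) \<le> prob (E1 \<inter> E2)"
  proof -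
    have "exp (ln (9 * 2 ^ 50) * real m) = (9 * 2 ^ 50 :: real) ^ m"
      by (simp add: exp_of_nat2_mult)
    moreover have "- rate_const \<delta> * real N * \<epsilon>\<^sup>2 = - (N * \<epsilon>\<^sup>2 / (18 * D\<^sup>2 * (25 / 16)\<^sup>2))"
      by (simp add: rate_const_def D_def)
    ultimately have x: "exp (- rate_const \<delta> * real N * \<epsilon>\<^sup>2 + ln (9 * 2 ^ 50) * real m) = (9 * 2 ^ 50) ^ m * ?x"
      by (simp only: exp_add mult.commute)
    \<comment> \<open>Inclusion and exclusion; the two failure bounds, each with a factor 2, add up
      to the factor 4.\<close>
    have "prob E1 + prob E2 = prob (E1 \<union> E2) + prob (E1 \<inter> E2)"
      using E1(1) E2(1) finite_measure_Union'[OF E1(1) E2(1)] finite_measure_Diff'[OF E2(1) E1(1)]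
      by (simp add: Int_commute)
    then have "prob E1 + prob E2 \<le> 1 + prob (E1 \<inter> E2)" using prob_le_1[of "E1 \<union> E2"] by linarith
    with E1(2) E2(2) show ?thesis unfolding x by linarith
  qed
  show ?thesis
    unfolding holds_with_prob_ge_def
  proof (intro bexI[of _ "E1 \<inter> E2"] conjI ballI)
    show "E1 \<inter> E2 \<in> sets \<mu>" using E1(1) E2(1) by blast
    fix U assume U: "U \<in> E1 \<inter> E2"
    then have Us: "U \<in> unitary_group N"
      using sets.sets_into_space[OF E1(1)] by (auto simp: space_haar[OF haar])
    define W where "W = mat_adjoint U * H * U + P"
    have W: "hermitian_mat N W"
      unfolding W_def
      by (rule hermitian_mat_add[OF hermitian_mat_conj[OF H(1) unitary_groupD(1)[OF Us]] P(1)])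
    obtain T where T: "T \<in> unitary_group N" "W = T * mat_diag N (\<lambda>k. of_real (eigval_list W ! k)) * mat_adjoint T"
      by (rule spectral_theorem[OF W])
    define l where "l = (\<lambda>k. eigval_list W ! k)"
    note l_mono = eigval_list_facts(3)[OF W, folded l_def]
    define lam where "lam = (if t > 0 then eigval W i else eigval W (N - m + i))"
    define Q where "Q = mat_adjoint S * U"
    note sp = spiked_model_conjugated[OF S(1) S(2)[folded h_def] V' PV Us T(1) T(2)[unfolded W_def, folded l_def[unfolded W_def]],
        folded Q_def W_def]
    note sp' = spiked_model.scale[OF sp(1), of \<sigma>]
    let ?X = "emb_mat (Q * V)"
    \<comment> \<open>Above the spectrum \<open>J\<close> and \<open>K\<close> are the first
      \<open>i0 + 1\<close> indices. Below it they are the last \<open>m - i0\<close> indices among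
      \<open>m\<close> and among \<open>N\<close>, because negative spikes are matched with
      eigenvalues counted from the bottom. In both cases \<open>k0\<close> is the position of
      \<open>lam\<close>, and ties do no harm.\<close>
    have "\<exists>J K k0. J \<subseteq> {..<m} \<and> i0 \<in> J \<and> (\<forall>j\<in>J. \<sigma> * t \<le> \<sigma> * \<theta> j) \<and>
        (\<forall>j<m. j \<notin> J - {i0} \<longrightarrow> \<sigma> * \<theta> j \<le> \<sigma> * t) \<and> K \<subseteq> {..<N} \<and> card K = card J \<and> k0 \<in> K \<and>
        (\<forall>k\<in>K. \<sigma> * lam \<le> \<sigma> * l k) \<and> (\<forall>k<N. k \<notin> K - {k0} \<longrightarrow> \<sigma> * l k \<le> \<sigma> * lam)"
    proof (cases "t > 0")
      case True
      then have "\<sigma> = 1" by (simp add: \<sigma>_def)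
      moreover have "lam = l i0" using True by (simp add: lam_def eigval_def l_def i0_def)
      ultimately show ?thesis
        using i0(1) P\<theta>(1) P\<theta>(2) l_mono
        by (intro exI[of _ "{..i0}"] exI[of _ i0]) (auto simp: t\<theta> \<theta>_def)
    next
      case False
      then have "\<sigma> = - 1" using t0 by (simp add: \<sigma>_def)
      \<comment> \<open>Positions in the list count from 0 and \<open>eigval\<close> from 1, so
        \<open>i\<close> turns into \<open>i0 = i - 1\<close>.\<close>
      moreover have "lam = l (N - m + i0)" using False by (simp add: lam_def eigval_def l_def i0(2))
      ultimately show ?thesis
        using i0(1) P\<theta>(1) P\<theta>(2) l_mono
        by (intro exI[of _ "{i0..<m}"] exI[of _ "{N - m + i0..<N}"] exI[of _ "N - m + i0"]) (auto simp: t\<theta> \<theta>_def)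
    qed
    then obtain J K k0 where ex: "J \<subseteq> {..<m} \<and> i0 \<in> J \<and> (\<forall>j\<in>J. \<sigma> * t \<le> \<sigma> * \<theta> j) \<and>
        (\<forall>j<m. j \<notin> J - {i0} \<longrightarrow> \<sigma> * \<theta> j \<le> \<sigma> * t) \<and> K \<subseteq> {..<N} \<and> card K = card J \<and> k0 \<in> K \<and>
        (\<forall>k\<in>K. \<sigma> * lam \<le> \<sigma> * l k) \<and> (\<forall>k<N. k \<notin> K - {k0} \<longrightarrow> \<sigma> * l k \<le> \<sigma> * lam)"
      by (elim exE)
    have JK: "J \<subseteq> {..<m}" "i0 \<in> J" "\<And>j. j \<in> J \<Longrightarrow> \<sigma> * t \<le> \<sigma> * \<theta> j"
        "\<And>j. j < m \<Longrightarrow> j \<notin> J - {i0} \<Longrightarrow> \<sigma> * \<theta> j \<le> \<sigma> * t" "K \<subseteq> {..<N}" "card K = card J" "k0 \<in> K"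
        "\<And>k. k \<in> K \<Longrightarrow> \<sigma> * lam \<le> \<sigma> * l k" "\<And>k. k < N \<Longrightarrow> k \<notin> K - {k0} \<Longrightarrow> \<sigma> * l k \<le> \<sigma> * lam"
      using ex by (simp_all only:) blast+
    have concl: "\<bar>(euclid_norm w)\<^sup>2 + 1 / (t\<^sup>2 * deriv (stieltjes H) z)\<bar> \<le> \<epsilon> * C \<and>
        euclid_norm (nonzero_eigval_diag P m *\<^sub>v w - of_real t \<cdot>\<^sub>v w) \<le> \<epsilon> * C"
      if ev: "eigenvector W v (of_real lam)" and v1: "euclid_norm v = 1" and w: "w = mat_adjoint V *\<^sub>v v" for v w
    proof -
      have Wc: "W \<in> carrier_mat N N" by (rule hermitian_matD[OF W])
      have v: "v \<in> carrier_vec N" "W *\<^sub>v v = of_real lam \<cdot>\<^sub>v v" using ev Wc by (auto simp: eigenvector_def)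
      define x where "x = emb_vec (Q *\<^sub>v v)"
      have wx: "lin_adj N ?X x j = emb_vec w j" if "j < m" for j
        unfolding x_def w by (rule sp(3)[OF v(1) that])
      have wc: "w \<in> carrier_vec m" using V'(1) v(1) by (simp add: w)
      have eig: "of_real (\<sigma> * lam - \<sigma> * h k) * x k = lin_app m ?X (\<lambda>j. of_real (\<sigma> * \<theta> j) * lin_adj N ?X x j) k" if "k < N" for k
      proof -
        have "lin_app m ?X (\<lambda>j. of_real (\<sigma> * \<theta> j) * lin_adj N ?X x j) k =
            of_real \<sigma> * lin_app m ?X (\<lambda>j. of_real (\<theta> j) * lin_adj N ?X x j) k"
          unfolding lin_app_scale[symmetric] by (simp add: mult.assoc)
        also have "\<dots> = of_real \<sigma> * (of_real (lam - h k) * x k)"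
          using sp(2)[OF v(1) v(2) that] by (simp add: x_def)
        finally show ?thesis by (simp add: algebra_simps)
      qed
      have form1: "\<bar>diag_form N (\<lambda>k. 1 / (\<sigma> * z - \<sigma> * h k) - 1 / (\<sigma> * t)) (lin_app m ?X y)\<bar> \<le> \<epsilon> * sq_norm m y" for y
      proof -
        have "1 / (\<sigma> * t) = \<sigma> * (1 / t)" using \<sigma>(1) by auto
        then have "(\<lambda>k. 1 / (\<sigma> * z - \<sigma> * h k) - 1 / (\<sigma> * t)) = (\<lambda>k. \<sigma> * (a k - 1 / t))"
          unfolding \<sigma>a by (simp add: right_diff_distrib)
        moreover have "U \<in> E1" using U by blast
        ultimately show ?thesis using E1(3)[of U y]
          by (simp only: diag_form_mult abs_mult \<sigma>(2) Q_def mult_1)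
      qed
      have sq: "(1 / (\<sigma> * z - \<sigma> * h k))\<^sup>2 = (a k)\<^sup>2" for k
        unfolding \<sigma>a using \<sigma>(1) by auto
      have form2: "\<bar>diag_form N (\<lambda>k. (1 / (\<sigma> * z - \<sigma> * h k))\<^sup>2 - m2) (lin_app m ?X y)\<bar> \<le> \<epsilon> * sq_norm m y" for y
        unfolding sq using E2(3)[of U y] U by (simp add: Q_def)
      have mean': "(\<Sum>k<N. 1 / (\<sigma> * z - \<sigma> * h k)) / N = 1 / (\<sigma> * t)"
      proof -
        have "(\<Sum>k<N. 1 / (\<sigma> * z - \<sigma> * h k)) / N = \<sigma> * ((\<Sum>k<N. a k) / N)"
          unfolding \<sigma>a by (simp add: sum_distrib_left)
        also have "\<dots> = \<sigma> * (1 / t)" using mean by (simp add: a_def)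
        also have "\<dots> = 1 / (\<sigma> * t)" using \<sigma>(1) by auto
        finally show ?thesis .
      qed
      have tB: "0 < \<sigma> * t" "\<sigma> * t \<le> B" using t0 \<theta>B[OF i0(1), folded t\<theta>] \<sigma>(4) by simp_all
      have hB': "\<bar>\<sigma> * h k\<bar> \<le> B" if "k < N" for k using hB[OF that] \<sigma>(2) by (simp add: abs_mult)
      have \<theta>B': "\<bar>\<sigma> * \<theta> j\<bar> \<le> B" if "j < m" for j using \<theta>B[OF that] \<sigma>(2) by (simp add: abs_mult)
      have m2': "m2 = (\<Sum>k<N. (1 / (\<sigma> * z - \<sigma> * h k))\<^sup>2) / N" unfolding sq m2_def ..
      have x1: "sq_norm N x = 1" unfolding x_def sp(4)[OF v(1)] v1 by simp
      note est = spiked_model.outlier_estimates[OF sp' N gap hB' \<delta> tB mean' m2' form1 form2 \<epsilon> \<theta>B' JK eig x1]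
      have wn: "(euclid_norm w)\<^sup>2 = sq_norm m (lin_adj N ?X x)"
        unfolding euclid_norm_emb using wc wx by (simp add: sq_norm_nonneg) (simp add: sq_norm_def)
      \<comment> \<open>The derivative is negative, which explains the plus sign in the claim:
        \<open>1 / (t\<^sup>2 * deriv (stieltjes H) z)\<close> is
        \<open>- 1 / (m2 * t\<^sup>2)\<close>.\<close>
      have "deriv (stieltjes H) z = - m2"
      proof -
        have "z \<noteq> h k" if "k < N" for k using gap[OF that] \<delta> by auto
        from deriv_stieltjes_sum[of N z h, OF this] show ?thesis unfolding st m2_def a_def .
      qed
      then have "(euclid_norm w)\<^sup>2 + 1 / (t\<^sup>2 * deriv (stieltjes H) z) =
          sq_norm m (lin_adj N ?X x) - 1 / (m2 * (\<sigma> * t)\<^sup>2)"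
        unfolding wn \<sigma>(4) by (simp add: mult.commute)
      then have 1: "\<bar>(euclid_norm w)\<^sup>2 + 1 / (t\<^sup>2 * deriv (stieltjes H) z)\<bar> \<le> \<epsilon> * norm_const \<delta> B"
        using est(2) by simp
      let ?r = "nonzero_eigval_diag P m *\<^sub>v w - of_real t \<cdot>\<^sub>v w"
      have rc: "?r \<in> carrier_vec m"
        unfolding diag by (rule minus_carrier_vec[OF mult_mat_vec_carrier[OF mat_diag_carrier wc]]) (use wc in simp)
      have r: "emb_vec ?r j = of_real (\<theta> j) * emb_vec w j - of_real t * emb_vec w j" if j: "j < m" for j
      proof -
        have "emb_vec (mat_diag m (\<lambda>j. of_real (\<theta> j)) *\<^sub>v w) j = of_real (\<theta> j) * emb_vec w j"
          using emb_mult_vec[OF mat_diag_carrier wc j] lin_app_diag[OF j] by simp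
        then show ?thesis using wc j
          by (simp add: diag emb_vec_def e_mult e_of_real hom_minus)
      qed
      have r_norm: "sq_norm m (emb_vec ?r) = sq_norm m (\<lambda>j. of_real (\<sigma> * \<theta> j) * lin_adj N ?X x j - of_real (\<sigma> * t) * lin_adj N ?X x j)"
        unfolding sq_norm_def
      proof (intro sum.cong refl)
        fix j assume "j \<in> {..<m}"
        then have j: "j < m" by simp
        have "of_real (\<sigma> * \<theta> j) * lin_adj N ?X x j - of_real (\<sigma> * t) * lin_adj N ?X x j = of_real \<sigma> * emb_vec ?r j"
          unfolding r[OF j] wx[OF j] by (simp add: algebra_simps)
        then show "(cmod (emb_vec ?r j))\<^sup>2 = (cmod (of_real (\<sigma> * \<theta> j) * lin_adj N ?X x j - of_real (\<sigma> * t) * lin_adj N ?X x j))\<^sup>2"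
          using \<sigma>(2) by (simp add: norm_mult)
      qed
      have 2: "euclid_norm ?r \<le> \<epsilon> * vector_const \<delta> B"
        unfolding euclid_norm_emb carrier_vecD[OF rc] r_norm by (rule est(1))
      have "\<epsilon> * vector_const \<delta> B \<le> \<epsilon> * C" "\<epsilon> * norm_const \<delta> B \<le> \<epsilon> * C"
        using CB \<epsilon> by (simp_all add: mult_left_mono)
      with 1 2 show ?thesis by linarith
    qed
    then show "?Q U"
      unfolding Let_def W_def lam_def z_def t_def by blast
  qed (use prob in simp)
qed

end

interpretation real_embedding: scalar_embedding complex_of_real
  by unfold_locales auto

interpretation complex_embedding: scalar_embedding "\<lambda>x :: complex. x"
  by unfold_locales auto

lemma error_consts_pos:
  assumes "\<delta> > 0" "B > 0"
  shows "0 < vector_const \<delta> B" "0 < norm_const \<delta> B" "0 < rate_const \<delta>"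
proof -
  show "0 < vector_const \<delta> B" "0 < norm_const \<delta> B"
    using assms by (auto simp: vector_const_def norm_const_def intro!: add_pos_pos mult_pos_pos divide_pos_pos)
  have "0 < 1 / \<delta> + 1 / \<delta>\<^sup>2" using assms by (intro add_pos_pos) auto
  then show "0 < rate_const \<delta>" unfolding rate_const_def by (intro divide_pos_pos mult_pos_pos zero_less_power) auto
qed

theorem theorem2p7:
  fixes \<delta> B :: real
  assumes "\<delta> > 0" and "B > 0"
  shows "\<exists>c\<^sub>1 c\<^sub>2 C C\<^sub>B :: real. c\<^sub>1 > 0 \<and> c\<^sub>2 > 0 \<and> C > 0 \<and> C\<^sub>B > 0 \<and>
     (\<forall>M::nat \<Rightarrow> nat. (\<lambda>N. real (M N)) \<in> o(\<lambda>N. real N) \<longrightarrow>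
       (\<forall>N (H::real mat) (P::real mat) (V::real mat) (\<mu>::real mat measure) i \<epsilon>.
          hermitian_mat N H \<and> mat_opnorm H \<le> B \<and>
          hermitian_mat N P \<and> mat_opnorm P \<le> B \<and>
          vec_space.rank N P = M N \<and>
          nonzero_eigenbasis N P (M N) V \<and>
          haar_distribution N \<mu> \<and>
          1 \<le> i \<and> i \<le> M N \<and>
          (nonzero_eigval P i > 0 \<longrightarrow>
             stieltjes_inv H (1 / nonzero_eigval P i) \<ge> eigval H 1 + 2 * \<delta>) \<and>
          (nonzero_eigval P i < 0 \<longrightarrow>
             stieltjes_inv H (1 / nonzero_eigval P i) \<le> eigval H N - 2 * \<delta>) \<and>
          0 \<le> \<epsilon> \<and> \<epsilon> \<le> \<delta> \<longrightarrow>
          holds_with_prob_ge \<mu>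
            (1 - C * exp (- c\<^sub>1 * real N * \<epsilon>\<^sup>2 + c\<^sub>2 * real (M N)))
            (\<lambda>U. let \<theta> = nonzero_eigval P i;
                     W = mat_adjoint U * H * U + P;
                     lam = (if \<theta> > 0 then eigval W i else eigval W (N - M N + i))
                 in \<forall>v. eigenvector W v (of_real lam) \<and> euclid_norm v = 1 \<longrightarrow>
                      (let w = mat_adjoint V *\<^sub>v v in
                       \<bar>(euclid_norm w)\<^sup>2
                          + 1 / (\<theta>\<^sup>2 * deriv (stieltjes H) (stieltjes_inv H (1 / \<theta>)))\<bar>
                         \<le> \<epsilon> * C\<^sub>B \<and>
                       euclid_norm (nonzero_eigval_diag P (M N) *\<^sub>v w - of_real \<theta> \<cdot>\<^sub>v w)
                         \<le> \<epsilon> * C\<^sub>B)))) \<and>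
     (\<forall>M::nat \<Rightarrow> nat. (\<lambda>N. real (M N)) \<in> o(\<lambda>N. real N) \<longrightarrow>
       (\<forall>N (H::complex mat) (P::complex mat) (V::complex mat) (\<mu>::complex mat measure) i \<epsilon>.
          hermitian_mat N H \<and> mat_opnorm H \<le> B \<and>
          hermitian_mat N P \<and> mat_opnorm P \<le> B \<and>
          vec_space.rank N P = M N \<and>
          nonzero_eigenbasis N P (M N) V \<and>
          haar_distribution N \<mu> \<and>
          1 \<le> i \<and> i \<le> M N \<and>
          (nonzero_eigval P i > 0 \<longrightarrow>
             stieltjes_inv H (1 / nonzero_eigval P i) \<ge> eigval H 1 + 2 * \<delta>) \<and>
          (nonzero_eigval P i < 0 \<longrightarrow>
             stieltjes_inv H (1 / nonzero_eigval P i) \<le> eigval H N - 2 * \<delta>) \<and>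
          0 \<le> \<epsilon> \<and> \<epsilon> \<le> \<delta> \<longrightarrow>
          holds_with_prob_ge \<mu>
            (1 - C * exp (- c\<^sub>1 * real N * \<epsilon>\<^sup>2 + c\<^sub>2 * real (M N)))
            (\<lambda>U. let \<theta> = nonzero_eigval P i;
                     W = mat_adjoint U * H * U + P;
                     lam = (if \<theta> > 0 then eigval W i else eigval W (N - M N + i))
                 in \<forall>v. eigenvector W v (of_real lam) \<and> euclid_norm v = 1 \<longrightarrow>
                      (let w = mat_adjoint V *\<^sub>v v in
                       \<bar>(euclid_norm w)\<^sup>2
                          + 1 / (\<theta>\<^sup>2 * deriv (stieltjes H) (stieltjes_inv H (1 / \<theta>)))\<bar>
                         \<le> \<epsilon> * C\<^sub>B \<and>
                       euclid_norm (nonzero_eigval_diag P (M N) *\<^sub>v w - of_real \<theta> \<cdot>\<^sub>v w)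
                         \<le> \<epsilon> * C\<^sub>B))))"
proof -
  define C where "C = vector_const \<delta> B + norm_const \<delta> B"
  note pos = error_consts_pos[OF assms]
  have C: "C > 0" "vector_const \<delta> B \<le> C" "norm_const \<delta> B \<le> C" using pos by (auto simp: C_def)
  have ln: "ln (9 * 2 ^ 50 :: real) > 0" by (rule ln_gt_zero) simp
  note bounds = real_embedding.outlier_eigenvector_bounds[OF assms(1) _ _ _ _ _ _ _ _ _ _ _ _ C(2,3)]
    complex_embedding.outlier_eigenvector_bounds[OF assms(1) _ _ _ _ _ _ _ _ _ _ _ _ C(2,3)]
  show ?thesis
    \<comment> \<open>\<open>ln (9 * 2 ^ 50)\<close> is the logarithm of the net size per dimension,
      and 4 counts two events with two-sided tails.\<close>
    by (rule exI[of _ "rate_const \<delta>"], rule exI[of _ "ln (9 * 2 ^ 50)"], rule exI[of _ 4], rule exI[of _ C],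
        intro conjI allI impI pos(3) ln C(1) zero_less_numeral; elim conjE; rule bounds; assumption)
qed

end
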